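(* $\mathrm{SL}_4(\mathbf{Z})$ is not purely matricial field. That is, there is no sequence $\{\rho_i\}_{i=1}^{\infty}$ of finite dimensional unitary representations of $\Gamma = \mathrm{SL}_4(\mathbf{Z})$ such that for every $z \in \mathbb{C}[\Gamma]$, $\lim_{i\to\infty} \|\rho_i(z)\| = \|\lambda_{\Gamma}(z)\|$.
   Context: For a discrete group $\Gamma$, let $\lambda_{\Gamma} : \Gamma \to U(\ell^2(\Gamma))$ be the left regular representation. Unitary representations are extended linearly to the complex group algebra $\mathbb{C}[\Gamma]$, and all norms are operator norms. A sequence $\{\rho_i\}_{i=1}^{\infty}$ of finite dimensional (complex) unitary representations of $\Gamma$ strongly converges to the regular representation if $\lim_{i\to\infty}\|\rho_i(z)\| = \|\lambda_{\Gamma}(z)\|$ for every $z \in \mathbb{C}[\Gamma]$. The group $\Gamma$ is purely matricial field if there exists a sequence of finite dimensional unitary representations of $\Gamma$ that strongly converges to the regular representation. *)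

theory Defs
  imports
    "HOL-Analysis.Infinite_Sum"
    "HOL-Analysis.Convex"
    "HOL-Algebra.Group"
    "Jordan_Normal_Form.Schur_Decomposition"
begin


definition SL :: "nat \<Rightarrow> int mat monoid" where
  "SL n = \<lparr>carrier = {A \<in> carrier_mat n n. det A = 1}, mult = (*), one = 1\<^sub>m n\<rparr>"

definition unitary_group :: "nat \<Rightarrow> complex mat monoid" where
  "unitary_group n =
     \<lparr>carrier = {U \<in> carrier_mat n n. U * mat_adjoint U = 1\<^sub>m n \<and> mat_adjoint U * U = 1\<^sub>m n},
      mult = (*), one = 1\<^sub>m n\<rparr>"

lemma group_SL: "group (SL n)"
proof (rule groupI)
  fix A assume A: "A \<in> carrier (SL n)"
  then have c: "A \<in> carrier_mat n n" and d: "det A = 1" by (auto simp: SL_def)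
  note adj = adj_mat[OF c]
  have "det (adj_mat A) * det A = det (adj_mat A * A)"
    using c adj(1) by (simp add: det_mult)
  also have "\<dots> = 1" using adj(3) d by simp
  finally have "det (adj_mat A) = 1" using d by simp
  then show "\<exists>B\<in>carrier (SL n). B \<otimes>\<^bsub>SL n\<^esub> A = \<one>\<^bsub>SL n\<^esub>"
    using adj d by (intro bexI[of _ "adj_mat A"]) (auto simp: SL_def)
qed (auto simp: SL_def det_mult intro: assoc_mult_mat)

lemma mat_adjoint_index:
  assumes "i < dim_col A" "j < dim_row A"
  shows "mat_adjoint A $$ (i, j) = conjugate (A $$ (j, i))"
  using assms unfolding mat_adjoint_def by (simp add: mat_of_rows_index)

lemma mat_adjoint_carrier: "A \<in> carrier_mat n m \<Longrightarrow> mat_adjoint A \<in> carrier_mat m n"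
  unfolding mat_adjoint_def by auto

lemma mat_adjoint_adjoint: "mat_adjoint (mat_adjoint (A :: complex mat)) = A"
proof -
  have A: "A \<in> carrier_mat (dim_row A) (dim_col A)" by simp
  note 1 = mat_adjoint_carrier[OF A]
  show ?thesis
    using 1 mat_adjoint_carrier[OF 1] by (intro eq_matI) (auto simp: mat_adjoint_index)
qed

lemma mat_adjoint_mult:
  assumes A: "(A :: complex mat) \<in> carrier_mat n k" and B: "B \<in> carrier_mat k m"
  shows "mat_adjoint (A * B) = mat_adjoint B * mat_adjoint A"
proof (rule eq_matI)
  note c = mat_adjoint_carrier[OF A] mat_adjoint_carrier[OF B]
    mat_adjoint_carrier[OF mult_carrier_mat[OF A B]]
  show "dim_row (mat_adjoint (A * B)) = dim_row (mat_adjoint B * mat_adjoint A)"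
    "dim_col (mat_adjoint (A * B)) = dim_col (mat_adjoint B * mat_adjoint A)"
    using c by auto
  fix i j assume "i < dim_row (mat_adjoint B * mat_adjoint A)"
    "j < dim_col (mat_adjoint B * mat_adjoint A)"
  then show "mat_adjoint (A * B) $$ (i, j) = (mat_adjoint B * mat_adjoint A) $$ (i, j)"
    using A B c by (auto simp: mat_adjoint_index scalar_prod_def sum_conjugate
        conjugate_dist_mul mult.commute intro!: sum.cong)
qed

lemma mat_adjoint_one: "mat_adjoint (1\<^sub>m n) = (1\<^sub>m n :: complex mat)"
  using mat_adjoint_carrier[of "1\<^sub>m n :: complex mat" n n]
  by (intro eq_matI) (auto simp: mat_adjoint_index)

lemma group_unitary_group: "group (unitary_group n)"
proof (rule groupI)
  fix A B assume "A \<in> carrier (unitary_group n)" "B \<in> carrier (unitary_group n)"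
  then have A: "A \<in> carrier_mat n n" "A * mat_adjoint A = 1\<^sub>m n" "mat_adjoint A * A = 1\<^sub>m n"
    and B: "B \<in> carrier_mat n n" "B * mat_adjoint B = 1\<^sub>m n" "mat_adjoint B * B = 1\<^sub>m n"
    by (auto simp: unitary_group_def)
  note a = mat_adjoint_carrier[OF A(1)] and b = mat_adjoint_carrier[OF B(1)]
  have "(A * B) * (mat_adjoint B * mat_adjoint A) = A * (B * mat_adjoint B) * mat_adjoint A"
    using A(1) B(1) a b by (simp add: assoc_mult_mat[where n\<^sub>1=n and n\<^sub>2=n and n\<^sub>3=n and n\<^sub>4=n])
  moreover have "(mat_adjoint B * mat_adjoint A) * (A * B) = mat_adjoint B * (mat_adjoint A * A) * B"
    using A(1) B(1) a b by (simp add: assoc_mult_mat[where n\<^sub>1=n and n\<^sub>2=n and n\<^sub>3=n and n\<^sub>4=n])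
  ultimately show "A \<otimes>\<^bsub>unitary_group n\<^esub> B \<in> carrier (unitary_group n)"
    using A B a b by (auto simp: unitary_group_def mat_adjoint_mult)
next
  fix A assume "A \<in> carrier (unitary_group n)"
  then show "\<exists>B\<in>carrier (unitary_group n). B \<otimes>\<^bsub>unitary_group n\<^esub> A = \<one>\<^bsub>unitary_group n\<^esub>"
    by (intro bexI[of _ "mat_adjoint A"])
      (auto simp: unitary_group_def mat_adjoint_adjoint mat_adjoint_carrier)
qed (auto simp: unitary_group_def mat_adjoint_one intro: assoc_mult_mat)

definition group_algebra :: "('g, 'b) monoid_scheme \<Rightarrow> ('g \<Rightarrow> complex) set" where
  "group_algebra G = {z. finite {g. z g \<noteq> 0} \<and> {g. z g \<noteq> 0} \<subseteq> carrier G}"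

text \<open>Only meaningful for bounded operators: the supremum of an unbounded set of reals is
  unspecified. Lemmas \<open>bdd_above_mat\<close> and \<open>bdd_above_ell2\<close> below show that this is harmless for
  the operators considered here.\<close>

definition operator_norm :: "'v set \<Rightarrow> ('v \<Rightarrow> real) \<Rightarrow> ('v \<Rightarrow> 'v) \<Rightarrow> real" where
  "operator_norm V N T = (SUP v\<in>{v \<in> V. N v \<le> 1}. N (T v))"

definition vec_norm2 :: "complex vec \<Rightarrow> real" where
  "vec_norm2 v = sqrt (\<Sum>i<dim_vec v. (cmod (v $ i))\<^sup>2)"

definition mat_operator_norm :: "nat \<Rightarrow> complex mat \<Rightarrow> real" where
  "mat_operator_norm n A = operator_norm (carrier_vec n) vec_norm2 (\<lambda>v. A *\<^sub>v v)"

definition unitary_rep :: "('g, 'b) monoid_scheme \<Rightarrow> nat \<Rightarrow> ('g \<Rightarrow> complex mat) \<Rightarrow> bool" where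
  "unitary_rep G n \<rho> \<longleftrightarrow> \<rho> \<in> hom G (unitary_group n)"

definition rep_extend :: "nat \<Rightarrow> ('g \<Rightarrow> complex mat) \<Rightarrow> ('g \<Rightarrow> complex) \<Rightarrow> complex mat" where
  "rep_extend n \<rho> z = mat n n (\<lambda>(i, j). \<Sum>g | z g \<noteq> 0. z g * \<rho> g $$ (i, j))"

text \<open>Elements of \<open>\<ell>\<^sup>2(G)\<close> are represented by their extension by zero outside \<open>carrier G\<close>.\<close>

definition ell2 :: "('g, 'b) monoid_scheme \<Rightarrow> ('g \<Rightarrow> complex) set" where
  "ell2 G = {f. (\<forall>x. x \<notin> carrier G \<longrightarrow> f x = 0) \<and> (\<lambda>x. (cmod (f x))\<^sup>2) summable_on carrier G}"

definition ell2_norm :: "('g, 'b) monoid_scheme \<Rightarrow> ('g \<Rightarrow> complex) \<Rightarrow> real" where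
  "ell2_norm G f = sqrt (\<Sum>\<^sub>\<infinity>x\<in>carrier G. (cmod (f x))\<^sup>2)"

definition left_regular ::
    "('g, 'b) monoid_scheme \<Rightarrow> 'g \<Rightarrow> ('g \<Rightarrow> complex) \<Rightarrow> ('g \<Rightarrow> complex)" where
  "left_regular G g f = (\<lambda>x. if x \<in> carrier G then f (inv\<^bsub>G\<^esub> g \<otimes>\<^bsub>G\<^esub> x) else 0)"

definition left_regular_extend ::
    "('g, 'b) monoid_scheme \<Rightarrow> ('g \<Rightarrow> complex) \<Rightarrow> ('g \<Rightarrow> complex) \<Rightarrow> ('g \<Rightarrow> complex)" where
  "left_regular_extend G z f = (\<lambda>x. \<Sum>g | z g \<noteq> 0. z g * left_regular G g f x)"

definition strongly_converges_to_regular ::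
    "('g, 'b) monoid_scheme \<Rightarrow> (nat \<Rightarrow> nat) \<Rightarrow> (nat \<Rightarrow> 'g \<Rightarrow> complex mat) \<Rightarrow> bool" where
  "strongly_converges_to_regular G d \<rho> \<longleftrightarrow>
     (\<forall>z\<in>group_algebra G.
        (\<lambda>i. mat_operator_norm (d i) (rep_extend (d i) (\<rho> i) z))
          \<longlonglongrightarrow> operator_norm (ell2 G) (ell2_norm G) (left_regular_extend G z))"

text \<open>The dimension \<open>d i\<close> of the representation \<open>\<rho> i\<close> may be any natural number, including zero (where
  every operator has norm zero).\<close>

definition purely_matricial_field :: "('g, 'b) monoid_scheme \<Rightarrow> bool" where
  "purely_matricial_field G \<longleftrightarrow>
     (\<exists>(d :: nat \<Rightarrow> nat) \<rho>. (\<forall>i. unitary_rep G (d i) (\<rho> i)) \<and> strongly_converges_to_regular G d \<rho>)"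

lemma bdd_above_ell2:
  assumes G: "group G" and z: "z \<in> group_algebra G"
  shows "\<And>f. f \<in> ell2 G \<Longrightarrow> left_regular_extend G z f \<in> ell2 G"
    and "bdd_above ((\<lambda>f. ell2_norm G (left_regular_extend G z f)) ` {f \<in> ell2 G. ell2_norm G f \<le> 1})"
proof -
  interpret group G by fact
  define S where "S = {g. z g \<noteq> 0}"
  have S: "finite S" "S \<subseteq> carrier G" using z by (auto simp: group_algebra_def S_def)
  define C where "C = (\<Sum>g\<in>S. (cmod (z g))\<^sup>2)"
  have main: "left_regular_extend G z f \<in> ell2 G \<and>
      (ell2_norm G (left_regular_extend G z f))\<^sup>2 \<le> C * (real (card S) * (ell2_norm G f)\<^sup>2)"
    if f: "f \<in> ell2 G" for f
  proof -
    let ?I = "\<Sum>\<^sub>\<infinity>x\<in>carrier G. (cmod (f x))\<^sup>2"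
    have hs: "((\<lambda>x. (cmod (f x))\<^sup>2) has_sum ?I) (carrier G)"
      using f by (auto simp: ell2_def)
    have I: "?I \<ge> 0" by (intro infsum_nonneg) auto
    have hg: "((\<lambda>x. (cmod (left_regular G g f x))\<^sup>2) has_sum ?I) (carrier G)" if "g \<in> S" for g
    proof -
      have gc: "g \<in> carrier G" using that S by auto
      have bij: "bij_betw (\<lambda>x. inv\<^bsub>G\<^esub> g \<otimes>\<^bsub>G\<^esub> x) (carrier G) (carrier G)"
        by (rule bij_betw_byWitness[where f' = "\<lambda>x. g \<otimes>\<^bsub>G\<^esub> x"])
          (use gc in \<open>auto simp: m_assoc[symmetric]\<close>)
      have "((\<lambda>x. (cmod (f (inv\<^bsub>G\<^esub> g \<otimes>\<^bsub>G\<^esub> x)))\<^sup>2) has_sum ?I) (carrier G)"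
        using hs has_sum_reindex_bij_betw[OF bij, of "\<lambda>x. (cmod (f x))\<^sup>2" ?I] by simp
      then show ?thesis
        by (rule has_sum_cong[THEN iffD1, rotated]) (auto simp: left_regular_def)
    qed
    have hB: "((\<lambda>x. \<Sum>g\<in>S. (cmod (left_regular G g f x))\<^sup>2) has_sum (\<Sum>g\<in>S. ?I)) (carrier G)"
      using S(1) hg by (induction S rule: finite_induct) (auto intro!: has_sum_add simp del: sum_constant)
    have hB': "((\<lambda>x. C * (\<Sum>g\<in>S. (cmod (left_regular G g f x))\<^sup>2)) has_sum (C * (real (card S) * ?I))) (carrier G)"
      using has_sum_cmult_right[OF hB, of C] by simp
    have le: "(cmod (left_regular_extend G z f x))\<^sup>2
        \<le> C * (\<Sum>g\<in>S. (cmod (left_regular G g f x))\<^sup>2)" for x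
    proof -
      have "cmod (left_regular_extend G z f x) \<le> (\<Sum>g\<in>S. cmod (z g) * cmod (left_regular G g f x))"
        unfolding left_regular_extend_def S_def[symmetric]
        by (rule order.trans[OF norm_sum]) (simp add: norm_mult)
      then have "(cmod (left_regular_extend G z f x))\<^sup>2
          \<le> (\<Sum>g\<in>S. cmod (z g) * cmod (left_regular G g f x))\<^sup>2"
        by (intro power_mono) auto
      also have "\<dots> \<le> C * (\<Sum>g\<in>S. (cmod (left_regular G g f x))\<^sup>2)"
        unfolding C_def by (rule Cauchy_Schwarz_ineq_sum)
      finally show ?thesis .
    qed
    have sm: "(\<lambda>x. (cmod (left_regular_extend G z f x))\<^sup>2) summable_on carrier G"
      by (rule summable_on_comparison_test[OF has_sum_imp_summable[OF hB']]) (use le in auto)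
    have "(\<Sum>\<^sub>\<infinity>x\<in>carrier G. (cmod (left_regular_extend G z f x))\<^sup>2) \<le> C * (real (card S) * ?I)"
      using sm hB' le by (intro has_sum_mono[OF has_sum_infsum[OF sm] hB']) auto
    moreover have "(\<Sum>\<^sub>\<infinity>x\<in>carrier G. (cmod (left_regular_extend G z f x))\<^sup>2) \<ge> 0"
      by (intro infsum_nonneg) auto
    ultimately show ?thesis
      using sm I by (auto simp: ell2_def ell2_norm_def left_regular_extend_def left_regular_def)
  qed
  show "\<And>f. f \<in> ell2 G \<Longrightarrow> left_regular_extend G z f \<in> ell2 G"
    using main by blast
  show "bdd_above ((\<lambda>f. ell2_norm G (left_regular_extend G z f)) ` {f \<in> ell2 G. ell2_norm G f \<le> 1})"
  proof (rule bdd_aboveI2)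
    fix f assume f: "f \<in> {f \<in> ell2 G. ell2_norm G f \<le> 1}"
    have n0: "ell2_norm G f \<ge> 0" unfolding ell2_norm_def by (intro real_sqrt_ge_zero infsum_nonneg) auto
    have C0: "C \<ge> 0" unfolding C_def by (intro sum_nonneg) auto
    have "(ell2_norm G f)\<^sup>2 \<le> 1" using f n0 by (simp add: power_le_one)
    then have "real (card S) * (ell2_norm G f)\<^sup>2 \<le> real (card S) * 1" by (intro mult_left_mono) auto
    then have "C * (real (card S) * (ell2_norm G f)\<^sup>2) \<le> C * real (card S)"
      using C0 by (intro mult_left_mono) auto
    with main[of f] f have "(ell2_norm G (left_regular_extend G z f))\<^sup>2 \<le> C * real (card S)" by auto
    then show "ell2_norm G (left_regular_extend G z f) \<le> sqrt (C * real (card S))"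
      by (rule real_le_rsqrt)
  qed
qed

lemma bdd_above_mat:
  assumes A: "A \<in> carrier_mat n n"
  shows "bdd_above ((\<lambda>v. vec_norm2 (A *\<^sub>v v)) ` {v \<in> carrier_vec n. vec_norm2 v \<le> 1})"
proof (rule bdd_aboveI2)
  fix v assume "v \<in> {v \<in> carrier_vec n. vec_norm2 v \<le> 1}"
  then have v: "dim_vec v = n" and le1: "(\<Sum>j<n. (cmod (v $ j))\<^sup>2) \<le> 1"
    by (auto simp: vec_norm2_def)
  have "(cmod ((A *\<^sub>v v) $ i))\<^sup>2 \<le> (\<Sum>j<n. (cmod (A $$ (i, j)))\<^sup>2)" if i: "i < n" for i
  proof -
    have "cmod ((A *\<^sub>v v) $ i) \<le> (\<Sum>j<n. cmod (A $$ (i, j)) * cmod (v $ j))"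
      using i A v by (auto simp: scalar_prod_def norm_mult atLeast0LessThan
          intro!: order.trans[OF norm_sum] sum_mono)
    then have "(cmod ((A *\<^sub>v v) $ i))\<^sup>2 \<le> (\<Sum>j<n. cmod (A $$ (i, j)) * cmod (v $ j))\<^sup>2"
      by (intro power_mono) auto
    also have "\<dots> \<le> (\<Sum>j<n. (cmod (A $$ (i, j)))\<^sup>2) * (\<Sum>j<n. (cmod (v $ j))\<^sup>2)"
      by (rule Cauchy_Schwarz_ineq_sum)
    also have "\<dots> \<le> (\<Sum>j<n. (cmod (A $$ (i, j)))\<^sup>2) * 1"
      using le1 by (intro mult_left_mono sum_nonneg) auto
    finally show ?thesis by simp
  qed
  then show "vec_norm2 (A *\<^sub>v v) \<le> sqrt (\<Sum>i<n. \<Sum>j<n. (cmod (A $$ (i, j)))\<^sup>2)"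
    unfolding vec_norm2_def using A by (auto intro!: sum_mono)
qed

end

theory Submission
  imports Defs "HOL-Number_Theory.Number_Theory" "HOL-Library.Function_Algebras"
begin

text \<open>The regular representation and the finite dimensional representations of \<open>SL 4\<close> are told
apart by one element of the group algebra, the sum of five hyperbolic matrices
\<open>hyperbolic m\<close> that act on the first two coordinates. They play ping-pong, so the norm of their
sum in the regular representation is at most \<open>2 * sqrt 5 < 5\<close>. In every finite dimensional
unitary representation of positive dimension they have a common nonzero fixed vector, so there
the norm of the sum is at least \<open>5\<close>.

The fixed vector comes from a description of all finite dimensional unitary representations.
An elementary matrix is a central commutator in a Heisenberg group. In a bounded group of
matrices some power of such an element generates a subgroup close to the identity, and a
subgroup close to the identity is trivial, so the element has finite order (\<open>heisenberg_center_finite_order\<close>). Hence the elementary matrices act through a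
group with the Steinberg relations over the integers modulo some \<open>N\<close>. The Chinese remainder
theorem splits this group into commuting pieces, one for each prime power \<open>q\<close> dividing \<open>N\<close>, and
one looks for vectors fixed by one piece after another (\<open>fixed_vector\<close>).

For one prime power \<open>q = p ^ n\<close>, pick a vector \<open>v\<close> that is an eigenvector of the abelian group of
elementary matrices in the last column, with a character that is primitive in coordinate \<open>b\<close> and
trivial in the others, and that is fixed by \<open>x_ab\<close> (\<open>highest_vector\<close>). Morally the stabiliser
of this character in the copy of \<open>SL_2\<close> on the coordinates \<open>a, b\<close> is the group of all
\<open>x_ab(t)\<close>, which fixes \<open>v\<close>. So the orbit of \<open>v\<close> consists of finitely many eigenvectors with
distinct characters, and the sum over the orbit is a nonzero invariant vector.

This needs that the copy of \<open>SL_2\<close> acts through \<open>SL_2\<close> of the integers modulo \<open>q\<close>, an instance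
of the congruence subgroup property. What can fail is the multiplicativity of the
diagonal elements \<open>h(u)\<close>. The defect \<open>h(u v) h(u)\<^sup>-\<^sup>1 h(v)\<^sup>-\<^sup>1\<close> is the Steinberg symbol of \<open>u\<close> and
\<open>v\<close>. It is central and bimultiplicative because it is a commutator of diagonal
elements of two different copies of \<open>SL_2\<close> inside \<open>SL_3\<close>. It is trivial when \<open>u + v\<close> is \<open>0\<close> or
\<open>1\<close>. For odd \<open>p\<close> the units modulo \<open>q\<close> are powers of one element \<open>g\<close>, so all symbols are powers of
the symbol of \<open>g\<close> with itself. This one squares to the identity, and an odd power of it is trivial
because two odd powers of \<open>g\<close> add up to \<open>0\<close> or \<open>1\<close>. For \<open>p = 2\<close> only units congruent to \<open>1\<close> modulo \<open>8\<close> are used. They are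
even powers of \<open>5\<close>, so their symbols are even powers of an involution. This is where the number
\<open>8\<close> in the hyperbolic matrices comes from.\<close>

section \<open>Actions of Steinberg groups\<close>

text \<open>\<open>X i j t\<close> is the action of the elementary matrix with entry \<open>t\<close> in position \<open>(i, j)\<close>. The parameter
\<open>t\<close> is an integer that matters only modulo \<open>q\<close>, so units are integers with an inverse modulo \<open>q\<close>.
The relations are stated for maps on a whole type: the group that acts never has to be
named, and products of group elements are nested applications, which the simplifier
rewrites without associativity laws.\<close>

locale steinberg_action =
  fixes X :: "'i \<Rightarrow> 'i \<Rightarrow> int \<Rightarrow> 'a \<Rightarrow> 'a" and q :: int
  assumes X_zero [simp]: "X i j 0 x = x"
    and X_add: "i \<noteq> j \<Longrightarrow> X i j s (X i j t x) = X i j (s + t) x"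
    and X_chain: "\<lbrakk>i \<noteq> j; j \<noteq> k; i \<noteq> k\<rbrakk> \<Longrightarrow>
      X i j s (X j k t x) = X i k (s * t) (X j k t (X i j s x))"
    and X_commute: "\<lbrakk>i \<noteq> j; k \<noteq> l; j \<noteq> k; i \<noteq> l\<rbrakk> \<Longrightarrow>
      X i j s (X k l t x) = X k l t (X i j s x)"
    and X_modulus: "i \<noteq> j \<Longrightarrow> X i j q x = x"
begin

abbreviation recip :: "int \<Rightarrow> int \<Rightarrow> bool" where
  "recip u u' \<equiv> [u * u' = 1] (mod q)"

lemma X_cong:
  assumes "i \<noteq> j" "[s = t] (mod q)"
  shows "X i j s x = X i j t x"
proof -
  have *: "X i j (q * int n) y = y" for n y
  proof (induction n)
    case (Suc n)
    have "X i j (q * int (Suc n)) y = X i j q (X i j (q * int n) y)"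
      using assms(1) by (simp add: X_add algebra_simps)
    then show ?case using Suc assms(1) by (simp add: X_modulus)
  qed simp
  have **: "X i j (s + q * int n) x = X i j s x" for s n
    using assms(1) *[of n x] by (simp flip: X_add)
  obtain k where k: "t = s + q * k"
    using assms(2) by (auto simp: cong_iff_lin)
  show ?thesis
  proof (cases "k \<ge> 0")
    case True
    then show ?thesis using **[of s "nat k"] k by simp
  next
    case False
    then have "t + q * int (nat (- k)) = s" using k by (simp add: algebra_simps)
    then show ?thesis using **[of t "nat (- k)"] by simp
  qed
qed

lemma X_minus [simp]: "i \<noteq> j \<Longrightarrow> X i j (- t) (X i j t x) = x"
  and X_minus' [simp]: "i \<noteq> j \<Longrightarrow> X i j t (X i j (- t) x) = x"
  by (simp_all add: X_add)

lemma X_chain':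
  assumes "i \<noteq> j" "j \<noteq> k" "i \<noteq> k"
  shows "X j k t (X i j s x) = X i k (- (s * t)) (X i j s (X j k t x))"
  using assms by (simp add: X_chain)

lemma X_commutator:
  assumes "i \<noteq> j" "j \<noteq> k" "i \<noteq> k"
  shows "X i j (s * t) x = X i k s (X k j t (X i k (- s) (X k j (- t) x)))"
  using assms by (simp add: X_chain[of i k j s t])

lemma recip_cancel:
  assumes "recip u u'"
  shows "[u * (u' * t) = t] (mod q)" "[u' * (u * t) = t] (mod q)"
proof -
  have "[u * u' * t = 1 * t] (mod q)" by (rule cong_scalar_right[OF assms])
  then show "[u * (u' * t) = t] (mod q)" "[u' * (u * t) = t] (mod q)"
    by (simp_all add: mult_ac)
qed

lemma X_recip:
  assumes "i \<noteq> j" "recip u u'"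
  shows "X i j (u * (u' * t)) x = X i j t x" "X i j (u' * (u * t)) x = X i j t x"
    "X i j (- (u * (u' * t))) x = X i j (- t) x" "X i j (- (u' * (u * t))) x = X i j (- t) x"
  using recip_cancel[OF assms(2)] assms(1)
  by (auto intro!: X_cong simp: cong_minus_minus_iff)

lemma recip_minus: "recip u u' \<Longrightarrow> recip (- u) (- u')" by simp
lemma recip_sym: "recip u u' \<Longrightarrow> recip u' u" by (simp add: mult.commute)
lemma recip_mult: "recip u u' \<Longrightarrow> recip v v' \<Longrightarrow> recip (u * v) (u' * v')"
  using cong_mult[of "u * u'" 1 q "v * v'" 1] by (simp add: mult_ac)
lemma recip_power: "recip u u' \<Longrightarrow> recip (u ^ n) (u' ^ n)"
  using cong_pow[of "u * u'" 1 q n] by (simp add: power_mult_distrib)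

text \<open>The element \<open>w(u) = x_ij(u) x_ji(- 1 / u) x_ij(u)\<close>, the monomial matrix with entries \<open>u\<close> and \<open>- 1 / u\<close>.
The inverse \<open>u'\<close> of \<open>u\<close> is a separate argument, so that inverses of products and powers are
given by formulas and no choice of representatives is needed.\<close>

definition W :: "'i \<Rightarrow> 'i \<Rightarrow> int \<Rightarrow> int \<Rightarrow> 'a \<Rightarrow> 'a" where
  "W i j u u' x = X i j u (X j i (- u') (X i j u x))"

lemma W_cong:
  assumes "i \<noteq> j" "[u = v] (mod q)" "[u' = v'] (mod q)"
  shows "W i j u u' x = W i j v v' x"
proof -
  have "X i j u y = X i j v y" "X j i (- u') y = X j i (- v') y" for y
    using assms by (auto intro!: X_cong simp: cong_minus_minus_iff)
  then show ?thesis unfolding W_def by simp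
qed

lemma W_inverse [simp]: "i \<noteq> j \<Longrightarrow> W i j u u' (W i j (- u) (- u') x) = x"
  "i \<noteq> j \<Longrightarrow> W i j (- u) (- u') (W i j u u' x) = x"
  unfolding W_def using X_minus[of j i u'] by auto

context
  fixes i j k :: 'i and u u' :: int
  assumes ijk: "i \<noteq> j" "j \<noteq> k" "i \<noteq> k" and uu': "recip u u'"
begin

text \<open>Moving an elementary matrix that involves a third index \<open>k\<close> through the three factors of
\<open>w(u)\<close> uses only chain relations. This gives the four conjugation formulas that follow, the same as
for monomial matrices.\<close>

lemma W_X_jk: "W i j u u' (X j k t x) = X i k (u * t) (W i j u u' x)"
proof -
  have "W i j u u' (X j k t x) = X i j u (X j i (- u') (X i k (u * t) (X j k t (X i j u x))))"
    unfolding W_def using ijk by (simp add: X_chain)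
  also have "X j i (- u') (X i k (u * t) (X j k t (X i j u x))) =
      X j k (- t) (X i k (u * t) (X j i (- u') (X j k t (X i j u x))))"
    using ijk uu' by (simp add: X_chain[of j i k] X_recip)
  also have "\<dots> = X i k (u * t) (X j k (- t) (X j k t (X j i (- u') (X i j u x))))"
    using ijk by (metis X_commute)
  also have "X i j u \<dots> = X i k (u * t) (W i j u u' x)"
    using ijk unfolding W_def by (simp add: X_commute[of i j i k])
  finally show ?thesis .
qed

lemma W_X_ik: "W i j u u' (X i k t x) = X j k (- (u' * t)) (W i j u u' x)"
proof -
  let ?y = "X j i (- u') (X i j u x)"
  have "W i j u u' (X i k t x) = X i j u (X j i (- u') (X i k t (X i j u x)))"
    unfolding W_def using ijk by (simp add: X_commute[of i j i k])
  also have "\<dots> = X i j u (X j k (- (u' * t)) (X i k t ?y))"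
    using ijk by (simp add: X_chain[of j i k])
  also have "\<dots> = X i k (- t) (X j k (- (u' * t)) (X i j u (X i k t ?y)))"
    using ijk uu' by (simp add: X_chain[of i j k] X_recip)
  also have "\<dots> = X j k (- (u' * t)) (X i k (- t) (X i k t (X i j u ?y)))"
    using ijk by (metis X_commute)
  also have "\<dots> = X j k (- (u' * t)) (W i j u u' x)"
    using ijk unfolding W_def by simp
  finally show ?thesis .
qed

lemma W_X_ki: "W i j u u' (X k i t x) = X k j (- (t * u)) (W i j u u' x)"
proof -
  let ?y = "X i j u x"
  have "W i j u u' (X k i t x) = X i j u (X j i (- u') (X k j (- (t * u)) (X k i t ?y)))"
    unfolding W_def using ijk by (simp add: X_chain'[of k i j])
  also have "X j i (- u') (X k j (- (t * u)) (X k i t ?y)) =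
     X k i (- t) (X k j (- (t * u)) (X j i (- u') (X k i t ?y)))"
    using ijk uu' X_recip(3)[of k i u u' t]
    by (simp add: X_chain'[of k j i] mult_ac)
  also have "\<dots> = X k j (- (t * u)) (X k i (- t) (X k i t (X j i (- u') ?y)))"
    using ijk by (metis X_commute)
  also have "X i j u \<dots> = X k j (- (t * u)) (W i j u u' x)"
    using ijk unfolding W_def by (simp add: X_commute[of i j k j])
  finally show ?thesis .
qed

lemma W_X_kj: "W i j u u' (X k j t x) = X k i (t * u') (W i j u u' x)"
proof -
  let ?y = "X i j u x" and ?z = "X j i (- u') (X i j u x)"
  have "W i j u u' (X k j t x) = X i j u (X j i (- u') (X k j t ?y))"
    unfolding W_def using ijk by (simp add: X_commute[of i j k j])
  also have "X j i (- u') (X k j t ?y) = X k i (t * u') (X k j t ?z)"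
    using ijk by (simp add: X_chain'[of k j i])
  also have "X i j u \<dots> = X k j (- t) (X k i (t * u') (X i j u (X k j t ?z)))"
    using ijk uu' X_recip(3)[of k j u u' t]
    by (simp add: X_chain'[of k i j] mult_ac)
  also have "\<dots> = X k i (t * u') (X k j (- t) (X k j t (X i j u ?z)))"
    using ijk by (metis X_commute)
  also have "\<dots> = X k i (t * u') (W i j u u' x)"
    using ijk unfolding W_def by simp
  finally show ?thesis .
qed

end

text \<open>No relation connects \<open>x_ij\<close> and \<open>x_ji\<close> directly. Writing \<open>x_ij\<close> as a commutator through the third
index \<open>k\<close> reduces this to the previous lemmas.\<close>

lemma W_X_ij:
  assumes "i \<noteq> j" "j \<noteq> k" "i \<noteq> k" "recip u u'"
  shows "W i j u u' (X i j t x) = X j i (- (u' * u' * t)) (W i j u u' x)"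
    and "W i j u u' (X j i t x) = X i j (- (u * u * t)) (W i j u u' x)"
proof -
  have "W i j u u' (X i j (t * 1) x) = W i j u u' (X i k t (X k j 1 (X i k (- t) (X k j (- 1) x))))"
    by (subst X_commutator[OF assms(1-3)]) simp
  also have "\<dots> = X j k (- (u' * t)) (X k i u' (X j k (u' * t) (X k i (- u') (W i j u u' x))))"
    by (simp add: W_X_ik[OF assms] W_X_kj[OF assms])
  also have "\<dots> = X j i (- (u' * t) * u') (W i j u u' x)"
    using X_commutator[of j i k "- (u' * t)" u'] assms by simp
  finally show "W i j u u' (X i j t x) = X j i (- (u' * u' * t)) (W i j u u' x)"
    by (simp add: mult_ac)
  have "W i j u u' (X j i (t * 1) x) = W i j u u' (X j k t (X k i 1 (X j k (- t) (X k i (- 1) x))))"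
    by (subst X_commutator[of j i k]) (use assms in auto)
  also have "\<dots> = X i k (u * t) (X k j (- u) (X i k (- (u * t)) (X k j u (W i j u u' x))))"
    by (simp add: W_X_jk[OF assms] W_X_ki[OF assms])
  also have "\<dots> = X i j ((u * t) * (- u)) (W i j u u' x)"
    using X_commutator[OF assms(1-3), of "u * t" "- u"] by simp
  finally show "W i j u u' (X j i t x) = X i j (- (u * u * t)) (W i j u u' x)"
    by (simp add: mult_ac)
qed

lemma W_X_other:
  assumes "i \<noteq> j" "k \<noteq> l" "k \<notin> {i, j}" "l \<notin> {i, j}"
  shows "W i j u u' (X k l t x) = X k l t (W i j u u' x)"
proof -
  have "X i j s (X k l t y) = X k l t (X i j s y)" "X j i s (X k l t y) = X k l t (X j i s y)" for s y
    using assms by (auto intro!: X_commute)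
  then show ?thesis unfolding W_def by metis
qed

text \<open>The element \<open>h(u) = w(u) w(- 1)\<close>, which lies above the diagonal matrix with entries \<open>u\<close>, \<open>1 / u\<close> at \<open>i\<close>, \<open>j\<close>.\<close>

definition H :: "'i \<Rightarrow> 'i \<Rightarrow> int \<Rightarrow> int \<Rightarrow> 'a \<Rightarrow> 'a" where
  "H i j u u' x = W i j u u' (W i j (- 1) (- 1) x)"

definition Hinv :: "'i \<Rightarrow> 'i \<Rightarrow> int \<Rightarrow> int \<Rightarrow> 'a \<Rightarrow> 'a" where
  "Hinv i j u u' x = W i j 1 1 (W i j (- u) (- u') x)"

text \<open>The diagonal entries of that matrix.\<close>

definition wt :: "'i \<Rightarrow> 'i \<Rightarrow> int \<Rightarrow> int \<Rightarrow> 'i \<Rightarrow> int" where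
  "wt a b u u' i = (if i = a then u else if i = b then u' else 1)"

lemma H_inverse [simp]: "i \<noteq> j \<Longrightarrow> H i j u u' (Hinv i j u u' x) = x"
  "i \<noteq> j \<Longrightarrow> Hinv i j u u' (H i j u u' x) = x"
proof -
  assume ij: "i \<noteq> j"
  show "H i j u u' (Hinv i j u u' x) = x"
    using W_inverse(2)[OF ij, of 1 1] W_inverse(1)[OF ij, of u u'] unfolding H_def Hinv_def by simp
  show "Hinv i j u u' (H i j u u' x) = x"
    using W_inverse(1)[OF ij, of 1 1] W_inverse(2)[OF ij, of u u'] unfolding H_def Hinv_def by simp
qed

lemma H_cong:
  assumes "i \<noteq> j" "[u = v] (mod q)" "[u' = v'] (mod q)"
  shows "H i j u u' x = H i j v v' x" "Hinv i j u u' x = Hinv i j v v' x"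
proof -
  show "H i j u u' x = H i j v v' x" unfolding H_def using W_cong[OF assms] by simp
  show "Hinv i j u u' x = Hinv i j v v' x" unfolding Hinv_def
    using W_cong[OF assms(1), of "-u" "-v" "-u'" "-v'"] assms by (simp add: cong_minus_minus_iff)
qed

lemma recip_unique:
  assumes "recip u u'" "recip v v'" "[u = v] (mod q)"
  shows "[u' = v'] (mod q)"
proof -
  have "[u' = v' * (v * u')] (mod q)"
    using recip_cancel(2)[OF assms(2), of u'] by (simp add: cong_sym)
  also have "[v' * (v * u') = v' * (u * u')] (mod q)"
    using assms(3) by (intro cong_mult cong_refl) (simp add: cong_sym)
  also have "[v' * (u * u') = v' * 1] (mod q)"
    using assms(1) by (intro cong_mult cong_refl)
  finally show ?thesis by simp
qed

lemma H_X:
  assumes "a \<noteq> b" "b \<noteq> c" "a \<noteq> c" "recip u u'" "i \<noteq> j"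
  shows "H a b u u' (X i j t x) = X i j (wt a b u u' i * wt a b u' u j * t) (H a b u u' x)"
proof -
  have m: "recip (- 1) (- 1)" by simp
  consider "i = a" "j = b" | "i = b" "j = a" | "i = a" "j \<notin> {a, b}" | "i = b" "j \<notin> {a, b}"
    | "j = a" "i \<notin> {a, b}" | "j = b" "i \<notin> {a, b}" | "i \<notin> {a, b}" "j \<notin> {a, b}"
    using assms by blast
  then show ?thesis
  proof cases
    case 1
    then show ?thesis using assms(1) unfolding H_def wt_def
      by (simp add: W_X_ij[OF assms(1-3) m] W_X_ij[OF assms(1-4)] mult.assoc)
  next
    case 2
    then show ?thesis using assms(1) unfolding H_def wt_def
      by (simp add: W_X_ij[OF assms(1-3) m] W_X_ij[OF assms(1-4)] mult.assoc)
  next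
    case 3
    then have "a \<noteq> b" "b \<noteq> j" "a \<noteq> j" using assms by auto
    from W_X_ik[OF this m] W_X_jk[OF this assms(4)] 3 show ?thesis
      using assms unfolding H_def wt_def by simp
  next
    case 4
    then have "a \<noteq> b" "b \<noteq> j" "a \<noteq> j" using assms by auto
    from W_X_jk[OF this m] W_X_ik[OF this assms(4)] 4 show ?thesis
      using assms unfolding H_def wt_def by simp
  next
    case 5
    then have "a \<noteq> b" "b \<noteq> i" "a \<noteq> i" using assms by auto
    from W_X_ki[OF this m] W_X_kj[OF this assms(4)] 5 show ?thesis
      using assms unfolding H_def wt_def by (simp add: mult.commute)
  next
    case 6
    then have "a \<noteq> b" "b \<noteq> i" "a \<noteq> i" using assms by auto
    from W_X_kj[OF this m] W_X_ki[OF this assms(4)] 6 show ?thesis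
      using assms unfolding H_def wt_def by (simp add: mult.commute)
  next
    case 7
    then show ?thesis using W_X_other[OF assms(1,5)] unfolding H_def wt_def by auto
  qed
qed

end

section \<open>Steinberg symbols\<close>

context steinberg_action
begin

text \<open>The Steinberg symbol of \<open>u\<close> and \<open>v\<close>, the defect \<open>h(u v) h(u)\<^sup>-\<^sup>1 h(v)\<^sup>-\<^sup>1\<close> of multiplicativity of \<open>h\<close>.\<close>

definition symb :: "'i \<Rightarrow> 'i \<Rightarrow> int \<Rightarrow> int \<Rightarrow> int \<Rightarrow> int \<Rightarrow> 'a \<Rightarrow> 'a" where
  "symb a b u u' v v' x = H a b (u * v) (u' * v') (Hinv a b u u' (Hinv a b v v' x))"

definition central :: "('a \<Rightarrow> 'a) \<Rightarrow> bool" where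
  "central f \<longleftrightarrow> (\<forall>i j t x. i \<noteq> j \<longrightarrow> f (X i j t x) = X i j t (f x))"

lemma central_commutes:
  assumes "central f" "a \<noteq> b"
  shows "f (H a b u u' x) = H a b u u' (f x)" "f (Hinv a b u u' x) = Hinv a b u u' (f x)"
    "f (symb a b u u' v v' x) = symb a b u u' v v' (f x)"
proof -
  have W: "f (W a b u u' x) = W a b u u' (f x)" for u u' x
    using assms unfolding W_def central_def by simp
  show H: "f (H a b u u' x) = H a b u u' (f x)" for u u' x
    unfolding H_def by (simp add: W)
  show Hi: "f (Hinv a b u u' x) = Hinv a b u u' (f x)" for u u' x
    unfolding Hinv_def by (simp add: W)
  show "f (symb a b u u' v v' x) = symb a b u u' v v' (f x)"
    unfolding symb_def by (simp add: H Hi)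
qed

lemma recip_wt: "recip u u' \<Longrightarrow> recip (wt a b u u' i) (wt a b u' u i)"
  by (auto simp: wt_def mult.commute)

lemma symb_cong:
  assumes "a \<noteq> b" "recip u u'" "recip v v'" "recip s s'" "recip t t'"
    "[u = s] (mod q)" "[v = t] (mod q)"
  shows "symb a b u u' v v' x = symb a b s s' t t' x"
proof -
  have 1: "[u' = s'] (mod q)" "[v' = t'] (mod q)"
    using assms recip_unique by blast+
  show ?thesis unfolding symb_def
    using H_cong(1)[OF assms(1) cong_mult[OF assms(6,7)] cong_mult[OF 1]]
      H_cong(2)[OF assms(1,6) 1(1)] H_cong(2)[OF assms(1,7) 1(2)] by simp
qed

lemma symb_H:
  assumes "a \<noteq> b"
  shows "symb a b u u' v v' (H a b v v' (H a b u u' x)) = H a b (u * v) (u' * v') x"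
  using assms unfolding symb_def by simp

lemma symb_surj:
  assumes "a \<noteq> b"
  shows "\<exists>y. symb a b u u' v v' y = x"
proof
  show "symb a b u u' v v' (H a b v v' (H a b u u' (Hinv a b (u * v) (u' * v') x))) = x"
    using symb_H[OF assms] assms by simp
qed

end

locale steinberg_rank_two = steinberg_action X q
  for X :: "'i \<Rightarrow> 'i \<Rightarrow> int \<Rightarrow> 'a \<Rightarrow> 'a" and q :: int +
  fixes a b c :: 'i
  assumes abc: "a \<noteq> b" "b \<noteq> c" "a \<noteq> c"
begin

lemma acb: "a \<noteq> c" "c \<noteq> b" "a \<noteq> b" using abc by auto

lemma Hinv_X:
  assumes dist: "k \<noteq> l" "l \<noteq> m" "k \<noteq> m" and "recip u u'" "i \<noteq> j"
  shows "Hinv k l u u' (X i j t x) = X i j (wt k l u' u i * wt k l u u' j * t) (Hinv k l u u' x)"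
proof -
  let ?P = "wt k l u u' i * wt k l u' u j" and ?P' = "wt k l u' u i * wt k l u u' j"
  have r: "recip ?P ?P'"
    by (intro recip_mult recip_wt assms recip_sym)
  have "H k l u u' (X i j (?P' * t) (Hinv k l u u' x)) = X i j (?P * (?P' * t)) x"
    using H_X[OF dist assms(4,5), of "?P' * t"] dist by simp
  also have "\<dots> = X i j t x" by (rule X_recip[OF assms(5) r])
  finally show ?thesis using H_inverse(2)[OF dist(1)] by metis
qed

text \<open>The diagonal matrices multiply without defect, so conjugation by the symbol rescales every
elementary matrix by \<open>1\<close>.\<close>

lemma central_symb:
  assumes dist: "k \<noteq> l" "l \<noteq> m" "k \<noteq> m" and u: "recip u u'" and v: "recip v v'"
  shows "central (symb k l u u' v v')"
  unfolding central_def
proof (intro allI impI)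
  fix i j t x assume ij: "(i :: 'i) \<noteq> j"
  let ?P = "wt k l u u' i * wt k l u' u j" and ?P' = "wt k l u' u i * wt k l u u' j"
  let ?Q = "wt k l v v' i * wt k l v' v j" and ?Q' = "wt k l v' v i * wt k l v v' j"
  have P: "recip ?P ?P'" by (intro recip_mult recip_wt u recip_sym)
  have Q: "recip ?Q ?Q'" by (intro recip_mult recip_wt v recip_sym)
  have "wt k l (u * v) (u' * v') i * wt k l (u' * v') (u * v) j = ?P * ?Q"
    by (simp add: wt_def)
  then have "symb k l u u' v v' (X i j t x) = X i j (?P * ?Q * (?P' * (?Q' * t))) (symb k l u u' v v' x)"
    unfolding symb_def
    using H_X[OF dist recip_mult[OF u v] ij] Hinv_X[OF dist u ij] Hinv_X[OF dist v ij]
    by simp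
  also have "X i j (?P * ?Q * (?P' * (?Q' * t))) y = X i j t y" for y
  proof (rule X_cong[OF ij])
    have "[?P * (?P' * (?Q * (?Q' * t))) = ?Q * (?Q' * t)] (mod q)"
      by (rule recip_cancel[OF P])
    also have "[?Q * (?Q' * t) = t] (mod q)"
      by (rule recip_cancel[OF Q])
    finally show "[?P * ?Q * (?P' * (?Q' * t)) = t] (mod q)"
      by (simp only: mult_ac)
  qed
  finally show "symb k l u u' v v' (X i j t x) = X i j t (symb k l u u' v v' x)" .
qed

lemma W_W_opposite:
  assumes "recip u u'"
  shows "W a b u u' (W a b v v' x) = W b a (- (u' * u' * v)) (- (u * u * v')) (W a b u u' x)"
  unfolding W_def[of a b v v'] W_def[of b a]
  using W_X_ij[OF abc assms] by simp

text \<open>Apply the conjugation formula to \<open>w(u)\<close> conjugated by itself.\<close>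

lemma W_opposite:
  assumes "recip u u'"
  shows "W b a u u' x = W a b (- u') (- u) x"
proof -
  have r: "recip (- u') (- u)" using assms by (simp add: mult.commute)
  let ?z = "W a b u' u x"
  have "W a b (- u') (- u) (W a b (- u') (- u) ?z) =
      W b a (- ((- u) * (- u) * (- u'))) (- ((- u') * (- u') * (- u))) (W a b (- u') (- u) ?z)"
    by (rule W_W_opposite[OF r])
  also have "W a b (- u') (- u) ?z = x" using abc by simp
  also have "W b a (- ((- u) * (- u) * (- u'))) (- ((- u') * (- u') * (- u))) x = W b a u u' x"
    using recip_cancel(1)[OF assms, of u] recip_cancel(2)[OF assms, of u'] abc
    by (intro W_cong) (simp_all add: mult_ac)
  finally show ?thesis by simp
qed

lemma W_W:
  assumes "recip u u'" "recip v v'"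
  shows "W a b u u' (W a b v v' x) = W a b (u * u * v') (u' * u' * v) (W a b u u' x)"
proof -
  have "recip (- (u' * u' * v)) (- (u * u * v'))"
    using recip_mult[OF recip_mult[OF recip_sym recip_sym, OF assms(1) assms(1)] assms(2)] by simp
  from W_opposite[OF this] show ?thesis by (simp add: W_W_opposite[OF assms(1)])
qed

text \<open>The case \<open>v = - u\<close> of multiplicativity holds because \<open>w(u) w(- 1) w(- u)\<close> is a conjugate of \<open>w(- 1)\<close>.\<close>

lemma H_H_minus:
  assumes "recip u u'"
  shows "H a b u u' (H a b (- u) (- u') x) = H a b (- (u * u)) (- (u' * u')) x"
  unfolding H_def using W_W[OF assms, of "- 1" "- 1"] abc by simp

lemma symb_minus:
  assumes "recip u u'"
  shows "symb a b u u' (- u) (- u') x = x"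
proof -
  obtain y where y: "x = H a b (- u) (- u') (H a b u u' y)"
    using H_inverse(1)[OF abc(1)] by metis
  have "H a b (- u) (- u') (H a b u u' y) = H a b (u * - u) (u' * - u') y"
    using H_H_minus[OF recip_minus[OF assms], of y] by simp
  then show ?thesis unfolding y using symb_H[OF abc(1), of u u' "-u" "-u'" y] by simp
qed

lemma symb_one: "recip u u' \<Longrightarrow> symb a b u u' 1 1 x = x"
  using abc unfolding symb_def Hinv_def[of a b 1 1] by simp

text \<open>The Steinberg relation. The proof expands \<open>w(u) w(- 1) w(v)\<close>, uses \<open>u + v = 1\<close> to merge
neighbouring factors, trades one factor \<open>x_ab(- v)\<close> for \<open>w(- v)\<close>, and moves \<open>w(- v)\<close> to the right,
where it is absorbed.\<close>

lemma W_steinberg: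
  assumes u: "recip u u'" and v: "recip v v'" and uv: "[u + v = 1] (mod q)"
  shows "W a b u u' (W a b (- 1) (- 1) (W a b v v' x)) = W a b (u * v) (u' * v') x"
proof -
  let ?X = "X a b" and ?Y = "X b a" and ?w = "W a b (- v) (- v')"
  note XY = X_add[OF abc(1)] X_add[OF abc(1)[symmetric]]
  note Xc = X_cong[OF abc(1)] and Yc = X_cong[OF abc(1)[symmetric]]
  have rv: "recip (- v) (- v')" using v by simp
  have w: "?w z = ?Y v' (?X (- v) (?Y v' z))" for z
    using W_opposite[OF recip_sym[OF v], of z] by (simp add: W_def)
  have u1: "?X (u - 1) z = ?X (- v) z" and v1: "?X (v - 1) z = ?X (- u) z" for z
    using uv by (auto intro!: Xc simp: cong_iff_dvd_diff algebra_simps)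
  have s1: "?Y (- u' - v') z = ?Y (- (u' * v')) z" for z
  proof (rule Yc)
    have "[u' * v' * (u + v) = u' * v' * 1] (mod q)"
      using uv by (intro cong_mult cong_refl)
    moreover have "[v' * (u' * u) + u' * (v' * v) = v' * 1 + u' * 1] (mod q)"
      using u v by (intro cong_add cong_mult cong_refl) (simp_all add: mult.commute)
    ultimately have "[v' * 1 + u' * 1 = u' * v' * 1] (mod q)"
      by (metis cong_sym cong_trans distrib_left mult.assoc mult.left_commute add.commute mult.commute)
    then have "[- (v' * 1 + u' * 1) = - (u' * v' * 1)] (mod q)" by (simp only: cong_minus_minus_iff)
    then show "[- u' - v' = - (u' * v')] (mod q)" by (simp add: algebra_simps)
  qed
  have s2: "?X (- (v * v * (1 - v'))) z = ?X (u * v) z" for z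
  proof (rule Xc)
    have "[v * (v * v') - v * v = v * 1 - v * v] (mod q)"
      using v by (intro cong_diff cong_mult cong_refl)
    moreover have "[v * (1 - v) = v * u] (mod q)"
      using uv by (intro cong_mult cong_refl) (simp add: cong_iff_dvd_diff dvd_diff_commute algebra_simps)
    ultimately have "[v * (v * v') - v * v = v * u] (mod q)"
      by (metis cong_trans right_diff_distrib)
    then show "[- (v * v * (1 - v')) = u * v] (mod q)" by (simp add: algebra_simps)
  qed
  have s3: "?Y (v' * v' * u + v') z = ?Y (v' * v') z" for z
  proof (rule Yc)
    have "[v' * v' * u + v' * (v' * v) = v' * v' * u + v' * 1] (mod q)"
      using v by (intro cong_add cong_mult cong_refl) (simp add: mult.commute)
    moreover have "[v' * v' * (u + v) = v' * v' * 1] (mod q)"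
      using uv by (intro cong_mult cong_refl)
    ultimately show "[v' * v' * u + v' = v' * v'] (mod q)"
      by (metis cong_sym cong_trans distrib_left mult.assoc mult.right_neutral)
  qed
  have s4: "?X (u - u * v) z = ?X (u * u) z" for z
  proof (rule Xc)
    have "[u * (1 - v) = u * u] (mod q)"
      using uv by (intro cong_mult cong_refl) (simp add: cong_iff_dvd_diff dvd_diff_commute algebra_simps)
    then show "[u - u * v = u * u] (mod q)" by (simp add: algebra_simps)
  qed
  have s5: "?X (- (u * v * (u * v) * (v' * v'))) z = ?X (- (u * u)) z" for z
  proof (rule Xc)
    have "[u * u * (v * v') * (v * v') = u * u * 1 * 1] (mod q)"
      using v by (intro cong_mult cong_refl)
    then have "[- (u * u * (v * v') * (v * v')) = - (u * u * 1 * 1)] (mod q)"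
      by (simp only: cong_minus_minus_iff)
    then show "[- (u * v * (u * v) * (v' * v')) = - (u * u)] (mod q)" by (simp add: mult_ac)
  qed
  have w1: "?w (?X v z) = ?Y (- v') (?w z)" for z
    using W_X_ij(1)[OF abc rv, of v z] X_recip(3)[OF abc(1)[symmetric] recip_sym[OF v], of v']
    by (simp add: mult_ac)
  have w2: "?w (?Y (- v') z) = ?X v (?w z)" for z
    using W_X_ij(2)[OF abc rv, of "- v'" z] X_recip(1)[OF abc(1) v, of v]
    by (simp add: mult_ac)
  have "W a b u u' (W a b (- 1) (- 1) (W a b v v' x)) =
      ?X u (?Y (- u') (?X (u - 1) (?Y 1 (?X (v - 1) (?Y (- v') (?X v x))))))"
    unfolding W_def using XY by (simp add: algebra_simps)
  also have "\<dots> = ?X u (?Y (- u') (?X (- v) (?Y 1 (?X (- u) (?Y (- v') (?X v x))))))"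
    by (simp only: u1 v1)
  also have "\<dots> = ?X u (?Y (- u' - v') (?w (?Y (1 - v') (?X (- u) (?Y (- v') (?X v x))))))"
  proof -
    have "?X (- v) (?Y 1 z) = ?Y (- v') (?w (?Y (1 - v') z))" for z
      unfolding w using XY abc by simp
    then show ?thesis using XY by simp
  qed
  also have "\<dots> = ?X u (?Y (- (u' * v')) (?X (u * v) (?Y (v' * v' * u) (?X v (?Y (- v') (?w x))))))"
  proof -
    have "?w (?X (- u) z) = ?Y (v' * v' * u) (?w z)" "?w (?Y (1 - v') z) = ?X (u * v) (?w z)" for z
      using W_X_ij[OF abc rv] s2 by simp_all
    then show ?thesis by (simp only: s1 w1 w2)
  qed
  also have "?X v (?Y (- v') (?w x)) = ?Y v' x"
    unfolding w using abc by simp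
  also have "?Y (v' * v' * u) (?Y v' x) = ?Y (v' * v') x"
    using XY s3 by simp
  also have "?X u (?Y (- (u' * v')) (?X (u * v) (?Y (v' * v') x))) =
      ?X (u - u * v) (W a b (u * v) (u' * v') (?Y (v' * v') x))"
    unfolding W_def using XY by simp
  also have "\<dots> = ?X (u * u) (?X (- (u * u)) (W a b (u * v) (u' * v') x))"
    unfolding s4 W_X_ij(2)[OF abc recip_mult[OF u v]] s5 ..
  also have "\<dots> = W a b (u * v) (u' * v') x" using abc by simp
  finally show ?thesis .
qed

lemma symb_steinberg:
  assumes u: "recip u u'" and v: "recip v v'" and uv: "[u + v = 1] (mod q)"
  shows "symb a b u u' v v' x = x"
proof -
  obtain y where y: "x = H a b v v' (H a b u u' y)"
    using H_inverse(1)[OF abc(1)] by metis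
  have "H a b v v' (H a b u u' y) = H a b (v * u) (v' * u') y"
    unfolding H_def using W_steinberg[OF v u] uv by (simp add: add.commute)
  then show ?thesis unfolding y using symb_H[OF abc(1), of u u' v v' y] by (simp add: mult.commute)
qed

text \<open>Conjugation by \<open>h_ac(u)\<close> turns \<open>w_ab(v)\<close> into \<open>w_ab(u v)\<close>, so the symbol is the commutator of
\<open>h_ac(u)\<close> and \<open>h_ab(v)\<close>. Since it is central, it is multiplicative in both arguments.\<close>

lemma symb_commutator:
  assumes u: "recip u u'" and v: "recip v v'"
  shows "H a c u u' (H a b v v' x) = symb a b u u' v v' (H a b v v' (H a c u u' x))"
proof -
  have W: "H a c u u' (W a b v v' x) = W a b (u * v) (u' * v') (H a c u u' x)" for v v' x
    unfolding W_def using H_X[OF acb u] abc by (simp add: wt_def)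
  have "H a c u u' (H a b v v' x) = W a b (u * v) (u' * v') (W a b (- u) (- u') (H a c u u' x))"
    unfolding H_def[of a b] by (simp add: W)
  also have "\<dots> = symb a b u u' v v' (H a b v v' (H a c u u' x))"
    unfolding symb_def using abc W_inverse(2)[of a b 1 1] by (simp add: H_def[of a b] Hinv_def[of a b])
  finally show ?thesis .
qed

lemma symb_mult_left:
  assumes u: "recip u u'" and v: "recip v v'" and w: "recip w w'"
  shows "symb a b (u * v) (u' * v') w w' x = symb a b u u' w w' (symb a b v v' w w' x)"
proof -
  let ?d = "symb a c u u' v v'"
  have dc: "central ?d" by (rule central_symb[OF acb u v])
  have c1: "central (symb a b u u' w w')" by (rule central_symb[OF abc u w])
  \<comment> \<open>All operators are bijective, so \<open>x\<close> may be written in the form that the commutators produce below.\<close>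
  obtain z where "x = ?d z" using symb_surj[of a c] abc by metis
  moreover obtain y where "z = H a b w w' (H a c v v' (H a c u u' y))"
    using H_inverse(1)[of a b] H_inverse(1)[of a c] abc by metis
  ultimately have x: "x = ?d (H a b w w' (H a c v v' (H a c u u' y)))" by simp
  have "H a c (u * v) (u' * v') (H a b w w' y) = symb a b (u * v) (u' * v') w w' x"
    unfolding x symb_commutator[OF recip_mult[OF u v] w]
    using symb_H[of a c u u' v v'] abc
    by (simp add: central_commutes(1)[OF dc abc(1)])
  moreover have "H a c (u * v) (u' * v') (H a b w w' y) = ?d (H a c v v' (H a c u u' (H a b w w' y)))"
    using symb_H[of a c u u' v v'] abc by simp
  moreover have "\<dots> = symb a b u u' w w' (symb a b v v' w w' x)"
    unfolding x symb_commutator[OF u w] symb_commutator[OF v w]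
      central_commutes(1)[OF c1 abc(3), symmetric] central_commutes(3)[OF dc abc(1)] ..
  ultimately show ?thesis by simp
qed

lemma symb_mult_right:
  assumes u: "recip u u'" and v: "recip v v'" and w: "recip w w'"
  shows "symb a b u u' (v * w) (v' * w') x = symb a b u u' w w' (symb a b u u' v v' x)"
proof -
  let ?d = "symb a b v v' w w'"
  have dc: "central ?d" by (rule central_symb[OF abc v w])
  have c1: "central (symb a b u u' v v')" by (rule central_symb[OF abc u v])
  obtain z where "x = ?d z" using symb_surj[of a b] abc by metis
  moreover obtain y where "z = H a b w w' (H a b v v' (H a c u u' y))"
    using H_inverse(1)[of a b] H_inverse(1)[of a c] abc by metis
  ultimately have x: "x = ?d (H a b w w' (H a b v v' (H a c u u' y)))" by simp
  have "H a c u u' (H a b (v * w) (v' * w') y) = symb a b u u' (v * w) (v' * w') x"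
    unfolding x symb_commutator[OF u recip_mult[OF v w]]
    using symb_H[of a b v v' w w'] abc by simp
  moreover have "H a c u u' (H a b (v * w) (v' * w') y) = ?d (H a c u u' (H a b w w' (H a b v v' y)))"
    using symb_H[of a b v v' w w'] abc central_commutes(1)[OF dc abc(3)] by metis
  moreover have "\<dots> = symb a b u u' w w' (symb a b u u' v v' x)"
    unfolding x symb_commutator[OF u w] symb_commutator[OF u v]
      central_commutes(1)[OF c1 abc(1), symmetric] central_commutes(3)[OF dc abc(1)] ..
  ultimately show ?thesis by simp
qed

text \<open>The symbol of \<open>u\<close> and \<open>- u\<close> is trivial, hence the symbols of \<open>u\<close> with \<open>u\<close> and with \<open>- 1\<close> are inverse
to each other, and the square of the latter is the symbol of \<open>u\<close> and \<open>1\<close>.\<close>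

lemma symb_self_involution:
  assumes u: "recip u u'"
  shows "symb a b u u' u u' (symb a b u u' u u' x) = x"
proof -
  let ?k = "symb a b u u' u u'" and ?m = "symb a b u u' (- 1) (- 1)"
  have m1: "recip (- 1) (- 1)" by simp
  have km: "?k (?m x) = x" for x
    using symb_mult_right[OF u m1 u, of x] symb_minus[OF u, of x] by simp
  have mm: "?m (?m x) = x" for x
    using symb_mult_right[OF u m1 m1, of x] symb_one[OF u, of x] by simp
  have "?k x = ?m x" for x using km[of "?m x"] mm[of x] by simp
  then show ?thesis using km[of x] by simp
qed

lemma symb_powers:
  assumes g: "recip g g'"
  shows "symb a b (g ^ i) (g' ^ i) (g ^ j) (g' ^ j) x = (symb a b g g' g g' ^^ (i * j)) x"
proof -
  have 1: "symb a b g g' (g ^ j) (g' ^ j) x = (symb a b g g' g g' ^^ j) x" for j x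
  proof (induction j)
    case 0
    then show ?case using symb_one[OF g] by simp
  next
    case (Suc j)
    then show ?case
      using symb_mult_right[OF g recip_power[OF g, of j] g, of x] by (simp add: mult.commute)
  qed
  show ?thesis
  proof (induction i arbitrary: x)
    case 0
    have "symb a b 1 1 (g ^ j) (g' ^ j) x = x"
      using abc unfolding symb_def Hinv_def[of a b 1 1] by simp
    then show ?case by simp
  next
    case (Suc i)
    then show ?case
      using symb_mult_left[OF g recip_power[OF g, of i] recip_power[OF g, of j], of x]
      by (simp add: 1 funpow_add)
  qed
qed

text \<open>All symbols of powers of \<open>g\<close> are powers of the symbol \<open>k\<close> of \<open>g\<close> with itself, which is an
involution. The exponent \<open>i * j\<close> is even, or else a pair of odd powers of \<open>g\<close> with trivial symbol
shows that \<open>k\<close> itself is trivial.\<close>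

lemma H_mult_powers:
  assumes g: "recip g g'" and u: "recip u u'" "[g ^ i = u] (mod q)" and v: "recip v v'" "[g ^ j = v] (mod q)"
    and "even (i * j) \<or> (\<exists>k l. odd (k * l) \<and> ([g ^ k + g ^ l = 1] (mod q) \<or> [g ^ k + g ^ l = 0] (mod q)))"
  shows "H a b u u' (H a b v v' x) = H a b (u * v) (u' * v') x"
proof -
  let ?k = "symb a b g g' g g'"
  have inv: "(?k ^^ (2 * n)) x = x" for n x
    by (induction n) (use symb_self_involution[OF g] in simp_all)
  have "(?k ^^ (j * i)) x = x" for x
  proof (cases "even (i * j)")
    case True
    then obtain n where "j * i = 2 * n" by (auto simp: mult.commute elim: evenE)
    then show ?thesis using inv by simp
  next
    case False
    with assms(6) obtain k l where kl: "odd (k * l)"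
      "[g ^ k + g ^ l = 1] (mod q) \<or> [g ^ k + g ^ l = 0] (mod q)" by blast
    then obtain n where n: "k * l = Suc (2 * n)" by (metis oddE Suc_eq_plus1)
    have "symb a b (g ^ k) (g' ^ k) (g ^ l) (g' ^ l) x = x" for x
      using kl(2)
    proof
      assume "[g ^ k + g ^ l = 1] (mod q)"
      then show ?thesis by (rule symb_steinberg[OF recip_power[OF g] recip_power[OF g]])
    next
      assume "[g ^ k + g ^ l = 0] (mod q)"
      then have "[g ^ l = - (g ^ k)] (mod q)"
        by (simp add: cong_iff_dvd_diff add.commute)
      then show ?thesis
        using symb_cong[OF abc(1) recip_power[OF g] recip_power[OF g] recip_power[OF g]
            recip_minus[OF recip_power[OF g]] cong_refl] symb_minus[OF recip_power[OF g]] by simp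
    qed
    then have "?k x = x" for x
      unfolding symb_powers[OF g] n using inv by simp
    then have "(?k ^^ n) x = x" for n by (induction n) simp_all
    then show ?thesis .
  qed
  then have "symb a b v v' u u' x = x" for x
    using symb_cong[OF abc(1) recip_power[OF g] recip_power[OF g] v(1) u(1) v(2) u(2), of x]
    unfolding symb_powers[OF g] by simp
  then show ?thesis using symb_H[OF abc(1), of v v' u u' x] by (simp add: mult.commute)
qed

end

section \<open>Units modulo prime powers\<close>

text \<open>Induction on the exponent: if \<open>25 ^ j\<close> agrees with \<open>u\<close> modulo \<open>2 ^ (m + 3)\<close> but not modulo the next
power of two, then a further factor \<open>25 ^ (2 ^ m)\<close>, which is \<open>1\<close> plus an odd multiple of
\<open>2 ^ (m + 3)\<close>, corrects the digit.\<close>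

lemma power_of_25_mod_power_of_2:
  fixes u :: int
  assumes "[u = 1] (mod 8)"
  shows "\<exists>j. [25 ^ j = u] (mod 2 ^ n)"
proof -
  have sq: "\<exists>w. odd w \<and> (25 :: int) ^ (2 ^ m) = 1 + 2 ^ (m + 3) * w" for m
  proof (induction m)
    case 0
    show ?case by (intro exI[of _ 3]) simp
  next
    case (Suc m)
    then obtain w :: int where w: "odd w" "25 ^ (2 ^ m) = 1 + 2 ^ (m + 3) * w" by blast
    have "(25 :: int) ^ (2 ^ Suc m) = (25 ^ (2 ^ m))\<^sup>2" by (metis power_Suc2 power_mult)
    also have "\<dots> = 1 + 2 ^ (Suc m + 3) * (w + 2 ^ (m + 2) * w\<^sup>2)"
      unfolding w by (simp add: power2_eq_square algebra_simps power_add)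
    finally show ?case using w(1) by (intro exI[of _ "w + 2 ^ (m + 2) * w\<^sup>2"]) simp
  qed
  have "\<exists>j. [25 ^ j = u] (mod 2 ^ (m + 3))" for m
  proof (induction m)
    case 0
    show ?case using assms by (intro exI[of _ 0]) (simp add: cong_sym)
  next
    case (Suc m)
    then obtain j where "[25 ^ j = u] (mod 2 ^ (m + 3))" by blast
    then have "2 ^ (m + 3) dvd 25 ^ j - u" by (simp add: cong_iff_dvd_diff)
    then obtain s where "25 ^ j - u = 2 ^ (m + 3) * s" ..
    then have s: "25 ^ j = u + 2 ^ (m + 3) * s" by simp
    obtain w :: int where w: "odd w" "25 ^ (2 ^ m) = 1 + 2 ^ (m + 3) * w" using sq by blast
    have "[u = 1] (mod 2)" using assms by (rule cong_dvd_modulus) simp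
    then have u: "odd u" by (simp add: cong_def odd_iff_mod_2_eq_one)
    have dvd: "2 ^ (Suc m + 3) dvd 2 ^ (m + 3) * z" if "even z" for z :: int
    proof -
      from that obtain y where "z = 2 * y" ..
      then have "2 ^ (m + 3) * z = 2 ^ (Suc m + 3) * y" by (simp add: power_add)
      then show ?thesis by simp
    qed
    show ?case
    proof (cases "even s")
      case True
      then have "2 ^ (Suc m + 3) dvd 25 ^ j - u" using s dvd[of s] by simp
      then show ?thesis by (auto simp: cong_iff_dvd_diff)
    next
      case False
      have "25 ^ (j + 2 ^ m) - u = 2 ^ (m + 3) * (s + u * w + 2 ^ (m + 3) * (s * w))"
        unfolding power_add s w by (simp add: algebra_simps)
      moreover have "even (s + u * w + 2 ^ (m + 3) * (s * w))" using False u w(1) by simp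
      ultimately have "2 ^ (Suc m + 3) dvd 25 ^ (j + 2 ^ m) - u"
        using dvd by metis
      then show ?thesis by (auto simp: cong_iff_dvd_diff)
    qed
  qed
  then obtain j where "[25 ^ j = u] (mod 2 ^ (n + 3))" by blast
  then have "[25 ^ j = u] (mod 2 ^ n)" by (rule cong_dvd_modulus) (simp add: power_add)
  then show ?thesis by blast
qed

text \<open>Take a primitive root \<open>g\<close> that generates the units modulo all powers of \<open>p\<close>. The parity of an
exponent of \<open>g\<close> is then determined modulo \<open>p\<close>. If \<open>- 1\<close> is an even power of \<open>g\<close>, then \<open>g\<close> and \<open>- g\<close>
are odd powers with sum zero. Otherwise let \<open>u\<close> be the least positive odd power modulo \<open>p\<close>. Then
\<open>u - 1\<close> is an even power by minimality, so \<open>1 - u\<close> is odd, and \<open>u\<close> and \<open>1 - u\<close> have sum one.\<close>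

lemma primitive_root_steinberg_pair:
  fixes p :: int
  assumes "prime p" "odd p"
  obtains g k l where "\<And>u. coprime u p \<Longrightarrow> \<exists>i. [g ^ i = u] (mod p ^ Suc n)"
    "coprime g p" "odd k" "odd l" "[g ^ k + g ^ l = 1] (mod p ^ Suc n) \<or> [g ^ k + g ^ l = 0] (mod p ^ Suc n)"
proof -
  define P where "P = nat p"
  have P: "prime P" "odd P" "p = int P"
    using assms prime_gt_0_int[of p] by (simp_all add: P_def even_nat_iff)
  obtain h where h: "\<forall>k>0. residue_primroot (P ^ k) h"
    using residue_primroot_odd_prime_power_exists[OF P(1,2)] by blast
  have P1: "P > 1" using P(1) prime_gt_1_nat by blast
  have gen: "\<exists>i. [int h ^ i = u] (mod p ^ Suc n)" if "coprime u p" for u n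
  proof -
    define m where "m = P ^ Suc n"
    define r where "r = nat (u mod int m)"
    have m: "m > 1" unfolding m_def using P1 by (metis one_less_power zero_less_Suc)
    have pm: "p ^ Suc n = int m" using P(3) by (simp add: m_def)
    have r: "int r = u mod int m" using m by (simp add: r_def)
    have "coprime u (p ^ Suc n)" using that by simp
    then have "coprime (int r) (int m)" unfolding r pm using m by simp
    then have c: "coprime r m" by simp
    have "int r < int m" unfolding r using m by simp
    then have "r < m" by simp
    moreover have "r > 0" using c m by (cases "r = 0") auto
    ultimately have "r \<in> totatives m" using c by (auto simp: totatives_def)
    moreover have "bij_betw (\<lambda>i. h ^ i mod m) {..<totient m} (totatives m)"
      using residue_primroot_is_generator[OF m] h unfolding m_def by blast
    ultimately obtain i where "r = h ^ i mod m" by (auto simp: bij_betw_def)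
    then have "int h ^ i mod int m = u mod int m" using r by (simp add: zmod_int)
    then show ?thesis unfolding pm by (auto simp: cong_def)
  qed
  have rh: "residue_primroot P h" using h[rule_format, of 1] by simp
  then have cop: "coprime P h" and ord: "ord P h = P - 1"
    using P(1) by (auto simp: residue_primroot_def totient_prime)
  have parity: "even i = even j" if "[int h ^ i = int h ^ j] (mod p)" for i j
  proof -
    have "[h ^ i = h ^ j] (mod P)" using that P(3) by (metis cong_int_iff of_nat_power)
    then have "[i = j] (mod (P - 1))" using order_divides_expdiff[OF cop] ord by simp
    then have "[i = j] (mod 2)" by (rule cong_dvd_modulus_nat) (use P(2) in simp)
    then show ?thesis by (simp add: cong_def even_iff_mod_2_eq_zero)
  qed
  have mod_p: "[x = y] (mod p)" if "[x = y] (mod p ^ Suc n)" for x y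
    using that by (rule cong_dvd_modulus) simp
  obtain m where m: "[int h ^ m = - 1] (mod p ^ Suc n)" using gen[of "- 1" n] by auto
  have "\<exists>k l. odd k \<and> odd l \<and>
    ([int h ^ k + int h ^ l = 1] (mod p ^ Suc n) \<or> [int h ^ k + int h ^ l = 0] (mod p ^ Suc n))"
  proof (cases "even m")
    case True
    have "[int h ^ 1 + int h ^ (1 + m) = int h ^ 1 + int h * (- 1)] (mod p ^ Suc n)"
      unfolding power_add power_one_right by (intro cong_add cong_mult cong_refl m)
    then show ?thesis using True by (intro exI[of _ 1] exI[of _ "1 + m"]) simp
  next
    case False
    \<comment> \<open>The positive integers that are odd powers of \<open>h\<close> modulo \<open>p\<close>.\<close>
    define N where "N u \<longleftrightarrow> u > 0 \<and> (\<exists>i. odd i \<and> [int h ^ i = int u] (mod p))" for u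
    have "N (h mod P)"
    proof -
      have "h mod P \<noteq> 0" using cop P1 by (metis coprime_absorb_left dvd_eq_mod_eq_0 less_irrefl nat_dvd_1_iff_1)
      moreover have "[int h ^ 1 = int (h mod P)] (mod p)"
        using P(3) by (simp add: cong_def zmod_int)
      ultimately show ?thesis unfolding N_def by (metis odd_one neq0_conv)
    qed
    define u where "u = (LEAST u. N u)"
    have Nu: "N u" unfolding u_def by (rule LeastI) fact
    have least: "u \<le> w" if "N w" for w unfolding u_def using that by (rule Least_le)
    have "u \<le> h mod P" by (rule least) fact
    moreover have "h mod P < P" using P1 by simp
    ultimately have "u < P" by linarith
    have "u \<noteq> 1"
    proof
      assume "u = 1"
      then obtain i where "odd i" "[int h ^ i = int h ^ 0] (mod p)" using Nu by (auto simp: N_def)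
      then show False using parity by blast
    qed
    then have u2: "u - 1 > 0" "u - 1 < P" using Nu \<open>u < P\<close> by (auto simp: N_def)
    have cu: "coprime (int w) p" if "0 < w" "w < P" for w
      using that P by (metis coprime_commute coprime_int_iff nat_dvd_not_less prime_imp_coprime)
    obtain k where k: "[int h ^ k = int u] (mod p ^ Suc n)"
      using gen[OF cu, of u n] Nu \<open>u < P\<close> by (auto simp: N_def)
    obtain i where i: "odd i" "[int h ^ i = int u] (mod p)" using Nu by (auto simp: N_def)
    have "odd k" using parity[of k i] mod_p[OF k] i by (metis cong_sym cong_trans)
    obtain j where j: "[int h ^ j = int (u - 1)] (mod p ^ Suc n)"
      using gen[OF cu[OF u2], of n] by blast
    have "even j"
    proof (rule ccontr)
      assume "odd j"
      then have "N (u - 1)" using u2 mod_p[OF j] by (auto simp: N_def)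
      then show False using least[of "u - 1"] u2 by simp
    qed
    have "[int h ^ k + int h ^ (m + j) = int u + (- 1) * int (u - 1)] (mod p ^ Suc n)"
      unfolding power_add by (intro cong_add cong_mult k m j)
    also have "int u + (- 1) * int (u - 1) = 1" using u2 by simp
    finally show ?thesis using \<open>odd k\<close> \<open>even j\<close> False by (intro exI[of _ k] exI[of _ "m + j"]) simp
  qed
  moreover have "coprime (int h) p" using cop P(3) by (simp add: coprime_commute)
  ultimately show ?thesis using that gen by blast
qed

section \<open>Eigenvectors of periodic one-parameter groups\<close>

definition unity :: "int \<Rightarrow> int \<Rightarrow> complex" where
  "unity q t = cis (2 * pi * of_int t / of_int q)"

lemma unity_add: "unity q (s + t) = unity q s * unity q t"
  by (simp add: unity_def cis_mult add_divide_distrib ring_distribs)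

lemma unity_0 [simp]: "unity q 0 = 1" by (simp add: unity_def)

lemma unity_eq_1_iff:
  assumes "q > 0"
  shows "unity q t = 1 \<longleftrightarrow> q dvd t"
proof
  assume "q dvd t"
  then obtain k where "t = q * k" ..
  then show "unity q t = 1"
    using assms cis_multiple_2pi[of "of_int k"] by (simp add: unity_def mult_ac)
next
  assume "unity q t = 1"
  then have "cos (2 * pi * of_int t / of_int q) = 1"
    by (simp add: unity_def complex_eq_iff)
  then obtain n :: int where "2 * pi * real_of_int t / of_int q = of_int n * 2 * pi"
    using cos_one_2pi_int by auto
  then have "real_of_int t = of_int n * of_int q" using assms by (simp add: field_simps)
  then have "real_of_int t = of_int (n * q)" by simp
  then have "t = n * q" by (simp only: of_int_eq_iff)
  then show "q dvd t" by simp
qed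

lemma sum_periodic_shift:
  fixes f :: "int \<Rightarrow> 'a :: comm_monoid_add"
  assumes "q > 0" "\<And>s t. [s = t] (mod q) \<Longrightarrow> f s = f t"
  shows "(\<Sum>t\<in>{0..<q}. f (t + r)) = (\<Sum>t\<in>{0..<q}. f t)"
  by (rule sum.reindex_bij_witness[where i = "\<lambda>t. (t - r) mod q" and j = "\<lambda>t. (t + r) mod q"])
    (use assms in \<open>auto simp: mod_simps intro!: assms(2)\<close>)

lemma unity_cong:
  assumes "q > 0" "[s = t] (mod q)"
  shows "unity q s = unity q t"
proof -
  have "unity q (s - t) = 1" using assms by (simp add: unity_eq_1_iff cong_iff_dvd_diff)
  then show ?thesis using unity_add[of q "s - t" t] by simp
qed

lemma sum_unity:
  assumes "q > 0"
  shows "(\<Sum>t\<in>{0..<q}. unity q (m * t)) = (if q dvd m then of_int q else 0)"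
proof (cases "q dvd m")
  case True
  then have "unity q (m * t) = 1" for t using assms by (simp add: unity_eq_1_iff)
  then show ?thesis using True assms by simp
next
  case False
  have "(\<Sum>t\<in>{0..<q}. unity q (m * (t + 1))) = (\<Sum>t\<in>{0..<q}. unity q (m * t))"
    using sum_periodic_shift[OF assms, of "\<lambda>t. unity q (m * t)" 1]
    by (simp add: unity_cong[OF assms] cong_scalar_left)
  moreover have "unity q (m * (t + 1)) = unity q m * unity q (m * t)" for t
    by (simp add: ring_distribs unity_add)
  ultimately have "unity q m * (\<Sum>t\<in>{0..<q}. unity q (m * t)) = (\<Sum>t\<in>{0..<q}. unity q (m * t))"
    by (simp flip: sum_distrib_left)
  then show ?thesis using False assms by (auto simp: unity_eq_1_iff)
qed

text \<open>The scalars are fixed to be complex numbers. The scalar multiplication is a parameter because the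
vectors will be complex functions, a type without a scalar multiplication of its own.\<close>

locale complex_vector_space = vector_space scale
  for scale :: "complex \<Rightarrow> 'v :: ab_group_add \<Rightarrow> 'v" (infixr \<open>*s\<close> 75)
begin

definition linear_map_on :: "'v set \<Rightarrow> ('v \<Rightarrow> 'v) \<Rightarrow> bool" where
  "linear_map_on S f \<longleftrightarrow> f ` S \<subseteq> S \<and> (\<forall>x\<in>S. \<forall>y\<in>S. f (x + y) = f x + f y) \<and>
     (\<forall>r. \<forall>x\<in>S. f (r *s x) = r *s f x)"

lemma linear_map_on_sum:
  assumes "linear_map_on S f" "subspace S" "finite A" "\<And>x. x \<in> A \<Longrightarrow> g x \<in> S"
  shows "f (sum g A) = (\<Sum>x\<in>A. f (g x))"
  using assms(3,4)
proof (induction A)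
  case empty
  have "f (0 *s 0) = 0 *s f 0" using assms(1,2) subspace_0 unfolding linear_map_on_def by blast
  then show ?case by simp
next
  case (insert x A)
  then have "sum g A \<in> S" using assms(2) subspace_sum by (metis insertI2)
  then show ?case using insert assms(1) by (auto simp: linear_map_on_def)
qed

lemma linear_map_on_comp:
  shows "linear_map_on S f \<Longrightarrow> linear_map_on S g \<Longrightarrow> linear_map_on S (\<lambda>x. f (g x))"
  unfolding linear_map_on_def by (auto simp: image_subset_iff)

lemma fixes_sum_of_permuted_set:
  assumes "linear_map_on S f" "subspace S" "finite A" "A \<subseteq> S" "f ` A \<subseteq> A" "inj_on f A"
  shows "f (\<Sum>A) = \<Sum>A"
proof -
  have "f ` A = A" using assms by (simp add: endo_inj_surj)
  then have "(\<Sum>x\<in>A. f x) = \<Sum>A" using assms(6) sum.reindex[of f A "\<lambda>x. x"] by simp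
  then show ?thesis using linear_map_on_sum[OF assms(1-3), of "\<lambda>x. x"] assms(4) by auto
qed

end

locale periodic_action = complex_vector_space scale
  for scale :: "complex \<Rightarrow> 'v :: ab_group_add \<Rightarrow> 'v" (infixr \<open>*s\<close> 75) +
  fixes U :: "int \<Rightarrow> 'v \<Rightarrow> 'v" and q :: int and T :: "'v set"
  assumes q_pos: "q > 0" and T: "subspace T" and U_linear: "\<And>t. linear_map_on T (U t)"
    and U_add: "\<And>s t x. x \<in> T \<Longrightarrow> U s (U t x) = U (s + t) x"
    and U_0: "\<And>x. x \<in> T \<Longrightarrow> U 0 x = x"
    and U_cong: "\<And>s t x. [s = t] (mod q) \<Longrightarrow> U s x = U t x"
begin

text \<open>The Fourier coefficient of \<open>x\<close> along the character \<open>t \<mapsto> unity q (j * t)\<close>, up to the factor \<open>q\<close>.\<close>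

definition component :: "int \<Rightarrow> 'v \<Rightarrow> 'v" where
  "component j x = (\<Sum>t\<in>{0..<q}. unity q (- (j * t)) *s U t x)"

lemma U_closed: "x \<in> T \<Longrightarrow> U t x \<in> T"
  using U_linear[of t] by (auto simp: linear_map_on_def)

lemma component_closed: "x \<in> T \<Longrightarrow> component j x \<in> T"
  unfolding component_def by (intro subspace_sum subspace_scale U_closed T)

lemma U_component:
  assumes "x \<in> T"
  shows "U r (component j x) = unity q (j * r) *s component j x"
proof -
  let ?f = "\<lambda>t. unity q (- (j * t)) *s U t x"
  have "U r (component j x) = (\<Sum>t\<in>{0..<q}. U r (?f t))"
    unfolding component_def
    by (intro linear_map_on_sum[OF U_linear T]) (auto intro: subspace_scale T U_closed assms)
  also have "\<dots> = (\<Sum>t\<in>{0..<q}. unity q (j * r) *s ?f (t + r))"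
  proof (intro sum.cong refl)
    fix t
    have "U r (?f t) = unity q (- (j * t)) *s U (t + r) x"
      using U_linear[of r] U_closed[OF assms] U_add[OF assms]
      by (simp add: linear_map_on_def add.commute)
    moreover have "unity q (- (j * t)) = unity q (j * r) * unity q (- (j * (t + r)))"
      by (simp add: ring_distribs flip: unity_add)
    ultimately show "U r (?f t) = unity q (j * r) *s ?f (t + r)" by (simp only: scale_scale)
  qed
  also have "\<dots> = unity q (j * r) *s (\<Sum>t\<in>{0..<q}. ?f (t + r))"
    by (rule scale_sum_right[symmetric])
  also have "(\<Sum>t\<in>{0..<q}. ?f (t + r)) = component j x"
    unfolding component_def
  proof (rule sum_periodic_shift[OF q_pos])
    fix s t assume st: "[s = t] (mod q)"
    then have "[- (j * s) = - (j * t)] (mod q)"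
      by (simp add: cong_minus_minus_iff cong_scalar_left)
    then show "?f s = ?f t" using unity_cong[OF q_pos] U_cong[OF st] by simp
  qed
  finally show ?thesis .
qed

lemma sum_components:
  assumes "x \<in> T"
  shows "(\<Sum>j\<in>{0..<q}. component j x) = of_int q *s x"
proof -
  have "(\<Sum>j\<in>{0..<q}. component j x) = (\<Sum>t\<in>{0..<q}. (\<Sum>j\<in>{0..<q}. unity q (- t * j)) *s U t x)"
    unfolding component_def by (subst sum.swap) (simp add: scale_sum_left mult.commute)
  also have "\<dots> = (\<Sum>t\<in>{0..<q}. (if t = 0 then of_int q *s x else 0))"
    using q_pos U_0[OF assms] unfolding sum_unity[OF q_pos]
    by (intro sum.cong) (auto dest: zdvd_imp_le)
  also have "\<dots> = of_int q *s x" using q_pos by (simp add: sum.delta)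
  finally show ?thesis .
qed

lemma component_linear: "linear_map_on T (component j)"
proof -
  have U: "U t (x + y) = U t x + U t y" "U t (r *s x) = r *s U t x" if "x \<in> T" "y \<in> T" for t x y r
    using U_linear[of t] that by (auto simp: linear_map_on_def)
  have "component j (x + y) = component j x + component j y" if "x \<in> T" "y \<in> T" for x y
    using U(1)[OF that] by (simp add: component_def scale_right_distrib sum.distrib)
  moreover have "component j (r *s x) = r *s component j x" if "x \<in> T" for r x
    unfolding component_def scale_sum_right U(2)[OF that that] by (simp add: mult.commute)
  ultimately show ?thesis using component_closed by (auto simp: linear_map_on_def)
qed

lemma component_eigenvector:
  assumes "\<forall>t. U t x = unity q (m * t) *s x"
  shows "component j x = (if [m = j] (mod q) then of_int q *s x else 0)"
proof -
  have "component j x = (\<Sum>t\<in>{0..<q}. unity q ((m - j) * t) *s x)"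
    unfolding component_def using assms
    by (simp add: algebra_simps flip: unity_add)
  also have "\<dots> = (\<Sum>t\<in>{0..<q}. unity q ((m - j) * t)) *s x"
    by (rule scale_sum_left[symmetric])
  finally show ?thesis by (simp add: sum_unity[OF q_pos] cong_iff_dvd_diff)
qed

text \<open>\<open>x\<close> is a combination of its Fourier coefficients. If \<open>f\<close> fixed all of them, it would fix \<open>x\<close>.\<close>

lemma eigenvector_moved:
  assumes "x \<in> T" "linear_map_on T f" "f x \<noteq> x"
  shows "\<exists>j. \<exists>y\<in>T. f y \<noteq> y \<and> (\<forall>t. U t y = unity q (j * t) *s y)"
proof -
  have "\<exists>j. f (component j x) \<noteq> component j x"
  proof (rule ccontr)
    assume "\<not> ?thesis"
    then have "f (\<Sum>j\<in>{0..<q}. component j x) = (\<Sum>j\<in>{0..<q}. component j x)"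
      by (subst linear_map_on_sum[OF assms(2) T]) (auto intro: component_closed assms)
    then have "of_int q *s f x = of_int q *s x"
      using assms(1,2) by (simp add: sum_components linear_map_on_def)
    then show False using assms(3) q_pos by simp
  qed
  then show ?thesis using component_closed[OF assms(1)] U_component[OF assms(1)] by metis
qed

lemma eigenvector:
  assumes "x \<in> T" "x \<noteq> 0"
  shows "\<exists>j. \<exists>y\<in>T. y \<noteq> 0 \<and> (\<forall>t. U t y = unity q (j * t) *s y)"
proof -
  have "linear_map_on T (\<lambda>x. 0)" using T by (auto simp: linear_map_on_def subspace_0)
  from eigenvector_moved[OF assms(1) this] assms(2) show ?thesis by metis
qed

end

section \<open>A highest vector for the last column\<close>

text \<open>Divisibility is a total order on the integers modulo a prime power.\<close>

lemma cong_prime_power_divides: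
  fixes p x y :: int
  assumes "prime p"
  shows "(\<exists>s. [x * s = y] (mod p ^ n)) \<or> (\<exists>s. [y * s = x] (mod p ^ n))"
proof -
  have solve: "\<exists>s. [x * s = y] (mod p ^ n)" if dvd: "gcd x (p ^ n) dvd y" for x y
  proof -
    obtain r where r: "y = gcd x (p ^ n) * r" using dvd by blast
    obtain s where "[x * s = gcd x (p ^ n)] (mod p ^ n)" using cong_solve_int by blast
    then have "[x * s * r = y] (mod p ^ n)" unfolding r by (rule cong_scalar_right)
    then show ?thesis by (auto simp: mult.assoc)
  qed
  have "\<exists>i. gcd z (p ^ n) = p ^ i" for z
    using divides_primepow[OF assms, of "gcd z (p ^ n)" n] by auto
  then obtain i j where ij: "gcd x (p ^ n) = p ^ i" "gcd y (p ^ n) = p ^ j" by metis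
  have "p ^ i dvd p ^ j \<or> p ^ j dvd p ^ i" by (metis le_imp_power_dvd nle_le)
  then have "gcd x (p ^ n) dvd y \<or> gcd y (p ^ n) dvd x"
    unfolding ij[symmetric] by (meson dvd_trans gcd_dvd1)
  then show ?thesis using solve by blast
qed

text \<open>A linear action of the Steinberg group on the subspace \<open>S\<close>. Linearity is required only on \<open>S\<close>, so
that the action can be cut down to invariant subspaces while the relations still hold on the
whole type. The indices \<open>a\<close> and \<open>b\<close> carry the copy of \<open>SL_2\<close> for which a fixed vector is
sought, \<open>c\<close> is the third index needed for symbols, and \<open>d\<close> is the column whose characters
separate the vectors of an orbit.\<close>

locale steinberg_rep =
  steinberg_rank_two X q a b c + complex_vector_space scale
  for X :: "'i \<Rightarrow> 'i \<Rightarrow> int \<Rightarrow> 'v :: ab_group_add \<Rightarrow> 'v" and q :: int and a b c :: 'i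
    and scale :: "complex \<Rightarrow> 'v \<Rightarrow> 'v" (infixr \<open>*s\<close> 75) +
  fixes d :: 'i and S :: "'v set"
  assumes d: "d \<noteq> a" "d \<noteq> b" "d \<noteq> c"
    and q_pos: "q > 0" and S: "subspace S"
    and X_linear: "i \<noteq> j \<Longrightarrow> linear_map_on S (X i j t)"
begin

lemma distinct_indices: "a \<noteq> b" "b \<noteq> a" "a \<noteq> c" "c \<noteq> a" "b \<noteq> c" "c \<noteq> b"
  "a \<noteq> d" "d \<noteq> a" "b \<noteq> d" "d \<noteq> b" "c \<noteq> d" "d \<noteq> c"
  using abc d by auto

lemma X_closed: "i \<noteq> j \<Longrightarrow> x \<in> S \<Longrightarrow> X i j t x \<in> S"
  using X_linear[of i j t] by (auto simp: linear_map_on_def)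

lemma X_scale: "i \<noteq> j \<Longrightarrow> x \<in> S \<Longrightarrow> X i j t (r *s x) = r *s X i j t x"
  using X_linear[of i j t] by (auto simp: linear_map_on_def)

lemma X_inj: "i \<noteq> j \<Longrightarrow> X i j t x = X i j t y \<longleftrightarrow> x = y"
  by (metis X_minus)

lemma X_of_zero: "i \<noteq> j \<Longrightarrow> X i j t 0 = 0"
  using X_scale[of i j 0 t 0] subspace_0[OF S] by simp

lemma X_nonzero: "i \<noteq> j \<Longrightarrow> x \<noteq> 0 \<Longrightarrow> X i j t x \<noteq> 0"
  using X_inj[of i j t x 0] X_of_zero by simp

definition eigen :: "'i \<Rightarrow> 'i \<Rightarrow> int \<Rightarrow> 'v set" where
  "eigen i j m = {x \<in> S. \<forall>t. X i j t x = unity q (m * t) *s x}"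

lemma eigen_zero_iff: "x \<in> eigen i j 0 \<longleftrightarrow> x \<in> S \<and> (\<forall>t. X i j t x = x)"
  by (simp add: eigen_def)

lemma subspace_eigen: "i \<noteq> j \<Longrightarrow> subspace (eigen i j m)"
proof (rule subspaceI)
  fix x y r assume ij: "i \<noteq> j" and x: "x \<in> eigen i j m" and y: "y \<in> eigen i j m"
  then show "x + y \<in> eigen i j m"
    using X_linear[OF ij] S by (auto simp: eigen_def linear_map_on_def scale_right_distrib subspace_add)
  show "r *s x \<in> eigen i j m"
    using x X_scale[OF ij] S by (auto simp: eigen_def subspace_scale scale_left_commute)
qed (use S X_of_zero in \<open>auto simp: eigen_def subspace_0\<close>)

lemma eigen_cong: "[m = n] (mod q) \<Longrightarrow> eigen i j m = eigen i j n"
proof -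
  assume "[m = n] (mod q)"
  then have "unity q (m * t) = unity q (n * t)" for t
    by (intro unity_cong q_pos cong_scalar_right)
  then show ?thesis by (simp add: eigen_def)
qed

lemma eigen_subset: "eigen i j m \<subseteq> S" by (auto simp: eigen_def)

lemma eigen_commute:
  assumes "x \<in> eigen i j m" "i \<noteq> j" "k \<noteq> l" "j \<noteq> k" "i \<noteq> l"
  shows "X k l s x \<in> eigen i j m"
proof -
  have "X i j t (X k l s x) = unity q (m * t) *s X k l s x" for t
    using assms X_commute[of i j k l t s x] X_scale[of k l x] by (simp add: eigen_def)
  then show ?thesis using assms X_closed by (simp add: eigen_def)
qed

text \<open>The elementary matrix \<open>x_ij(s)\<close> adds a multiple of row \<open>j\<close> to row \<open>i\<close>. On characters of the
column \<open>k\<close> it acts by the contragredient operation.\<close>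

lemma eigen_chain:
  assumes "x \<in> eigen j k m" "x \<in> eigen i k n" "i \<noteq> j" "j \<noteq> k" "i \<noteq> k"
  shows "X i j s x \<in> eigen j k (m - n * s)"
proof -
  have 1: "X i j s x \<in> eigen i k n" using assms by (intro eigen_commute) auto
  have "X j k t (X i j s x) = unity q ((m - n * s) * t) *s X i j s x" for t
  proof -
    have "X j k t (X i j s x) = X i k (- (s * t)) (X i j s (X j k t x))"
      by (rule X_chain') (use assms in auto)
    also have "X j k t x = unity q (m * t) *s x" using assms by (simp add: eigen_def)
    also have "X i j s (unity q (m * t) *s x) = unity q (m * t) *s X i j s x"
      using assms by (intro X_scale) (auto simp: eigen_def)
    also have "X i k (- (s * t)) (unity q (m * t) *s X i j s x) =
        unity q (m * t) *s X i k (- (s * t)) (X i j s x)"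
      using assms 1 by (intro X_scale) (auto simp: eigen_def)
    also have "\<dots> = unity q (m * t) *s unity q (n * (- (s * t))) *s X i j s x"
      using 1 by (simp add: eigen_def)
    also have "\<dots> = unity q ((m - n * s) * t) *s X i j s x"
      by (simp add: algebra_simps flip: unity_add)
    finally show ?thesis .
  qed
  then show ?thesis using 1 by (simp add: eigen_def)
qed

lemma eigenvector_in:
  assumes sub: "subspace T" "T \<subseteq> S" and ij: "i \<noteq> j" and inv: "\<And>t x. x \<in> T \<Longrightarrow> X i j t x \<in> T"
  shows "periodic_action scale (X i j) q T"
    and "x \<in> T \<Longrightarrow> x \<noteq> 0 \<Longrightarrow> \<exists>y m. y \<in> T \<and> y \<noteq> 0 \<and> y \<in> eigen i j m"
    and "x \<in> T \<Longrightarrow> X i j r x \<noteq> x \<Longrightarrow> \<exists>y m. y \<in> T \<and> X i j r y \<noteq> y \<and> y \<in> eigen i j m"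
proof -
  have lin: "linear_map_on T (X i j t)" for t
    using X_linear[OF ij, of t] sub(2) inv unfolding linear_map_on_def by blast
  show pa: "periodic_action scale (X i j) q T"
  proof (intro periodic_action.intro periodic_action_axioms.intro complex_vector_space_axioms)
    show "X i j s x = X i j t x" if "[s = t] (mod q)" for s t x
      by (rule X_cong[OF ij that])
  qed (simp_all add: q_pos sub lin X_add[OF ij])
  show "\<exists>y m. y \<in> T \<and> y \<noteq> 0 \<and> y \<in> eigen i j m" if x: "x \<in> T" "x \<noteq> 0"
  proof -
    obtain m y where "y \<in> T" "y \<noteq> 0" "\<forall>t. X i j t y = unity q (m * t) *s y"
      using periodic_action.eigenvector[OF pa x] by blast
    moreover from this have "y \<in> eigen i j m" using sub(2) by (simp add: eigen_def subset_eq)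
    ultimately show ?thesis by blast
  qed
  show "\<exists>y m. y \<in> T \<and> X i j r y \<noteq> y \<and> y \<in> eigen i j m" if x: "x \<in> T" "X i j r x \<noteq> x"
  proof -
    obtain m y where "y \<in> T" "X i j r y \<noteq> y" "\<forall>t. X i j t y = unity q (m * t) *s y"
      using periodic_action.eigenvector_moved[OF pa x(1) lin x(2)] by blast
    moreover from this have "y \<in> eigen i j m" using sub(2) by (simp add: eigen_def subset_eq)
    ultimately show ?thesis by blast
  qed
qed

text \<open>Vectors on which the column \<open>d\<close> acts by a character supported in the row \<open>b\<close>.\<close>

definition col_d :: "int \<Rightarrow> 'v set" where
  "col_d k = eigen a d 0 \<inter> eigen c d 0 \<inter> eigen b d k"

lemma subspace_col_d: "subspace (col_d k)"
  unfolding col_d_def using distinct_indices by (intro subspace_inter subspace_eigen) auto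

lemma col_d_closed:
  assumes "x \<in> col_d k"
  shows "X a b s x \<in> col_d k" "X c b s x \<in> col_d k" "X a c s x \<in> col_d k" "X c a s x \<in> col_d k"
proof -
  note di = distinct_indices
  have x: "x \<in> eigen a d 0" "x \<in> eigen c d 0" "x \<in> eigen b d k"
    using assms by (simp_all add: col_d_def)
  have "X a b s x \<in> eigen b d k" "X c b s x \<in> eigen b d k"
    "X a c s x \<in> eigen c d 0" "X c a s x \<in> eigen a d 0"
    using eigen_chain[OF x(3,1), of s] eigen_chain[OF x(3,2), of s]
      eigen_chain[OF x(2,1), of s] eigen_chain[OF x(1,2), of s] di by simp_all
  then show "X a b s x \<in> col_d k" "X c b s x \<in> col_d k" "X a c s x \<in> col_d k" "X c a s x \<in> col_d k"
    using x di by (simp_all add: col_d_def eigen_commute)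
qed

text \<open>The hypothesis on \<open>x\<close> gives a character of \<open>x_bd\<close> of exact order \<open>q\<close>, and row operations clear the other
entries of the character of column \<open>d\<close>. The remaining freedom, \<open>SL_2\<close> on the indices \<open>a, c\<close>,
acts on the characters of column \<open>b\<close>. By Euclid's algorithm, which takes one step modulo a
prime power, it makes the character of \<open>x_ab\<close> trivial.\<close>

lemma highest_vector:
  assumes p: "prime p" "q = p ^ Suc n" and x: "x \<in> S" "X b d (p ^ n) x \<noteq> x"
  obtains v k where "v \<noteq> 0" "v \<in> col_d k" "v \<in> eigen a b 0" "coprime k q"
proof -
  note di = distinct_indices
  obtain y1 k where y1: "y1 \<in> eigen b d k" "X b d (p ^ n) y1 \<noteq> y1"
    using eigenvector_in(3)[of S b d] x S X_closed di by (metis subset_refl)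
  have "\<not> p dvd k"
  proof
    assume "p dvd k"
    then have "unity q (k * p ^ n) = 1" using q_pos p(2) by (auto simp: unity_eq_1_iff)
    then show False using y1 by (simp add: eigen_def)
  qed
  then have k: "coprime k q" unfolding p(2)
    using p(1) prime_imp_coprime coprime_commute by (metis coprime_power_right_iff)
  then obtain k' where k': "[k * k' = 1] (mod q)" using cong_solve_coprime_int by blast
  have "y1 \<noteq> 0" using y1 X_of_zero di by auto
  \<comment> \<open>Make the vector an eigenvector of the whole column \<open>d\<close>.\<close>
  have "\<exists>y m. y \<in> eigen b d k \<and> y \<noteq> 0 \<and> y \<in> eigen a d m"
    by (rule eigenvector_in(2)[where x = y1])
      (use y1 \<open>y1 \<noteq> 0\<close> di in \<open>simp_all add: subspace_eigen eigen_subset eigen_commute\<close>)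
  then obtain y2 \<alpha> where y2: "y2 \<in> eigen b d k" "y2 \<noteq> 0" "y2 \<in> eigen a d \<alpha>" by blast
  have "\<exists>y m. y \<in> eigen b d k \<inter> eigen a d \<alpha> \<and> y \<noteq> 0 \<and> y \<in> eigen c d m"
    by (rule eigenvector_in(2)[where x = y2])
      (use y2 di in \<open>simp_all add: subspace_eigen subspace_inter eigen_subset le_infI1 eigen_commute\<close>)
  then obtain y3 \<beta> where y3: "y3 \<in> eigen b d k" "y3 \<in> eigen a d \<alpha>" "y3 \<noteq> 0" "y3 \<in> eigen c d \<beta>"
    by blast
  \<comment> \<open>Row operations with row \<open>b\<close>, whose entry \<open>k\<close> is a unit, clear the rows \<open>a\<close> and \<open>c\<close>.\<close>
  define y4 where "y4 = X b a (\<alpha> * k') (X b c (\<beta> * k') y3)"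
  have z: "eigen i d (m - k * (m * k')) = eigen i d 0" for i m
  proof (rule eigen_cong)
    have "[m * (k * k') = m * 1] (mod q)" using k' by (intro cong_mult cong_refl)
    then have "[m - m * (k * k') = m - m * 1] (mod q)" by (intro cong_diff cong_refl)
    then show "[m - k * (m * k') = 0] (mod q)" by (simp add: mult_ac)
  qed
  have s: "X b c (\<beta> * k') y3 \<in> eigen c d 0" "X b c (\<beta> * k') y3 \<in> eigen b d k"
    "X b c (\<beta> * k') y3 \<in> eigen a d \<alpha>"
    using eigen_chain[of y3 c d \<beta> b k "\<beta> * k'"] y3 di z[of c \<beta>]
    by (auto intro: eigen_commute)
  then have y4: "y4 \<in> col_d k"
    unfolding col_d_def y4_def
    using eigen_chain[of _ a d \<alpha> b k "\<alpha> * k'"] di z[of a \<alpha>]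
    by (auto intro: eigen_commute)
  have "y4 \<noteq> 0" unfolding y4_def using y3 di by (intro X_nonzero) auto
  have col_S: "col_d k \<subseteq> S" unfolding col_d_def using eigen_subset by blast
  have "\<exists>y m. y \<in> col_d k \<and> y \<noteq> 0 \<and> y \<in> eigen a b m"
    by (rule eigenvector_in(2)[where x = y4])
      (use y4 \<open>y4 \<noteq> 0\<close> di col_S in \<open>simp_all add: subspace_col_d col_d_closed\<close>)
  then obtain y5 \<delta> where y5: "y5 \<in> col_d k" "y5 \<noteq> 0" "y5 \<in> eigen a b \<delta>" by blast
  have "\<exists>y m. y \<in> col_d k \<inter> eigen a b \<delta> \<and> y \<noteq> 0 \<and> y \<in> eigen c b m"
    by (rule eigenvector_in(2)[where x = y5])
      (use y5 di col_S in \<open>simp_all add: subspace_col_d subspace_eigen subspace_inter le_infI1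
        eigen_commute col_d_closed\<close>)
  then obtain y6 \<epsilon> where y6: "y6 \<in> col_d k" "y6 \<in> eigen a b \<delta>" "y6 \<noteq> 0" "y6 \<in> eigen c b \<epsilon>"
    by blast
  consider s where "[\<epsilon> * s = \<delta>] (mod q)" | s where "[\<delta> * s = \<epsilon>] (mod q)"
    using cong_prime_power_divides[OF p(1)] unfolding p(2) by blast
  then show ?thesis
  proof cases
    case 1
    have "X c a s y6 \<in> eigen a b (\<delta> - \<epsilon> * s)"
      using eigen_chain[of y6 a b \<delta> c \<epsilon>] y6 di by auto
    moreover have "[\<delta> - \<epsilon> * s = 0] (mod q)"
      using cong_diff[OF cong_refl 1, of \<delta>] by simp
    ultimately have "X c a s y6 \<in> eigen a b 0" using eigen_cong by metis
    then show ?thesis using that[of "X c a s y6"] y6 k col_d_closed X_nonzero di by metis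
  next
    case 2
    \<comment> \<open>First turn the character \<open>(\<delta>, \<epsilon>)\<close> of the rows \<open>a, c\<close> into \<open>(\<delta>, - \<delta>)\<close>, then add the second entry to the first.\<close>
    let ?y = "X a c (s + 1) y6"
    have y: "?y \<in> eigen c b (\<epsilon> - \<delta> * (s + 1))"
      using eigen_chain[of y6 c b \<epsilon> a \<delta>] y6 di by auto
    have "[\<epsilon> - \<delta> * s - \<delta> = \<epsilon> - \<epsilon> - \<delta>] (mod q)"
      using 2 by (intro cong_diff cong_refl)
    then have "?y \<in> eigen c b (- \<delta>)"
      using y eigen_cong[of "\<epsilon> - \<delta> * (s + 1)" "- \<delta>" c b] by (simp add: algebra_simps)
    moreover have "?y \<in> eigen a b \<delta>" using y6 di by (intro eigen_commute) auto
    ultimately have "X c a (- 1) ?y \<in> eigen a b 0"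
      using eigen_chain[of ?y a b \<delta> c "- \<delta>" "- 1"] di by auto
    moreover have "X c a (- 1) ?y \<in> col_d k" using y6 col_d_closed by blast
    moreover have "X c a (- 1) ?y \<noteq> 0" using y6 di by (intro X_nonzero) auto
    ultimately show ?thesis using that k by blast
  qed
qed

end

section \<open>Orbit sums\<close>

lemma finite_periodic_image:
  fixes f :: "int \<Rightarrow> int \<Rightarrow> int \<Rightarrow> 'a"
  assumes "q > 0" "\<And>r s t. f (r mod q) (s mod q) (t mod q) = f r s t"
  shows "finite {f r s t | r s t. P r s t}"
proof (rule finite_subset)
  show "{f r s t | r s t. P r s t} \<subseteq> (\<lambda>(r, s, t). f r s t) ` ({0..<q} \<times> {0..<q} \<times> {0..<q})"
  proof clarify
    fix r s t
    show "f r s t \<in> (\<lambda>(r, s, t). f r s t) ` ({0..<q} \<times> {0..<q} \<times> {0..<q})"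
      using assms by (intro image_eqI[where x = "(r mod q, s mod q, t mod q)"]) auto
  qed
qed simp

context steinberg_rep
begin

lemma W_linear: "i \<noteq> j \<Longrightarrow> linear_map_on S (W i j u u')"
proof -
  assume ij: "i \<noteq> j"
  have "W i j u u' = (\<lambda>x. X i j u (X j i (- u') (X i j u x)))" by (simp add: W_def fun_eq_iff)
  then show ?thesis
    using linear_map_on_comp[OF X_linear[OF ij] linear_map_on_comp[OF X_linear[OF ij[symmetric]] X_linear[OF ij]]]
    by simp
qed

lemma H_linear: "i \<noteq> j \<Longrightarrow> linear_map_on S (H i j u u')"
proof -
  assume ij: "i \<noteq> j"
  have "H i j u u' = (\<lambda>x. W i j u u' (W i j (- 1) (- 1) x))" by (simp add: H_def fun_eq_iff)
  then show ?thesis using linear_map_on_comp[OF W_linear[OF ij] W_linear[OF ij]] by simp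
qed

lemma H_scale: "i \<noteq> j \<Longrightarrow> x \<in> S \<Longrightarrow> H i j u u' (r *s x) = r *s H i j u u' x"
  using H_linear[of i j] unfolding linear_map_on_def by blast

lemma W_closed: "i \<noteq> j \<Longrightarrow> x \<in> S \<Longrightarrow> W i j u u' x \<in> S"
  and H_closed: "i \<noteq> j \<Longrightarrow> x \<in> S \<Longrightarrow> H i j u u' x \<in> S"
  using W_linear[of i j u u'] H_linear[of i j u u'] unfolding linear_map_on_def by blast+

lemma W_scale: "i \<noteq> j \<Longrightarrow> x \<in> S \<Longrightarrow> W i j u u' (r *s x) = r *s W i j u u' x"
  using W_linear[of i j] unfolding linear_map_on_def by blast

lemma H_eigen:
  assumes "x \<in> eigen i j m" "recip u u'" "i \<noteq> j"
  shows "H a b u u' x \<in> eigen i j (m * (wt a b u' u i * wt a b u u' j))"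
proof -
  let ?P = "wt a b u u' i * wt a b u' u j" and ?P' = "wt a b u' u i * wt a b u u' j"
  have r: "recip ?P ?P'" by (intro recip_mult recip_wt assms recip_sym)
  have "X i j t (H a b u u' x) = unity q (m * ?P' * t) *s H a b u u' x" for t
  proof -
    have "X i j t (H a b u u' x) = X i j (?P * (?P' * t)) (H a b u u' x)"
      using X_recip(1)[OF assms(3) r] by simp
    also have "\<dots> = H a b u u' (X i j (?P' * t) x)"
      by (rule H_X[OF abc assms(2,3), symmetric])
    also have "\<dots> = unity q (m * (?P' * t)) *s H a b u u' x"
      using assms(1) H_scale[OF abc(1)] by (simp add: eigen_def)
    finally show ?thesis by (simp add: mult.assoc)
  qed
  moreover have "H a b u u' x \<in> S"
    using H_closed[OF abc(1)] assms(1) by (simp add: eigen_def)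
  ultimately show ?thesis by (simp add: eigen_def)
qed

lemma W_eigen:
  assumes "x \<in> eigen b d m"
  shows "W a b 1 1 x \<in> eigen a d m"
proof -
  have "X a d t (W a b 1 1 x) = unity q (m * t) *s W a b 1 1 x" for t
  proof -
    have "X a d t (W a b 1 1 x) = W a b 1 1 (X b d t x)"
      using W_X_jk[of a b d 1 1 t x] distinct_indices by simp
    also have "\<dots> = unity q (m * t) *s W a b 1 1 x"
      using assms W_scale[OF abc(1)] by (simp add: eigen_def)
    finally show ?thesis .
  qed
  moreover have "W a b 1 1 x \<in> S"
    using W_closed[OF abc(1)] assms(1) by (simp add: eigen_def)
  ultimately show ?thesis by (simp add: eigen_def)
qed

text \<open>Projecting to the character of \<open>v\<close>, namely \<open>0\<close> in row \<open>a\<close> and \<open>k\<close> in row \<open>b\<close>, kills all summands but \<open>v\<close>.\<close>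

lemma sum_nonzero:
  assumes fin: "finite Q" and sub: "Q \<subseteq> S" and v: "v \<in> Q" "v \<noteq> 0" "v \<in> eigen a d 0" "v \<in> eigen b d k"
    and others: "\<And>x. x \<in> Q \<Longrightarrow> x \<noteq> v \<Longrightarrow> (\<exists>m. \<not> q dvd m \<and> x \<in> eigen a d m) \<or>
      (\<exists>m. \<not> [m = k] (mod q) \<and> x \<in> eigen a d 0 \<and> x \<in> eigen b d m)"
  shows "\<Sum>Q \<noteq> 0"
proof
  assume Q0: "\<Sum>Q = 0"
  note di = distinct_indices
  interpret ad: periodic_action scale "X a d" q S
    by (rule eigenvector_in(1)) (use S di X_closed in auto)
  interpret bd: periodic_action scale "X b d" q S
    by (rule eigenvector_in(1)) (use S di X_closed in auto)
  let ?P = "\<lambda>x. bd.component k (ad.component 0 x)"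
  have lin: "linear_map_on S ?P"
    by (rule linear_map_on_comp[OF bd.component_linear ad.component_linear])
  have bd0: "bd.component k 0 = 0"
    using bd.component_linear linear_map_on_sum[of S _ "{}"] S by force
  have bds: "bd.component k (r *s x) = r *s bd.component k x" if "x \<in> S" for r x
    using bd.component_linear[of k] that unfolding linear_map_on_def by blast
  have ad_eigen: "ad.component 0 x = (if q dvd m then of_int q *s x else 0)" if "x \<in> eigen a d m" for x m
    using ad.component_eigenvector[of x m 0] that by (simp add: eigen_def cong_0_iff)
  have bd_eigen: "bd.component k x = (if [m = k] (mod q) then of_int q *s x else 0)" if "x \<in> eigen b d m" for x m
    using bd.component_eigenvector[of x m k] that by (simp add: eigen_def)
  have "?P x = 0" if "x \<in> Q - {v}" for x
  proof -
    have xS: "x \<in> S" using that sub by blast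
    from that others[of x] consider m where "\<not> q dvd m" "x \<in> eigen a d m"
      | m where "\<not> [m = k] (mod q)" "x \<in> eigen a d 0" "x \<in> eigen b d m" by blast
    then show ?thesis
      by cases (simp_all add: ad_eigen bd_eigen bd0 bds xS)
  qed
  then have "(\<Sum>x\<in>Q. ?P x) = (\<Sum>x\<in>{v}. ?P x)"
    using fin v(1) by (intro sum.mono_neutral_right) auto
  moreover have "?P (\<Sum>Q) = (\<Sum>x\<in>Q. ?P x)"
    using linear_map_on_sum[OF lin S fin, of "\<lambda>x. x"] sub by auto
  moreover have "?P (\<Sum>Q) = 0"
    unfolding Q0 using linear_map_on_sum[OF lin S, of "{}"] by simp
  moreover have "?P v = of_int q *s of_int q *s v"
    using v sub by (simp add: ad_eigen[of v 0] bd_eigen[of v k] bds subset_eq)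
  ultimately show False using v q_pos by simp
qed

lemma X_fixed:
  assumes "i \<noteq> j" "X i j 1 x = x"
  shows "X i j t x = x"
proof -
  have *: "X i j (int n) x = x" for n
  proof (induction n)
    case (Suc n)
    have "X i j (int (Suc n)) x = X i j 1 (X i j (int n) x)" using assms by (simp add: X_add)
    then show ?case using Suc assms by simp
  qed simp
  have "X i j t x = X i j (t mod q) x"
    using assms(1) by (intro X_cong) auto
  then show ?thesis using *[of "nat (t mod q)"] q_pos by simp
qed

text \<open>The factorisation of a matrix with invertible corner \<open>s = 1 + r\<close> into lower triangular, diagonal and
upper triangular part. The latter fixes \<open>x\<close>.\<close>

lemma X_one_X_opposite:
  assumes "recip s s'" "s = 1 + r" and x: "\<And>t. X a b t x = x"
  shows "X a b 1 (X b a r x) = X b a (r * s') (Hinv a b s' s x)"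
proof -
  note ab = abc(1) abc(1)[symmetric]
  have W: "W a b (- s') (- s) x = X a b (- s') (X b a s x)"
    unfolding W_def using x by simp
  have "X a b 1 (X b a r x) = X a b 1 (X b a (- 1) (X b a s x))"
    using ab assms(2) by (simp add: X_add)
  also have "\<dots> = W a b 1 1 (X a b (- 1) (X b a s x))"
    unfolding W_def using ab by (simp add: X_add)
  also have "X a b (- 1) (X b a s x) = X a b (s' - 1) (W a b (- s') (- s) x)"
    unfolding W using ab by (simp add: X_add)
  also have "W a b 1 1 \<dots> = X b a (1 - s') (Hinv a b s' s x)"
    using W_X_ij(1)[OF abc, of 1 1] unfolding Hinv_def by simp
  also have "\<dots> = X b a (r * s') (Hinv a b s' s x)"
  proof (rule X_cong[OF ab(2)])
    have "[1 - s' = s * s' - s'] (mod q)"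
      using assms(1) by (intro cong_diff cong_refl) (rule cong_sym)
    then show "[1 - s' = r * s'] (mod q)" using assms(2) by (simp add: algebra_simps)
  qed
  finally show ?thesis .
qed

lemma W_one_W_one: "W a b 1 1 (W a b 1 1 x) = Hinv a b (- 1) (- 1) x"
  by (simp add: Hinv_def)

lemma H_one: "H a b 1 1 x = x"
  using abc W_inverse(1)[of a b 1 1] by (simp add: H_def)

lemma Hinv_eq_H:
  assumes "\<And>x. H a b s' s (H a b s s' x) = H a b (s' * s) (s * s') x" "recip s s'"
  shows "Hinv a b s' s x = H a b s s' x"
proof -
  have "H a b s' s (H a b s s' x) = H a b 1 1 x"
    unfolding assms(1) using assms(2) abc by (intro H_cong) (auto simp: mult.commute)
  then show ?thesis using H_inverse(2)[OF abc(1)] by (metis H_one)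
qed

lemma H_mod: "H a b (u mod q) (u' mod q) x = H a b u u' x"
  using abc by (intro H_cong) auto

lemma X_mod: "i \<noteq> j \<Longrightarrow> X i j (t mod q) x = X i j t x"
  by (intro X_cong) auto

lemma recip_coprime: "recip u u' \<Longrightarrow> coprime u q"
  using coprime_iff_invertible_int by blast

context
  fixes v k
  assumes v: "v \<noteq> 0" "v \<in> col_d k" "v \<in> eigen a b 0" and k: "coprime k q" and q: "q > 1"
begin

lemma H_v:
  assumes "recip u u'"
  shows "H a b u u' v \<in> eigen a d 0" "H a b u u' v \<in> eigen b d (k * u)"
    "H a b u u' v \<in> eigen a b 0"
  using H_eigen[OF _ assms, of v a d 0] H_eigen[OF _ assms, of v b d k]
    H_eigen[OF _ assms, of v a b 0] v distinct_indices by (simp_all add: col_d_def wt_def)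

lemma X_H_v: "recip u u' \<Longrightarrow> X a b t (H a b u u' v) = H a b u u' v"
  using H_v(3) by (simp add: eigen_zero_iff)

lemma opposite_H_v:
  assumes "recip u u'"
  shows "X b a r (H a b u u' v) \<in> eigen a d (- (k * u * r))"
    "X b a r (H a b u u' v) \<in> eigen b d (k * u)"
  using eigen_chain[OF H_v(1,2)[OF assms], of r] eigen_commute[OF H_v(2)[OF assms], of b a r]
    distinct_indices by simp_all

text \<open>The vector \<open>x_ba(r) h(u) v\<close> has the character \<open>(- k u r, k u)\<close> of column \<open>d\<close> in the rows \<open>a, b\<close>. As \<open>k\<close> is
a unit, this is the character \<open>(0, k)\<close> of \<open>v\<close> only for \<open>r = 0\<close> and \<open>u = 1\<close> modulo \<open>q\<close>.\<close>

lemma opposite_character: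
  assumes "recip u u'" "X b a r (H a b u u' v) \<noteq> v"
  shows "(\<exists>m. \<not> q dvd m \<and> X b a r (H a b u u' v) \<in> eigen a d m) \<or>
      (\<exists>m. \<not> [m = k] (mod q) \<and> X b a r (H a b u u' v) \<in> eigen a d 0 \<and> X b a r (H a b u u' v) \<in> eigen b d m)"
proof (cases "q dvd r")
  case False
  have "coprime (k * u) q" using k recip_coprime[OF assms(1)] by simp
  then have "\<not> q dvd - (k * u * r)"
    using False by (simp add: coprime_dvd_mult_right_iff coprime_commute)
  then show ?thesis using opposite_H_v(1)[OF assms(1)] by blast
next
  case True
  then have r: "X b a r x = x" for x
    using X_cong[of b a r 0] abc by (simp add: cong_0_iff)
  have "\<not> [k * u = k] (mod q)"
  proof
    assume "[k * u = k] (mod q)"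
    then have u: "[u = 1] (mod q)" using cong_mult_lcancel[OF k, of u 1] by simp
    then have "[u' = 1] (mod q)" using recip_unique[OF assms(1), of 1 1] by simp
    then have "H a b u u' v = v" using H_cong(1)[OF abc(1) u, of u' 1 v] H_one by simp
    then show False using assms(2) r by simp
  qed
  then show ?thesis using H_v(1,2)[OF assms(1)] r by auto
qed

text \<open>The set of all \<open>x_ab(s) w(1) h(u) v\<close> and of all \<open>x_ba(r) h(u) v\<close> with \<open>p\<close> dividing \<open>r\<close> is the orbit of \<open>v\<close>
under \<open>SL_2\<close>, written in terms of the two cells of the Bruhat decomposition over a
local ring. It is enough to see that \<open>x_ab(1)\<close> and \<open>w(1)\<close> map it into itself: they are
injective and the set is finite, so they permute it and fix its sum.\<close>

lemma fixed_vector_odd: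
  assumes p: "prime p" "p dvd q" "\<And>t. \<not> p dvd t \<Longrightarrow> coprime t q"
    and mult: "\<And>u u' w w' x. recip u u' \<Longrightarrow> recip w w' \<Longrightarrow>
      H a b u u' (H a b w w' x) = H a b (u * w) (u' * w') x"
  shows "\<exists>x\<in>S. x \<noteq> 0 \<and> (\<forall>t. X a b t x = x) \<and> (\<forall>t. X b a t x = x)"
proof -
  define big where "big = {X a b s (W a b 1 1 (H a b u u' v)) | s u u'. recip u u'}"
  define small where "small = {X b a r (H a b u u' v) | r u u'. recip u u' \<and> p dvd r}"
  let ?Q = "big \<union> small"
  note di = distinct_indices
  have fin: "finite ?Q" unfolding big_def small_def finite_Un
    by (intro conjI finite_periodic_image[OF q_pos]) (simp_all add: H_mod X_mod di)
  have bigI: "X a b s (W a b 1 1 (H a b u u' v)) \<in> ?Q" if "recip u u'" for s u u'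
    using that unfolding big_def by blast
  have smallI: "X b a r (H a b u u' v) \<in> ?Q" if "recip u u'" "p dvd r" for r u u'
    using that unfolding small_def by blast
  have big_char: "X a b s (W a b 1 1 (H a b u u' v)) \<in> eigen a d (k * u)" if "recip u u'" for s u u'
    using eigen_commute[OF W_eigen[OF H_v(2)[OF that]], of a b s] di by simp
  have sub: "?Q \<subseteq> S"
    using big_char opposite_H_v(1) eigen_subset unfolding big_def small_def by blast
  have r1: "recip 1 1" by simp
  have vQ: "v \<in> ?Q" using smallI[OF r1, of 0] by (simp add: H_one)
  have nz: "\<Sum>?Q \<noteq> 0"
  proof (rule sum_nonzero[OF fin sub vQ v(1), of k])
    show "v \<in> eigen a d 0" "v \<in> eigen b d k" using v by (simp_all add: col_d_def)
    fix x assume x: "x \<in> ?Q" "x \<noteq> v"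
    then consider s u u' where "recip u u'" "x = X a b s (W a b 1 1 (H a b u u' v))"
      | r u u' where "recip u u'" "x = X b a r (H a b u u' v)"
      unfolding big_def small_def by blast
    then show "(\<exists>m. \<not> q dvd m \<and> x \<in> eigen a d m) \<or>
      (\<exists>m. \<not> [m = k] (mod q) \<and> x \<in> eigen a d 0 \<and> x \<in> eigen b d m)"
    proof cases
      case 1
      then have "coprime (k * u) q" using k recip_coprime by simp
      then have "\<not> q dvd k * u" using coprime_common_divisor[of "k * u" q q] q by auto
      then show ?thesis using big_char 1 by blast
    next
      case 2
      then show ?thesis using opposite_character x(2) by blast
    qed
  qed
  have XQ: "X a b 1 ` ?Q \<subseteq> ?Q"
  proof (rule image_subsetI)
    fix x assume "x \<in> ?Q"
    then consider s u u' where "recip u u'" "x = X a b s (W a b 1 1 (H a b u u' v))"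
      | r u u' where "recip u u'" "p dvd r" "x = X b a r (H a b u u' v)"
      unfolding big_def small_def by blast
    then show "X a b 1 x \<in> ?Q"
    proof cases
      case 1
      then show ?thesis using bigI by (simp add: X_add abc)
    next
      case 2
      have "\<not> p dvd 1 + r" using 2 p(1) not_prime_unit dvd_add_left_iff by metis
      then obtain s' where s': "recip (1 + r) s'" using p(3) cong_solve_coprime_int by blast
      have "X a b 1 x = X b a (r * s') (Hinv a b s' (1 + r) (H a b u u' v))"
        unfolding 2 by (rule X_one_X_opposite[OF s' refl X_H_v[OF 2(1)]])
      also have "\<dots> = X b a (r * s') (H a b ((1 + r) * u) (s' * u') v)"
        by (simp add: Hinv_eq_H[OF mult[OF recip_sym[OF s'] s'] s'] mult[OF s' 2(1)])
      also have "\<dots> \<in> ?Q" using 2 s' by (intro smallI recip_mult) auto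
      finally show ?thesis .
    qed
  qed
  have WQ: "W a b 1 1 ` ?Q \<subseteq> ?Q"
  proof (rule image_subsetI)
    fix x assume "x \<in> ?Q"
    then consider s u u' where "recip u u'" "x = X a b s (W a b 1 1 (H a b u u' v))"
      | r u u' where "recip u u'" "p dvd r" "x = X b a r (H a b u u' v)"
      unfolding big_def small_def by blast
    then show "W a b 1 1 x \<in> ?Q"
    proof cases
      case 2
      then have "W a b 1 1 x = X a b (- r) (W a b 1 1 (H a b u u' v))"
        using W_X_ij(2)[OF abc r1, of r] by simp
      then show ?thesis using bigI 2 by simp
    next
      case 1
      let ?y = "H a b (- u) (- u') v"
      have m1: "recip (- 1) (- 1)" by simp
      have "W a b 1 1 x = X b a (- s) (W a b 1 1 (W a b 1 1 (H a b u u' v)))"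
        using W_X_ij(1)[OF abc r1, of s] 1 by simp
      also have "\<dots> = X b a (- s) ?y"
        unfolding W_one_W_one using Hinv_eq_H[OF mult[OF m1 m1]] mult[OF m1 1(1)] by simp
      finally have Wx: "W a b 1 1 x = X b a (- s) ?y" .
      have ru: "recip (- u) (- u')" using 1 by simp
      show ?thesis
      proof (cases "p dvd s")
        case True
        then show ?thesis unfolding Wx by (intro smallI ru) simp
      next
        case False
        then obtain s' where s': "recip s s'" using p(3) cong_solve_coprime_int by blast
        have "W a b s' s (X a b (- s') ?y) = X a b s' (X b a (- s) ?y)"
          unfolding W_def using abc by simp
        then have "X b a (- s) ?y = X a b (- s') (W a b s' s ?y)"
          using X_H_v[OF ru, of "- s'"] X_minus[OF abc(1)] by metis
        also have "W a b s' s ?y = W a b 1 1 (H a b s s' ?y)"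
          using W_W[OF r1 s'] abc W_inverse(1)[of a b 1 1] by (simp add: H_def[of a b s s'])
        also have "H a b s s' ?y = H a b (s * - u) (s' * - u') v" by (rule mult[OF s' ru])
        also have "X a b (- s') (W a b 1 1 \<dots>) \<in> ?Q" by (intro bigI recip_mult s' ru)
        finally show ?thesis unfolding Wx .
      qed
    qed
  qed
  have X1: "X a b 1 (\<Sum>?Q) = \<Sum>?Q"
    by (rule fixes_sum_of_permuted_set[OF X_linear S fin sub XQ])
      (use abc X_inj in \<open>auto simp: inj_on_def\<close>)
  have W1: "W a b 1 1 (\<Sum>?Q) = \<Sum>?Q"
    by (rule fixes_sum_of_permuted_set[OF W_linear S fin sub WQ])
      (use abc X_inj in \<open>auto simp: inj_on_def W_def\<close>)
  have Xab: "X a b t (\<Sum>?Q) = \<Sum>?Q" for t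
    by (rule X_fixed[OF abc(1) X1])
  have "X b a t (\<Sum>?Q) = \<Sum>?Q" for t
    using W_X_ij(1)[OF abc r1, of "- t" "\<Sum>?Q"] Xab W1 by simp
  then show ?thesis using Xab nz sub subspace_sum[OF S, of ?Q "\<lambda>x. x"] by blast
qed

text \<open>Here the group is generated by \<open>x_ab(1)\<close> and the \<open>x_ba(8 t)\<close>. All of its elements are congruent modulo
\<open>8\<close> to upper triangular matrices with diagonal \<open>1\<close>, so only the cell of \<open>v\<close> is needed, and only the
\<open>h(u)\<close> with \<open>u\<close> congruent to \<open>1\<close> modulo \<open>8\<close>.\<close>

lemma fixed_vector_two:
  assumes p: "q = 2 ^ n"
    and mult: "\<And>u u' w w' x. recip u u' \<Longrightarrow> recip w w' \<Longrightarrow> [u = 1] (mod 8) \<Longrightarrow> [w = 1] (mod 8) \<Longrightarrow>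
      H a b u u' (H a b w w' x) = H a b (u * w) (u' * w') x"
  shows "\<exists>x\<in>S. x \<noteq> 0 \<and> (\<forall>t. X a b t x = x) \<and> (\<forall>t. X b a (8 * t) x = x)"
proof -
  define Q where "Q = {X b a r (H a b u u' v) | r u u'. recip u u' \<and> [u = 1] (mod 8) \<and> 8 dvd r}"
  note di = distinct_indices
  have fin: "finite Q" unfolding Q_def
    by (intro finite_periodic_image[OF q_pos]) (simp_all add: H_mod X_mod di)
  have QI: "X b a r (H a b u u' v) \<in> Q" if "recip u u'" "[u = 1] (mod 8)" "8 dvd r" for r u u'
    using that unfolding Q_def by blast
  have sub: "Q \<subseteq> S"
    using opposite_H_v(1) eigen_subset unfolding Q_def by blast
  have r1: "recip 1 1" by simp
  have vQ: "v \<in> Q" using QI[OF r1, of 0] by (simp add: H_one)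
  have nz: "\<Sum>Q \<noteq> 0"
    by (rule sum_nonzero[OF fin sub vQ v(1), of k])
      (use v opposite_character in \<open>auto simp: col_d_def Q_def\<close>)
  have XQ: "X a b 1 ` Q \<subseteq> Q"
  proof (rule image_subsetI)
    fix x assume "x \<in> Q"
    then obtain r u u' where ru: "recip u u'" "[u = 1] (mod 8)" "8 dvd r" and x: "x = X b a r (H a b u u' v)"
      unfolding Q_def by blast
    have s8: "[1 + r = 1] (mod 8)" using ru(3) by (simp add: cong_iff_dvd_diff)
    have "odd (1 + r)" using ru(3) by auto
    then have "coprime (1 + r) (2 ^ (n + 3))" by (simp add: coprime_right_2_iff_odd)
    then have "coprime (1 + r) (8 * q)" by (simp add: p power_add mult.commute)
    \<comment> \<open>The inverse is taken modulo \<open>8 * q\<close>, so that it is congruent to \<open>1\<close> modulo \<open>8\<close> also when \<open>q < 8\<close>.\<close>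
    then obtain s' where s: "[(1 + r) * s' = 1] (mod 8 * q)" using cong_solve_coprime_int by blast
    then have s': "recip (1 + r) s'" by (rule cong_dvd_modulus) simp
    have "[(1 + r) * s' = 1] (mod 8)" using s by (rule cong_dvd_modulus) simp
    then have s'8: "[s' = 1] (mod 8)"
      using cong_scalar_right[OF s8, of s'] by (metis cong_sym cong_trans mult_1)
    have "X a b 1 x = X b a (r * s') (Hinv a b s' (1 + r) (H a b u u' v))"
      unfolding x by (rule X_one_X_opposite[OF s' refl X_H_v[OF ru(1)]])
    also have "\<dots> = X b a (r * s') (H a b ((1 + r) * u) (s' * u') v)"
      by (simp add: Hinv_eq_H[OF mult[OF recip_sym[OF s'] s' s'8 s8] s'] mult[OF s' ru(1) s8 ru(2)])
    also have "\<dots> \<in> Q" using ru s' cong_mult[OF s8 ru(2)] by (intro QI recip_mult) auto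
    finally show "X a b 1 x \<in> Q" .
  qed
  have YQ: "X b a (8 * t) ` Q \<subseteq> Q" for t
  proof (rule image_subsetI)
    fix x assume "x \<in> Q"
    then obtain r u u' where ru: "recip u u'" "[u = 1] (mod 8)" "8 dvd r" and x: "x = X b a r (H a b u u' v)"
      unfolding Q_def by blast
    then show "X b a (8 * t) x \<in> Q"
      using QI[OF ru(1,2), of "8 * t + r"] di by (simp add: X_add)
  qed
  have "X a b 1 (\<Sum>Q) = \<Sum>Q"
    by (rule fixes_sum_of_permuted_set[OF X_linear S fin sub XQ])
      (use abc X_inj in \<open>auto simp: inj_on_def\<close>)
  then have "X a b t (\<Sum>Q) = \<Sum>Q" for t
    by (rule X_fixed[OF abc(1)])
  moreover have "X b a (8 * t) (\<Sum>Q) = \<Sum>Q" for t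
    by (rule fixes_sum_of_permuted_set[OF X_linear S fin sub YQ])
      (use di X_inj in \<open>auto simp: inj_on_def\<close>)
  ultimately show ?thesis using nz sub subspace_sum[OF S, of Q "\<lambda>x. x"] by blast
qed

end
end

section \<open>From prime powers to arbitrary moduli\<close>

context steinberg_rep
begin

lemma fixed_vector_of_exact_level:
  assumes p: "prime p" "q = p ^ Suc n" and x: "x \<in> S" "X b d (p ^ n) x \<noteq> x"
  shows "\<exists>x\<in>S. x \<noteq> 0 \<and> (\<forall>t. X a b t x = x) \<and> (\<forall>t. X b a (8 * t) x = x)"
proof -
  obtain v k where v: "v \<noteq> 0" "v \<in> col_d k" "v \<in> eigen a b 0" "coprime k q"
    using highest_vector[OF p x] by blast
  have p1: "p > 1" using p(1) prime_gt_1_int by blast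
  then have q1: "q > 1" unfolding p(2) by (metis one_less_power zero_less_Suc)
  show ?thesis
  proof (cases "p = 2")
    case False
    then have "odd p" using p(1) p1 by (intro prime_odd_int) auto
    obtain g k l where g: "\<And>u. coprime u p \<Longrightarrow> \<exists>i. [g ^ i = u] (mod q)" "coprime g p"
      "odd k" "odd l" "[g ^ k + g ^ l = 1] (mod q) \<or> [g ^ k + g ^ l = 0] (mod q)"
      using primitive_root_steinberg_pair[OF p(1) \<open>odd p\<close>, of n] unfolding p(2) by blast
    have "coprime g q" using g(2) by (simp add: p(2))
    then obtain g' where g': "recip g g'" using cong_solve_coprime_int by blast
    have mult: "H a b u u' (H a b w w' x) = H a b (u * w) (u' * w') x"
      if "recip u u'" "recip w w'" for u u' w w' x
    proof -
      have "coprime u q" "coprime w q" using that recip_coprime by blast+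
      then have "coprime u p" "coprime w p" by (simp_all add: p(2))
      then obtain i j where "[g ^ i = u] (mod q)" "[g ^ j = w] (mod q)" using g(1) by blast
      then show ?thesis using H_mult_powers[OF g' that(1) _ that(2)] g(3-5) by (metis even_mult_iff)
    qed
    have "coprime t q" if "\<not> p dvd t" for t
      using p prime_imp_coprime[OF p(1) that] by (simp add: coprime_commute)
    with fixed_vector_odd[OF v q1 p(1) _ _ mult] p(2) show ?thesis by auto
  next
    case True
    have q2: "q = 2 ^ Suc n" using p(2) True by simp
    have "coprime 5 q" unfolding q2 by (simp add: coprime_right_2_iff_odd)
    then obtain g' where g': "recip 5 g'" using cong_solve_coprime_int by blast
    have five: "\<exists>i. even i \<and> [5 ^ i = u] (mod q)" if u8: "[u = 1] (mod 8)" for u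
    proof -
      obtain j where "[25 ^ j = u] (mod q)"
        using power_of_25_mod_power_of_2[OF u8, of "Suc n"] q2 by blast
      then have "[5 ^ (2 * j) = u] (mod q)" by (simp add: power_mult)
      then show ?thesis by (intro exI[of _ "2 * j"]) simp
    qed
    have mult: "H a b u u' (H a b w w' x) = H a b (u * w) (u' * w') x"
      if u: "recip u u'" "recip w w'" "[u = 1] (mod 8)" "[w = 1] (mod 8)" for u u' w w' x
    proof -
      obtain i j where "even i" "[5 ^ i = u] (mod q)" "[5 ^ j = w] (mod q)"
        using five[OF u(3)] five[OF u(4)] by blast
      then show ?thesis using H_mult_powers[OF g' u(1) _ u(2)] by simp
    qed
    show ?thesis by (rule fixed_vector_two[OF v q1 q2 mult])
  qed
qed

text \<open>Commutators of \<open>x_bd(r)\<close> with elementary matrices reach every position.\<close>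

lemma trivial_everywhere:
  assumes "\<And>x. x \<in> S \<Longrightarrow> X b d r x = x" "i \<noteq> j" "x \<in> S"
  shows "X i j r x = x"
proof -
  define triv where "triv i j \<longleftrightarrow> (\<forall>x\<in>S. X i j r x = x)" for i j
  have neg: "X i j (- r) x = x" if "triv i j" "i \<noteq> j" "x \<in> S" for i j x
    using that X_minus[of i j r x] by (simp add: triv_def)
  have right: "triv i j" if "triv i k" "i \<noteq> j" "j \<noteq> k" "i \<noteq> k" for i j k
    unfolding triv_def
  proof
    fix x assume x: "x \<in> S"
    have "X i j (r * 1) x = X i k r (X k j 1 (X i k (- r) (X k j (- 1) x)))"
      using that by (intro X_commutator) auto
    also have "\<dots> = x"
      using that x neg[OF that(1,4)] X_closed[of k j] by (simp add: triv_def)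
    finally show "X i j r x = x" by simp
  qed
  have left: "triv i j" if "triv k j" "i \<noteq> j" "j \<noteq> k" "i \<noteq> k" for i j k
    unfolding triv_def
  proof
    fix x assume x: "x \<in> S"
    have "X i j (1 * r) x = X i k 1 (X k j r (X i k (- 1) (X k j (- r) x)))"
      using that by (intro X_commutator) auto
    also have "\<dots> = x"
      using that x neg[OF that(1)] X_closed[of i k] by (simp add: triv_def)
    finally show "X i j r x = x" by simp
  qed
  note di = distinct_indices
  have bd: "triv b d" using assms(1) by (simp add: triv_def)
  have id: "triv i d" if "i \<noteq> d" for i
    using left[of b d i] bd that di by (cases "i = b") auto
  have da: "triv d a" using left[of b a d] right[OF bd, of a] di by simp
  have "triv i j"
  proof (cases "i = d")
    case True
    then show ?thesis using right[OF da, of j] da assms(2) di by (cases "j = a") auto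
  next
    case False
    then show ?thesis using right[OF id, of i j] id assms(2) by (cases "j = d") auto
  qed
  then show ?thesis using assms(3) by (simp add: triv_def)
qed

text \<open>If \<open>X b d r\<close> is trivial on \<open>S\<close>, the action on \<open>S\<close> has the smaller modulus \<open>r\<close>. Setting it to the identity
outside \<open>S\<close> makes the relations true on the whole type.\<close>

lemma restrict_modulus:
  assumes "r > 0" "\<And>x. x \<in> S \<Longrightarrow> X b d r x = x"
  shows "steinberg_rep (\<lambda>i j t x. if x \<in> S \<and> i \<noteq> j then X i j t x else x) r a b c scale d S"
    (is "steinberg_rep ?X _ _ _ _ _ _ _")
proof unfold_locales
  fix i j :: 'i and t
  assume ij: "i \<noteq> j"
  show "linear_map_on S (?X i j t)"
    using X_linear[OF ij, of t] ij subspace_add[OF S] subspace_scale[OF S]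
    by (simp add: linear_map_on_def image_subset_iff)
next
  fix i j k :: 'i and s t x
  assume ijk: "i \<noteq> j" "j \<noteq> k" "i \<noteq> k"
  show "?X i j s (?X j k t x) = ?X i k (s * t) (?X j k t (?X i j s x))"
    using ijk X_chain[OF ijk, of s t x] by (cases "x \<in> S") (simp_all add: X_closed)
next
  fix i j k l :: 'i and s t x
  assume ijkl: "i \<noteq> j" "k \<noteq> l" "j \<noteq> k" "i \<noteq> l"
  show "?X i j s (?X k l t x) = ?X k l t (?X i j s x)"
    using ijkl X_commute[OF ijkl, of s t x] by (cases "x \<in> S") (simp_all add: X_closed)
next
  fix i j :: 'i and s t x
  assume ij: "i \<noteq> j"
  show "?X i j s (?X i j t x) = ?X i j (s + t) x"
    using ij X_add[OF ij, of s t x] by (cases "x \<in> S") (simp_all add: X_closed)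
  show "?X i j r x = x"
    using trivial_everywhere[OF assms(2) ij] by (cases "x \<in> S") simp_all
qed (use assms(1) S d abc in simp_all)

text \<open>For an idempotent \<open>e\<close> modulo \<open>q\<close>, the elementary matrices with parameters in the ideal of \<open>e\<close> again satisfy the Steinberg relations.\<close>

lemma rescale:
  assumes e: "[e * e = e] (mod q)" "[e * r = 0] (mod q)" and r: "r > 0"
    and T: "subspace T" "T \<subseteq> S" "\<And>i j t x. i \<noteq> j \<Longrightarrow> x \<in> T \<Longrightarrow> X i j (e * t) x \<in> T"
  shows "steinberg_rep (\<lambda>i j t. X i j (e * t)) r a b c scale d T"
proof unfold_locales
  fix i j k :: 'i and s t x
  assume "i \<noteq> j" "j \<noteq> k" and ik: "i \<noteq> k"
  then have "X i j (e * s) (X j k (e * t) x) = X i k (e * s * (e * t)) (X j k (e * t) (X i j (e * s) x))"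
    by (rule X_chain)
  also have "X i k (e * s * (e * t)) y = X i k (e * (s * t)) y" for y
    using cong_scalar_right[OF e(1), of "s * t"] by (intro X_cong[OF ik]) (simp add: mult_ac)
  finally show "X i j (e * s) (X j k (e * t) x) = X i k (e * (s * t)) (X j k (e * t) (X i j (e * s) x))" .
next
  fix i j :: 'i and x
  assume "i \<noteq> j"
  then show "X i j (e * r) x = x" using X_cong[OF _ e(2), of i j x] by simp
next
  fix i j :: 'i and t
  assume ij: "i \<noteq> j"
  show "linear_map_on T (X i j (e * t))"
    using X_linear[OF ij, of "e * t"] T(2) T(3)[OF ij] unfolding linear_map_on_def by blast
qed (use r T(1) d abc in \<open>simp_all add: X_add X_commute ring_distribs\<close>)

text \<open>For orthogonal idempotents the commutator relations are trivial, except that they do not cover opposite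
positions. There one factor is a commutator through a third index, as \<open>e'\<close> is its own square.\<close>

lemma orthogonal_commute:
  assumes e: "[e' * e' = e'] (mod q)" "[e * e' = 0] (mod q)" and ne: "i \<noteq> j" "k \<noteq> l"
  shows "X i j (e * s) (X k l (e' * t) x) = X k l (e' * t) (X i j (e * s) x)"
proof -
  have zero: "X i j (e * s * (e' * t)) y = y" "X i j (- (e * s * (e' * t))) y = y"
    "X i j (- (e' * t * (e * s))) y = y" if "i \<noteq> j" for i j s t y
  proof -
    have "[e * s * (e' * t) = 0] (mod q)"
      using cong_scalar_right[OF e(2), of "s * t"] by (simp add: mult_ac)
    then have *: "[e * s * (e' * t) = 0] (mod q)" "[- (e * s * (e' * t)) = 0] (mod q)"
      by (simp_all add: cong_0_iff)
    show "X i j (e * s * (e' * t)) y = y" "X i j (- (e * s * (e' * t))) y = y"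
      using X_cong[OF that *(1)] X_cong[OF that *(2)] by simp_all
    then show "X i j (- (e' * t * (e * s))) y = y" by (simp add: mult_ac)
  qed
  have non_opposite: "X i j (e * s) (X k l (e' * t) x) = X k l (e' * t) (X i j (e * s) x)"
    if ijkl: "i \<noteq> j" "k \<noteq> l" "\<not> (j = k \<and> i = l)" for i j k l s t x
  proof -
    consider "j \<noteq> k" "i \<noteq> l" | "j = k" "i \<noteq> l" | "j \<noteq> k" "i = l" using ijkl by blast
    then show ?thesis
    proof cases
      case 1
      then show ?thesis using ijkl X_commute by blast
    next
      case 2
      then show ?thesis using ijkl zero by (simp add: X_chain)
    next
      case 3
      then show ?thesis using ijkl zero by (simp add: X_chain'[of k l j])
    qed
  qed
  show ?thesis
  proof (cases "j = k \<and> i = l")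
    case False
    then show ?thesis using non_opposite ne by blast
  next
    case True
    obtain m where m: "m \<noteq> i" "m \<noteq> j" using abc by metis
    have split: "X j i (e' * t) y =
        X j m (e' * t) (X m i (e' * 1) (X j m (e' * - t) (X m i (e' * - 1) y)))" for y
    proof -
      have "X j i (e' * t) y = X j i (e' * t * e') y"
        using ne cong_scalar_right[OF cong_sym[OF e(1)], of t] by (intro X_cong) (auto simp: mult_ac)
      also have "\<dots> = X j m (e' * t) (X m i e' (X j m (- (e' * t)) (X m i (- e') y)))"
        using ne m by (intro X_commutator) auto
      finally show ?thesis by simp
    qed
    have comm: "X i j (e * s) (X j m (e' * t) y) = X j m (e' * t) (X i j (e * s) y)"
      "X i j (e * s) (X m i (e' * t) y) = X m i (e' * t) (X i j (e * s) y)" for t y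
      using non_opposite[of i j j m] non_opposite[of i j m i] ne m by blast+
    have "X i j (e * s) (X j i (e' * t) x) = X j i (e' * t) (X i j (e * s) x)"
      unfolding split by (simp only: comm)
    then show ?thesis using True by simp
  qed
qed

end

text \<open>Lower the modulus until the action on \<open>S\<close> has exact level \<open>p ^ n\<close>.\<close>

lemma fixed_vector_prime_power:
  fixes p :: int
  assumes "steinberg_rep X (p ^ n) a b c scl d S" "prime p" "x\<^sub>0 \<in> S" "x\<^sub>0 \<noteq> 0"
  shows "\<exists>x\<in>S. x \<noteq> 0 \<and> (\<forall>t. X a b t x = x) \<and> (\<forall>t. X b a (8 * t) x = x)"
  using assms(1)
proof (induction n arbitrary: X)
  case 0
  interpret steinberg_rep X "p ^ 0" a b c scl d S by fact
  have "X i j t x = x" if "i \<noteq> j" for i j t x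
    using X_cong[OF that, of t 0] by simp
  then show ?case using assms(3,4) abc by metis
next
  case (Suc n)
  interpret steinberg_rep X "p ^ Suc n" a b c scl d S by fact
  show ?case
  proof (cases "\<exists>x\<in>S. X b d (p ^ n) x \<noteq> x")
    case True
    then show ?thesis using fixed_vector_of_exact_level[OF assms(2) refl] by blast
  next
    case False
    have "p ^ n > 0" using prime_gt_0_int[OF assms(2)] by simp
    from Suc.IH[OF restrict_modulus[OF this]] False
    show ?thesis using abc by fastforce
  qed
qed

text \<open>Split off a prime power \<open>P\<close> with complementary idempotents \<open>e\<close> and \<open>e'\<close>. The vectors fixed by the \<open>e\<close>-part form a
nonzero subspace that the commuting \<open>e'\<close>-part preserves, and the induction hypothesis applies to it.\<close>

theorem fixed_vector:
  assumes "steinberg_rep X (int q) a b c scl d S" "x\<^sub>0 \<in> S" "x\<^sub>0 \<noteq> 0"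
  shows "\<exists>x\<in>S. x \<noteq> 0 \<and> (\<forall>t. X a b t x = x) \<and> (\<forall>t. X b a (8 * t) x = x)"
  using assms
proof (induction q arbitrary: X S x\<^sub>0 rule: less_induct)
  case (less q)
  interpret steinberg_rep X "int q" a b c scl d S by fact
  note di = distinct_indices
  show ?case
  proof (cases "q = 1")
    case True
    have "X i j t x = x" if "i \<noteq> j" for i j t x
      using X_cong[OF that, of t 0] True by simp
    then show ?thesis using less.prems(2,3) abc by metis
  next
    case False
    then obtain p where p: "prime p" "p dvd q" using prime_factor_nat by blast
    obtain r where r: "q = p ^ multiplicity p q * r" "\<not> p dvd r"
      using multiplicity_decompose'[of q p] p q_pos by (metis gr0I not_prime_unit of_nat_0_less_iff not_less_zero)
    define P where "P = p ^ multiplicity p q"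
    have qPr: "q = P * r" using r(1) by (simp add: P_def)
    have "multiplicity p q > 0" using p q_pos by (simp add: prime_multiplicity_gt_zero_iff)
    then have "P > 1" unfolding P_def using prime_gt_1_nat[OF p(1)] by (metis one_less_power)
    have "r > 0" using q_pos qPr by (cases "r = 0") auto
    then have "r < q" using \<open>P > 1\<close> qPr by simp
    have cop: "coprime (int P) (int r)"
      using prime_imp_coprime[OF p(1) r(2)] unfolding P_def by simp
    obtain e where e: "[e = 1] (mod int P)" "[e = 0] (mod int r)"
      using binary_chinese_remainder_int[OF cop] by blast
    define e' where "e' = 1 - e"
    have e': "[e' = 0] (mod int P)" "[e' = 1] (mod int r)"
      unfolding e'_def using cong_diff[OF cong_refl e(1), of 1] cong_diff[OF cong_refl e(2), of 1] by simp_all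
    have crt: "[x = y] (mod int q)" if "[x = y] (mod int P)" "[x = y] (mod int r)" for x y
      unfolding qPr using coprime_cong_mult[OF that cop] by simp
    have idem: "[z * z = z] (mod m)" if "[z = 0] (mod m) \<or> [z = 1] (mod m)" for z m :: int
    proof -
      have "z * z - z = z * (z - 1)" by (simp add: algebra_simps)
      then show ?thesis using that by (auto simp: cong_iff_dvd_diff)
    qed
    have orth: "[z * w = 0] (mod m)" if "[z = 0] (mod m) \<or> [w = 0] (mod m)" for z w m :: int
      using that by (auto simp: cong_0_iff)
    have ee: "[e * e = e] (mod int q)" "[e' * e' = e'] (mod int q)" "[e * e' = 0] (mod int q)"
      "[e * int P = 0] (mod int q)" "[e' * int r = 0] (mod int q)"
      by (intro crt idem orth disjI1 disjI2 e e' | simp add: cong_0_iff)+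
    define T where "T = {x \<in> S. (\<forall>t. X a b (e * t) x = x) \<and> (\<forall>t. X b a (e * (8 * t)) x = x)}"
    have "steinberg_rep (\<lambda>i j t. X i j (e * t)) (int P) a b c scl d S"
      by (rule rescale) (use ee S X_closed \<open>P > 1\<close> in auto)
    then have "steinberg_rep (\<lambda>i j t. X i j (e * t)) (int p ^ multiplicity p q) a b c scl d S"
      by (simp add: P_def)
    from fixed_vector_prime_power[OF this _ less.prems(2,3)] p(1)
    obtain y where y: "y \<in> T" "y \<noteq> 0" by (auto simp: T_def)
    have T: "subspace T"
    proof (rule subspaceI)
      show "0 \<in> T" using subspace_0[OF S] X_of_zero abc by (auto simp: T_def)
      show "x + y \<in> T" if "x \<in> T" "y \<in> T" for x y
        using that X_linear[of a b] X_linear[of b a] di subspace_add[OF S]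
        by (simp add: T_def linear_map_on_def)
      show "scl r x \<in> T" if "x \<in> T" for x r
        using that X_scale di subspace_scale[OF S] by (simp add: T_def)
    qed
    have TX: "X i j (e' * t) x \<in> T" if "i \<noteq> j" "x \<in> T" for i j t x
      using that X_closed orthogonal_commute[OF ee(2,3) _ that(1)] di by (simp add: T_def)
    have "steinberg_rep (\<lambda>i j t. X i j (e' * t)) (int r) a b c scl d T"
      by (rule rescale) (use ee T TX \<open>r > 0\<close> in \<open>auto simp: T_def\<close>)
    from less.IH[OF \<open>r < q\<close> this y] obtain x where x: "x \<in> T" "x \<noteq> 0"
      "\<forall>t. X a b (e' * t) x = x" "\<forall>t. X b a (e' * (8 * t)) x = x" by blast
    have split: "X i j (e * t) (X i j (e' * t) x) = X i j t x" if "i \<noteq> j" for i j t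
      using that by (simp add: X_add e'_def algebra_simps)
    have "X a b t x = x" "X b a (8 * t) x = x" for t
      using split[of a b t] split[of b a "8 * t"] x di by (simp_all add: T_def)
    then show ?thesis using x(1,2) by (auto simp: T_def)
  qed
qed

section \<open>Ping-pong and the regular representation\<close>

lemma has_sum_sum:
  fixes h :: "'a \<Rightarrow> 'b \<Rightarrow> real"
  assumes "finite T" "\<And>g. g \<in> T \<Longrightarrow> (h g has_sum s g) A"
  shows "((\<lambda>x. \<Sum>g\<in>T. h g x) has_sum (\<Sum>g\<in>T. s g)) A"
  using assms by (induction T rule: finite_induct) (simp_all add: has_sum_add)

lemma sum_disjoint_cases:
  fixes b :: "'a \<Rightarrow> 'c :: comm_monoid_add"
  assumes "finite T" "\<And>g h. g \<in> T \<Longrightarrow> h \<in> T \<Longrightarrow> g \<noteq> h \<Longrightarrow> A g \<inter> A h = {}"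
  obtains "(\<Sum>g\<in>T. if x \<in> A g then b g else 0) = 0"
  | g where "g \<in> T" "(\<Sum>g\<in>T. if x \<in> A g then b g else 0) = b g"
proof (cases "\<exists>g\<in>T. x \<in> A g")
  case False
  then have "(\<Sum>g\<in>T. if x \<in> A g then b g else 0) = 0" by (intro sum.neutral) auto
  then show ?thesis by (rule that(1))
next
  case True
  then obtain g where g: "g \<in> T" "x \<in> A g" by blast
  have "(\<Sum>g\<in>T. if x \<in> A g then b g else 0) = (\<Sum>g\<in>{g}. if x \<in> A g then b g else 0)"
    using g assms by (intro sum.mono_neutral_right) auto
  then show ?thesis using g by (intro that(2)[OF g(1)]) simp
qed

text \<open>Split the value \<open>f (inv g \<otimes> x)\<close> according to whether \<open>x\<close> lies in \<open>A g\<close>. The parts with \<open>x\<close> in \<open>A g\<close>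
have disjoint supports for different \<open>g\<close>. In the other parts \<open>inv g \<otimes> x\<close> lies in \<open>A g\<close>, so they come from restrictions of
\<open>f\<close> to disjoint sets. Each of the two sums therefore has norm at most \<open>sqrt (card T)\<close>.\<close>

lemma ping_pong_operator_norm:
  fixes G (structure)
  assumes "group G" "finite T" "T \<subseteq> carrier G"
    and disj: "\<And>g h. g \<in> T \<Longrightarrow> h \<in> T \<Longrightarrow> g \<noteq> h \<Longrightarrow> A g \<inter> A h = {}"
    and pp: "\<And>g x. g \<in> T \<Longrightarrow> x \<in> carrier G \<Longrightarrow> x \<notin> A g \<Longrightarrow> g \<otimes> x \<in> A g"
  shows "operator_norm (ell2 G) (ell2_norm G) (left_regular_extend G (\<lambda>g. if g \<in> T then 1 else 0))
    \<le> 2 * sqrt (real (card T))"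
proof -
  interpret group G by fact
  let ?L = "left_regular_extend G (\<lambda>g. if g \<in> T then 1 else 0)"
  let ?n = "real (card T)"
  have bound: "ell2_norm G (?L f) \<le> 2 * sqrt ?n" if f: "f \<in> ell2 G" "ell2_norm G f \<le> 1" for f
  proof -
    define I where "I = (\<Sum>\<^sub>\<infinity>x\<in>carrier G. (cmod (f x))\<^sup>2)"
    have hs: "((\<lambda>x. (cmod (f x))\<^sup>2) has_sum I) (carrier G)"
      using f(1) by (auto simp: ell2_def I_def)
    have I1: "I \<le> 1" using f(2) by (simp add: ell2_norm_def I_def)
    define u where "u g x = (cmod (f (inv g \<otimes> x)))\<^sup>2" for g x
    define w where "w g x = (if inv g \<otimes> x \<in> A g then u g x else 0)" for g x
    define J where "J g = (\<Sum>\<^sub>\<infinity>x\<in>carrier G. if x \<in> A g then (cmod (f x))\<^sup>2 else 0)" for g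
    have J: "((\<lambda>x. if x \<in> A g then (cmod (f x))\<^sup>2 else 0) has_sum J g) (carrier G)" for g
      unfolding J_def
      by (intro has_sum_infsum summable_on_comparison_test[OF has_sum_imp_summable[OF hs]]) auto
    have translate: "((\<lambda>x. h (inv g \<otimes> x)) has_sum s) (carrier G)"
      if "g \<in> T" "(h has_sum s) (carrier G)" for g h and s :: real
    proof -
      have gc: "g \<in> carrier G" using that assms(3) by auto
      have bij: "bij_betw (\<lambda>x. inv g \<otimes> x) (carrier G) (carrier G)"
        by (rule bij_betw_byWitness[where f' = "\<lambda>x. g \<otimes> x"])
          (use gc in \<open>auto simp: m_assoc[symmetric]\<close>)
      show ?thesis using that(2) has_sum_reindex_bij_betw[OF bij, of h s] by simp
    qed
    have "((\<lambda>x. \<Sum>g\<in>T. u g x) has_sum (\<Sum>g\<in>T. I)) (carrier G)"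
      unfolding u_def using assms(2)
      by (intro has_sum_sum translate[OF _ hs])
    moreover have "((\<lambda>x. \<Sum>g\<in>T. w g x) has_sum (\<Sum>g\<in>T. J g)) (carrier G)"
      unfolding w_def u_def using assms(2)
      by (intro has_sum_sum translate[OF _ J])
    ultimately have total: "((\<lambda>x. 2 * (\<Sum>g\<in>T. u g x) + 2 * (?n * (\<Sum>g\<in>T. w g x)))
        has_sum (2 * (\<Sum>g\<in>T. I) + 2 * (?n * (\<Sum>g\<in>T. J g)))) (carrier G)"
      by (intro has_sum_add has_sum_cmult_right)
    have "(\<Sum>g\<in>T. J g) \<le> I"
    proof (rule has_sum_mono[OF _ hs])
      show "((\<lambda>x. \<Sum>g\<in>T. if x \<in> A g then (cmod (f x))\<^sup>2 else 0) has_sum (\<Sum>g\<in>T. J g)) (carrier G)"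
        using assms(2) J by (intro has_sum_sum)
      show "(\<Sum>g\<in>T. if x \<in> A g then (cmod (f x))\<^sup>2 else 0) \<le> (cmod (f x))\<^sup>2" for x
        by (rule sum_disjoint_cases[OF assms(2) disj, where x = x and b = "\<lambda>_. (cmod (f x))\<^sup>2"]) auto
    qed
    have "?n * (\<Sum>g\<in>T. J g) \<le> ?n * I" using \<open>(\<Sum>g\<in>T. J g) \<le> I\<close> by (intro mult_left_mono) auto
    have pointwise: "(cmod (?L f x))\<^sup>2 \<le> 2 * (\<Sum>g\<in>T. u g x) + 2 * (?n * (\<Sum>g\<in>T. w g x))"
      if x: "x \<in> carrier G" for x
    proof -
      define v where "v g = f (inv g \<otimes> x)" for g
      define F1 where "F1 = (\<Sum>g\<in>T. if x \<in> A g then v g else 0)"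
      define F2 where "F2 = (\<Sum>g\<in>T. if x \<in> A g then 0 else v g)"
      have "?L f x = (\<Sum>g\<in>T. v g)"
        using x unfolding left_regular_extend_def left_regular_def v_def by simp
      also have "\<dots> = F1 + F2"
        unfolding F1_def F2_def sum.distrib[symmetric] by (intro sum.cong) auto
      finally have L: "?L f x = F1 + F2" .
      have "(cmod (F1 + F2))\<^sup>2 \<le> (cmod F1 + cmod F2)\<^sup>2"
        by (intro power_mono norm_triangle_ineq) auto
      also have "\<dots> \<le> 2 * (cmod F1)\<^sup>2 + 2 * (cmod F2)\<^sup>2"
        using sum_squares_bound[of "cmod F1" "cmod F2"] by (simp add: power2_sum)
      finally have split: "(cmod (F1 + F2))\<^sup>2 \<le> 2 * (cmod F1)\<^sup>2 + 2 * (cmod F2)\<^sup>2" .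
      have u: "u g x = (cmod (v g))\<^sup>2" for g by (simp add: u_def v_def)
      have F1: "(cmod F1)\<^sup>2 \<le> (\<Sum>g\<in>T. u g x)"
      proof (rule sum_disjoint_cases[OF assms(2) disj, where x = x and b = v])
        fix g assume "g \<in> T" "(\<Sum>g\<in>T. if x \<in> A g then v g else 0) = v g"
        then show ?thesis
          unfolding F1_def u using member_le_sum[of g T "\<lambda>g. (cmod (v g))\<^sup>2"] assms(2) by simp
      qed (auto simp: F1_def u intro: sum_nonneg)
      have away: "inv g \<otimes> x \<in> A g" if "g \<in> T" "x \<notin> A g" for g
      proof (rule ccontr)
        have gc: "g \<in> carrier G" using that assms(3) by auto
        assume "inv g \<otimes> x \<notin> A g"
        then have "g \<otimes> (inv g \<otimes> x) \<in> A g" using pp[OF that(1)] gc x by simp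
        then show False using that(2) gc x by (simp add: m_assoc[symmetric])
      qed
      have "cmod F2 \<le> (\<Sum>g\<in>T. 1 * cmod (if x \<in> A g then 0 else v g))"
        unfolding F2_def mult_1 by (rule norm_sum)
      then have "(cmod F2)\<^sup>2 \<le> (\<Sum>g\<in>T. 1 * cmod (if x \<in> A g then 0 else v g))\<^sup>2"
        by (intro power_mono) auto
      also have "\<dots> \<le> (\<Sum>g\<in>T. 1\<^sup>2) * (\<Sum>g\<in>T. (cmod (if x \<in> A g then 0 else v g))\<^sup>2)"
        by (rule Cauchy_Schwarz_ineq_sum)
      also have "\<dots> \<le> ?n * (\<Sum>g\<in>T. w g x)"
        using away by (auto intro!: mult_mono sum_mono simp: w_def u sum_nonneg)
      finally have F2: "(cmod F2)\<^sup>2 \<le> ?n * (\<Sum>g\<in>T. w g x)" .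
      show ?thesis unfolding L using split F1 F2 by linarith
    qed
    have "((\<lambda>x. (cmod (?L f x))\<^sup>2) has_sum (\<Sum>\<^sub>\<infinity>x\<in>carrier G. (cmod (?L f x))\<^sup>2)) (carrier G)"
      by (intro has_sum_infsum summable_on_comparison_test[OF has_sum_imp_summable[OF total] pointwise]) auto
    then have "(\<Sum>\<^sub>\<infinity>x\<in>carrier G. (cmod (?L f x))\<^sup>2) \<le> 2 * (\<Sum>g\<in>T. I) + 2 * (?n * (\<Sum>g\<in>T. J g))"
      using total pointwise by (rule has_sum_mono)
    also have "\<dots> \<le> 4 * (?n * I)" using \<open>?n * (\<Sum>g\<in>T. J g) \<le> ?n * I\<close> by (simp add: mult.commute)
    also have "\<dots> \<le> 4 * ?n" using mult_left_mono[OF I1, of ?n] by simp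
    finally have "ell2_norm G (?L f) \<le> sqrt (4 * ?n)" unfolding ell2_norm_def by simp
    then show ?thesis by (simp add: real_sqrt_mult)
  qed
  show ?thesis unfolding operator_norm_def
  proof (rule cSUP_least)
    have "(\<lambda>_. 0) \<in> {v \<in> ell2 G. ell2_norm G v \<le> 1}" by (simp add: ell2_def ell2_norm_def)
    then show "{v \<in> ell2 G. ell2_norm G v \<le> 1} \<noteq> {}" by blast
  qed (use bound in auto)
qed

lemma operator_norm_identity:
  fixes G (structure)
  assumes "group G"
  shows "1 \<le> operator_norm (ell2 G) (ell2_norm G) (left_regular_extend G (\<lambda>g. if g \<in> {\<one>} then 1 else 0))"
    (is "1 \<le> operator_norm _ _ ?L")
proof -
  interpret group G by fact
  let ?f = "\<lambda>x. if x = \<one> then 1 else 0 :: complex"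
  have hs: "((\<lambda>x. (cmod (?f x))\<^sup>2) has_sum 1) (carrier G)"
  proof -
    have "((\<lambda>x. (cmod (?f x))\<^sup>2) has_sum 1) {\<one>}" by (rule has_sum_finiteI) auto
    then show ?thesis by (rule has_sum_cong_neutral[THEN iffD1, rotated -1]) auto
  qed
  have f: "?f \<in> ell2 G" "ell2_norm G ?f = 1"
    using hs infsumI[OF hs] by (auto simp: ell2_def ell2_norm_def has_sum_imp_summable)
  have L: "?L ?f = ?f"
  proof
    fix x
    have "{g. (if g \<in> {\<one>} then 1 else 0 :: complex) \<noteq> 0} = {\<one>}" by auto
    then show "?L ?f x = ?f x" by (auto simp: left_regular_extend_def left_regular_def)
  qed
  have z: "(\<lambda>g. if g \<in> {\<one>} then 1 else 0) \<in> group_algebra G" by (simp add: group_algebra_def)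
  have "ell2_norm G (?L ?f) \<le> operator_norm (ell2 G) (ell2_norm G) ?L"
    unfolding operator_norm_def
    by (rule cSUP_upper[OF _ bdd_above_ell2(2)[OF assms z]]) (use f in auto)
  then show ?thesis unfolding L f by simp
qed

section \<open>Central commutators in bounded matrix groups\<close>

text \<open>Any submultiplicative norm would do. The sum of the absolute values of the entries needs no analysis.\<close>

definition entry_norm :: "complex mat \<Rightarrow> real" where
  "entry_norm A = (\<Sum>i<dim_row A. \<Sum>j<dim_col A. cmod (A $$ (i, j)))"

lemma entry_norm_carrier:
  "A \<in> carrier_mat n m \<Longrightarrow> entry_norm A = (\<Sum>i<n. \<Sum>j<m. cmod (A $$ (i, j)))"
  by (auto simp: entry_norm_def)

lemma entry_norm_nonneg: "entry_norm A \<ge> 0"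
  by (simp add: entry_norm_def sum_nonneg)

lemma entry_norm_minus:
  assumes "A \<in> carrier_mat n n" "B \<in> carrier_mat n n"
  shows "entry_norm (A - B) \<le> entry_norm A + entry_norm B"
proof -
  have "entry_norm (A - B) = (\<Sum>i<n. \<Sum>j<n. cmod (A $$ (i, j) - B $$ (i, j)))"
    unfolding entry_norm_carrier[OF minus_carrier_mat[OF assms(2)]]
    using assms by (intro sum.cong) auto
  also have "\<dots> \<le> (\<Sum>i<n. \<Sum>j<n. cmod (A $$ (i, j)) + cmod (B $$ (i, j)))"
    by (intro sum_mono norm_triangle_ineq4)
  finally show ?thesis using assms by (simp add: entry_norm_carrier sum.distrib)
qed

lemma entry_norm_mult:
  assumes A: "A \<in> carrier_mat n n" and B: "B \<in> carrier_mat n n"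
  shows "entry_norm (A * B) \<le> entry_norm A * entry_norm B"
proof -
  have "entry_norm (A * B) = (\<Sum>i<n. \<Sum>j<n. cmod (\<Sum>k<n. A $$ (i, k) * B $$ (k, j)))"
    using A B by (simp add: entry_norm_carrier[of "A * B" n n] scalar_prod_def atLeast0LessThan)
  also have "\<dots> \<le> (\<Sum>i<n. \<Sum>j<n. \<Sum>k<n. cmod (A $$ (i, k)) * cmod (B $$ (k, j)))"
    unfolding norm_mult[symmetric] by (intro sum_mono norm_sum)
  also have "\<dots> = (\<Sum>i<n. \<Sum>k<n. cmod (A $$ (i, k)) * (\<Sum>j<n. cmod (B $$ (k, j))))"
    unfolding sum_distrib_left by (intro sum.cong refl sum.swap)
  also have "\<dots> \<le> (\<Sum>i<n. \<Sum>k<n. cmod (A $$ (i, k)) * entry_norm B)"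
  proof (intro sum_mono mult_left_mono)
    fix k assume "k \<in> {..<n}"
    then show "(\<Sum>j<n. cmod (B $$ (k, j))) \<le> entry_norm B"
      using B member_le_sum[of k "{..<n}" "\<lambda>k. \<Sum>j<n. cmod (B $$ (k, j))"]
      by (simp add: entry_norm_carrier sum_nonneg)
  qed auto
  also have "\<dots> = entry_norm A * entry_norm B"
    using A by (simp add: entry_norm_carrier sum_distrib_right)
  finally show ?thesis .
qed

lemma entry_norm_eq_0:
  assumes "A \<in> carrier_mat n n" "entry_norm A = 0"
  shows "A = 0\<^sub>m n n"
proof (rule eq_matI)
  fix i j assume ij: "i < dim_row (0\<^sub>m n n)" "j < dim_col (0\<^sub>m n n)"
  have "(\<Sum>j<n. cmod (A $$ (i, j))) = 0"
    using assms ij by (simp add: entry_norm_carrier sum_nonneg_eq_0_iff sum_nonneg)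
  then show "A $$ (i, j) = 0\<^sub>m n n $$ (i, j)" using ij by (simp add: sum_nonneg_eq_0_iff)
qed (use assms in auto)

lemma entry_norm_unitary:
  assumes "U \<in> carrier (unitary_group n)"
  shows "entry_norm U \<le> real n * real n"
proof -
  have U: "U \<in> carrier_mat n n" "U * mat_adjoint U = 1\<^sub>m n"
    using assms by (auto simp: unitary_group_def)
  have "cmod (U $$ (i, j)) \<le> 1" if ij: "i < n" "j < n" for i j
  proof -
    have "(\<Sum>k<n. U $$ (i, k) * cnj (U $$ (i, k))) = (U * mat_adjoint U) $$ (i, i)"
      using U(1) ij mat_adjoint_carrier[OF U(1)]
      by (auto simp: scalar_prod_def atLeast0LessThan mat_adjoint_index intro!: sum.cong)
    also have "\<dots> = 1" using ij U(2) by simp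
    finally have "(\<Sum>k<n. complex_of_real ((cmod (U $$ (i, k)))\<^sup>2)) = 1"
      unfolding complex_norm_square .
    then have "complex_of_real (\<Sum>k<n. (cmod (U $$ (i, k)))\<^sup>2) = complex_of_real 1" by simp
    then have "(\<Sum>k<n. (cmod (U $$ (i, k)))\<^sup>2) = 1" by (simp only: of_real_eq_iff)
    then have "(cmod (U $$ (i, j)))\<^sup>2 \<le> 1\<^sup>2"
      using member_le_sum[of j "{..<n}" "\<lambda>k. (cmod (U $$ (i, k)))\<^sup>2"] ij by simp
    then show ?thesis by (rule power2_le_imp_le) simp
  qed
  then have "entry_norm U \<le> (\<Sum>i<n. \<Sum>j<n. 1)"
    unfolding entry_norm_carrier[OF U(1)] by (intro sum_mono) auto
  then show ?thesis by simp
qed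

text \<open>A group of matrices near the identity is trivial: if \<open>E = D k - 1\<close> is small, then
\<open>D (2 k) - 1 = 2 E + E\<^sup>2\<close> is longer than \<open>E\<close> by a factor of at least \<open>3 / 2\<close>, which cannot go on forever.\<close>

lemma small_powers_trivial:
  assumes D: "\<And>k. D k \<in> carrier_mat n n" and hom: "\<And>k l :: nat. D (k + l) = D k * D l"
    and small: "\<And>k. entry_norm (D k - 1\<^sub>m n) \<le> 1 / 2"
  shows "D 1 = 1\<^sub>m n"
proof -
  let ?\<delta> = "\<lambda>k. entry_norm (D (2 ^ k) - 1\<^sub>m n)"
  have double: "(3 / 2) * ?\<delta> k \<le> ?\<delta> (Suc k)" for k
  proof -
    define E where "E = D (2 ^ k) - 1\<^sub>m n"
    have E: "E \<in> carrier_mat n n" unfolding E_def by (intro minus_carrier_mat) simp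
    have DE: "D (2 ^ k) = 1\<^sub>m n + E" unfolding E_def using D[of "2 ^ k"]
      by (intro eq_matI) auto
    have "D (2 ^ Suc k) = D (2 ^ k) * D (2 ^ k)"
      using hom[of "2 ^ k" "2 ^ k"] by (simp add: mult_2)
    also have "\<dots> = (1\<^sub>m n + E) + (1\<^sub>m n + E) * E"
      unfolding DE using E
      by (simp add: mult_add_distrib_mat[of _ n n _ n] add_mult_distrib_mat[of _ n n _ _ n])
    also have "\<dots> = 1\<^sub>m n + (E + E + E * E)"
      using E by (subst add_mult_distrib_mat[of _ n n]) (auto intro!: eq_matI)
    finally have "D (2 ^ Suc k) - 1\<^sub>m n = E + E + E * E"
      using E by (auto intro!: eq_matI)
    then have "?\<delta> (Suc k) = entry_norm (E + E + E * E)" by simp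
    moreover have "entry_norm (E + E) \<le> entry_norm (E + E + E * E) + entry_norm (E * E)"
    proof -
      have eq: "(E + E + E * E) - E * E = E + E" using E by (auto intro!: eq_matI)
      have "E + E + E * E \<in> carrier_mat n n" "E * E \<in> carrier_mat n n" using E by simp_all
      from entry_norm_minus[OF this] show ?thesis unfolding eq .
    qed
    moreover have "entry_norm (E + E) = 2 * entry_norm E"
    proof -
      have two: "cmod (z + z) = 2 * cmod z" for z :: complex
        by (simp add: norm_mult flip: mult_2)
      have "entry_norm (E + E) = (\<Sum>i<n. \<Sum>j<n. cmod (E $$ (i, j) + E $$ (i, j)))"
        unfolding entry_norm_carrier[OF add_carrier_mat[OF E]] using E by (intro sum.cong) auto
      then show ?thesis unfolding entry_norm_carrier[OF E] two by (simp add: sum_distrib_left)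
    qed
    moreover have "entry_norm (E * E) \<le> entry_norm E * entry_norm E" by (rule entry_norm_mult[OF E E])
    moreover have "entry_norm E * entry_norm E \<le> (1 / 2) * entry_norm E"
      using small[of "2 ^ k"] by (intro mult_right_mono entry_norm_nonneg) (simp add: E_def)
    ultimately show ?thesis unfolding E_def by linarith
  qed
  have "(3 / 2) ^ k * ?\<delta> 0 \<le> ?\<delta> k" for k
  proof (induction k)
    case (Suc k)
    then show ?case using double[of k] by simp
  qed simp
  then have bd: "(3 / 2) ^ k * ?\<delta> 0 \<le> 1 / 2" for k using small[of "2 ^ k"] order.trans by blast
  have "?\<delta> 0 = 0"
  proof (rule ccontr)
    assume "?\<delta> 0 \<noteq> 0"
    then have "?\<delta> 0 > 0" using entry_norm_nonneg by (metis less_eq_real_def)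
    moreover obtain k where "(1 / 2) / ?\<delta> 0 < (3 / 2) ^ k"
      using real_arch_pow[of "3 / 2" "(1 / 2) / ?\<delta> 0"] by auto
    ultimately have "1 / 2 < (3 / 2) ^ k * ?\<delta> 0" by (simp add: divide_less_eq)
    then show False using bd[of k] by linarith
  qed
  then have "D 1 - 1\<^sub>m n = 0\<^sub>m n n"
    by (intro entry_norm_eq_0 minus_carrier_mat) auto
  then have zero: "(D 1 - 1\<^sub>m n) $$ (i, j) = 0" if "i < n" "j < n" for i j using that by simp
  show ?thesis
  proof (rule eq_matI)
    fix i j assume "i < dim_row (1\<^sub>m n)" "j < dim_col (1\<^sub>m n)"
    then show "D 1 $$ (i, j) = 1\<^sub>m n $$ (i, j)" using zero[of i j] D[of 1] by simp
  qed (use D[of 1] in auto)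
qed

text \<open>Pigeonhole: rounding the real and imaginary parts of all entries to multiples of \<open>1 / L\<close> leaves only finitely many matrices.\<close>

lemma unitary_sequence_almost_repeats:
  assumes f: "\<And>s :: nat. f s \<in> carrier (unitary_group n)" and "\<delta> > 0"
  obtains s t where "s < t" "entry_norm (f t - f s) \<le> \<delta>"
proof -
  have fc: "f s \<in> carrier_mat n n" for s using f[of s] by (auto simp: unitary_group_def)
  \<comment> \<open>A mesh so fine that the errors of all \<open>n * n\<close> entries add up to at most \<open>\<delta>\<close>.\<close>
  obtain L :: nat where L: "2 * real n * real n / \<delta> < real L" using reals_Archimedean2 by blast
  have "0 \<le> 2 * real n * real n / \<delta>" using assms(2) by simp
  then have L0: "real L > 0" using L by linarith
  define M :: int where "M = int (L * n * n)"
  define \<phi> where "\<phi> s = (\<lambda>(i, j)\<in>{..<n} \<times> {..<n}. (\<lfloor>L * Re (f s $$ (i, j))\<rfloor>, \<lfloor>L * Im (f s $$ (i, j))\<rfloor>))" for s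
  have rng: "\<lfloor>L * x\<rfloor> \<in> {- M..M}" if "\<bar>x\<bar> \<le> real n * real n" for x :: real
  proof -
    have "\<bar>L * x\<bar> \<le> L * (real n * real n)" unfolding abs_mult using that by (intro mult_mono) auto
    then have "- of_int M \<le> L * x" "L * x \<le> of_int M" by (auto simp: M_def mult.assoc)
    then show ?thesis by (simp add: le_floor_iff floor_le_iff)
  qed
  have "range \<phi> \<subseteq> ({..<n} \<times> {..<n}) \<rightarrow>\<^sub>E ({- M..M} \<times> {- M..M})"
  proof clarify
    fix s
    have "cmod (f s $$ (i, j)) \<le> real n * real n" if ij: "i < n" "j < n" for i j
    proof -
      have "cmod (f s $$ (i, j)) \<le> (\<Sum>j<n. cmod (f s $$ (i, j)))"
        using ij by (intro member_le_sum) auto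
      also have "\<dots> \<le> entry_norm (f s)"
        unfolding entry_norm_carrier[OF fc] using ij
        by (intro member_le_sum[where f = "\<lambda>i. \<Sum>j<n. cmod (f s $$ (i, j))"]) (auto intro: sum_nonneg)
      finally show ?thesis using entry_norm_unitary[OF f] by (rule order.trans)
    qed
    then have "\<bar>Re (f s $$ (i, j))\<bar> \<le> real n * real n" "\<bar>Im (f s $$ (i, j))\<bar> \<le> real n * real n"
      if "i < n" "j < n" for i j
      using that abs_Re_le_cmod abs_Im_le_cmod order.trans by blast+
    then show "\<phi> s \<in> ({..<n} \<times> {..<n}) \<rightarrow>\<^sub>E ({- M..M} \<times> {- M..M})"
      using rng unfolding \<phi>_def by (intro restrict_PiE_iff[THEN iffD2]) auto
  qed
  then have "finite (range \<phi>)" by (rule finite_subset) (intro finite_PiE; simp)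
  then have "\<not> inj \<phi>" using finite_imageD infinite_UNIV_nat by blast
  then obtain s t where "s \<noteq> t" "\<phi> s = \<phi> t" by (auto simp: inj_on_def)
  then obtain s t where st: "s < t" "\<phi> s = \<phi> t" by (metis linorder_neqE_nat)
  have floor_close: "\<bar>y - x\<bar> \<le> 1 / L" if "\<lfloor>L * x\<rfloor> = \<lfloor>L * y\<rfloor>" for x y :: real
  proof -
    have "\<bar>L * y - L * x\<bar> \<le> 1" using that by linarith
    then have "L * \<bar>y - x\<bar> \<le> 1" using L0 by (simp add: abs_mult flip: right_diff_distrib)
    then show ?thesis using L0 by (simp add: pos_le_divide_eq mult.commute)
  qed
  have "cmod (f t $$ (i, j) - f s $$ (i, j)) \<le> 2 / L" if "i < n" "j < n" for i j
  proof -
    have "\<phi> s (i, j) = \<phi> t (i, j)" using st(2) by simp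
    then have "\<lfloor>L * Re (f s $$ (i, j))\<rfloor> = \<lfloor>L * Re (f t $$ (i, j))\<rfloor>"
      "\<lfloor>L * Im (f s $$ (i, j))\<rfloor> = \<lfloor>L * Im (f t $$ (i, j))\<rfloor>"
      using that by (simp_all add: \<phi>_def)
    from floor_close[OF this(1)] floor_close[OF this(2)] show ?thesis
      using cmod_le[of "f t $$ (i, j) - f s $$ (i, j)"] by simp
  qed
  then have "(\<Sum>i<n. \<Sum>j<n. cmod (f t $$ (i, j) - f s $$ (i, j))) \<le> (\<Sum>i<n. \<Sum>j<n. 2 / L)"
    by (intro sum_mono) auto
  moreover have "entry_norm (f t - f s) = (\<Sum>i<n. \<Sum>j<n. cmod (f t $$ (i, j) - f s $$ (i, j)))"
    unfolding entry_norm_carrier[OF minus_carrier_mat[OF fc]]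
    using fc[of s] fc[of t] by (intro sum.cong) auto
  ultimately have "entry_norm (f t - f s) \<le> real n * (real n * (2 / L))" by simp
  also have "\<dots> \<le> \<delta>"
  proof -
    have "2 * real n * real n < L * \<delta>" using L assms(2) by (simp add: pos_divide_less_eq)
    then have "2 * real n * real n / L \<le> \<delta>" using L0 by (simp add: pos_divide_le_eq mult.commute)
    then show ?thesis by (simp add: mult_ac)
  qed
  finally show ?thesis using st(1) that by blast
qed

text \<open>Some \<open>f m\<close> with \<open>m > 0\<close> is close to the identity. Then every \<open>h (m * k)\<close>, a commutator of \<open>f m\<close> with the bounded
matrix \<open>g k\<close>, is equally close up to a constant that does not depend on \<open>k\<close>. So the powers of \<open>h m\<close> form a
small subgroup.\<close>

theorem heisenberg_center_finite_order:
  assumes U: "\<And>s. f s \<in> carrier (unitary_group n)" "\<And>s. g s \<in> carrier (unitary_group n)"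
      "\<And>s. h s \<in> carrier (unitary_group n)"
    and f: "\<And>s t :: nat. f (s + t) = f s * f t" and h: "\<And>s t. h (s + t) = h s * h t" "h 0 = 1\<^sub>m n"
    and fgh: "\<And>s t. f s * g t = h (s * t) * (g t * f s)"
  obtains m where "m > 0" "h m = 1\<^sub>m n"
proof -
  have c: "f s \<in> carrier_mat n n" "g s \<in> carrier_mat n n" "h s \<in> carrier_mat n n" for s
    using U[of s] by (auto simp: unitary_group_def)
  define K where "K = real n * real n"
  have K: "entry_norm V \<le> K" if "V \<in> carrier (unitary_group n)" for V
    unfolding K_def by (rule entry_norm_unitary[OF that])
  have inv: "A = (A * V) * mat_adjoint V" "mat_adjoint V \<in> carrier (unitary_group n)"
    "entry_norm (A - 1\<^sub>m n) \<le> entry_norm (A * V - V) * K"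
    if "V \<in> carrier (unitary_group n)" "A \<in> carrier_mat n n" for A V
  proof -
    have V: "V \<in> carrier_mat n n" "V * mat_adjoint V = 1\<^sub>m n" "mat_adjoint V \<in> carrier_mat n n"
      using that(1) by (auto simp: unitary_group_def mat_adjoint_carrier)
    show A: "A = (A * V) * mat_adjoint V"
      using that(2) V by (simp add: assoc_mult_mat[of _ n n _ n _ n])
    show adj: "mat_adjoint V \<in> carrier (unitary_group n)"
      using that(1) by (auto simp: unitary_group_def mat_adjoint_carrier mat_adjoint_adjoint)
    have "A - 1\<^sub>m n = (A * V - V) * mat_adjoint V"
      using minus_mult_distrib_mat[of "A * V" n n V "mat_adjoint V" n] that(2) V A by simp
    then have "entry_norm (A - 1\<^sub>m n) \<le> entry_norm (A * V - V) * entry_norm (mat_adjoint V)"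
      using entry_norm_mult[OF minus_carrier_mat[OF V(1)] V(3), of "A * V"] by simp
    also have "\<dots> \<le> entry_norm (A * V - V) * K"
      by (intro mult_left_mono K adj entry_norm_nonneg)
    finally show "entry_norm (A - 1\<^sub>m n) \<le> entry_norm (A * V - V) * K" .
  qed
  have K0: "K \<ge> 0" by (simp add: K_def)
  \<comment> \<open>Chosen so that \<open>2 * \<delta> * K ^ 3 \<le> 1 / 2\<close>, the estimate for \<open>h (m * k)\<close> below.\<close>
  define \<delta> where "\<delta> = 1 / (4 * K * K * K + 4)"
  have d0: "\<delta> > 0" using K0 unfolding \<delta>_def by (intro divide_pos_pos add_nonneg_pos mult_nonneg_nonneg) auto
  obtain s t where st: "s < t" "entry_norm (f t - f s) \<le> \<delta>"
    by (rule unitary_sequence_almost_repeats[OF U(1) d0])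
  define m where "m = t - s"
  have "f t = f m * f s" using st(1) f[of m s] by (simp add: m_def)
  then have fm: "entry_norm (f m - 1\<^sub>m n) \<le> \<delta> * K"
  proof -
    have "entry_norm (f m - 1\<^sub>m n) \<le> entry_norm (f m * f s - f s) * K" by (rule inv(3)[OF U(1) c(1)])
    also have "\<dots> \<le> \<delta> * K" using st(2) \<open>f t = f m * f s\<close> K0 by (simp add: mult_right_mono)
    finally show ?thesis .
  qed
  have small: "entry_norm (h (m * k) - 1\<^sub>m n) \<le> 1 / 2" for k
  proof -
    let ?F = "f m - 1\<^sub>m n" and ?G = "g k"
    have GF: "?G * f m \<in> carrier (unitary_group n)"
      using U group.is_monoid[OF group_unitary_group[of n]] monoid.m_closed[of "unitary_group n" ?G "f m"]
      by (simp add: unitary_group_def)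
    have F: "?F \<in> carrier_mat n n" by (intro minus_carrier_mat) simp
    \<comment> \<open>A commutator with \<open>f m\<close> depends only on the difference of \<open>f m\<close> from the identity.\<close>
    have "h (m * k) * (?G * f m) - ?G * f m = ?F * ?G - ?G * ?F"
    proof -
      have "?F * ?G = f m * ?G - ?G" "?G * ?F = ?G * f m - ?G"
        using minus_mult_distrib_mat[OF c(1) one_carrier_mat c(2)[of k]]
          mult_minus_distrib_mat[OF c(2)[of k] c(1) one_carrier_mat] c(2)[of k] by simp_all
      then show ?thesis unfolding fgh[symmetric] using c(1)[of m] c(2)[of k] by (intro eq_matI) auto
    qed
    then have "entry_norm (h (m * k) - 1\<^sub>m n) \<le> entry_norm (?F * ?G - ?G * ?F) * K"
      using inv(3)[OF GF c(3), of "m * k"] by simp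
    also have "entry_norm (?F * ?G - ?G * ?F) \<le> entry_norm ?F * entry_norm ?G + entry_norm ?G * entry_norm ?F"
      using entry_norm_minus[OF mult_carrier_mat[OF F c(2)] mult_carrier_mat[OF c(2) F], of k k]
        entry_norm_mult[OF F c(2), of k] entry_norm_mult[OF c(2) F, of k] by linarith
    also have "\<dots> \<le> 2 * (\<delta> * K * K)"
    proof -
      have "entry_norm ?F * entry_norm ?G \<le> \<delta> * K * K"
        using K0 d0 by (intro mult_mono fm K[OF U(2)] entry_norm_nonneg mult_nonneg_nonneg) auto
      then show ?thesis by (simp add: mult.commute)
    qed
    finally have "entry_norm (h (m * k) - 1\<^sub>m n) \<le> 2 * (\<delta> * K * K) * K"
      using K0 by (simp add: mult_right_mono)
    also have "\<dots> = 2 * (K * K * K) / (4 * (K * K * K) + 4)" unfolding \<delta>_def by (simp add: mult_ac)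
    also have "\<dots> \<le> 1 / 2" using K0 by (simp add: divide_le_eq add_nonneg_pos)
    finally show ?thesis .
  qed
  have "h (m * 1) = 1\<^sub>m n"
    by (rule small_powers_trivial[where D = "\<lambda>k. h (m * k)"]) (use c small h in \<open>simp_all add: ring_distribs\<close>)
  then have "h m = 1\<^sub>m n" by simp
  then show ?thesis using that[of m] st(1) by (simp add: m_def)
qed

section \<open>The special linear group of degree four\<close>

lemma transvection_mult_index:
  fixes A :: "int mat"
  assumes "A \<in> carrier_mat n n" "l < n" "i < n" "j < n"
  shows "(addrow_mat n a k l * A) $$ (i, j) = (if k = i then a * A $$ (l, j) + A $$ (i, j) else A $$ (i, j))"
  using addrow_mat[OF assms(1,2), of a k, symmetric] assms by simp

lemma
  fixes s t :: int
  shows transvection_add: "k < n \<Longrightarrow> l < n \<Longrightarrow> k \<noteq> l \<Longrightarrow>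
      addrow_mat n s k l * addrow_mat n t k l = addrow_mat n (s + t) k l"
    and transvection_chain: "\<lbrakk>k < n; l < n; m < n; k \<noteq> l; l \<noteq> m; k \<noteq> m\<rbrakk> \<Longrightarrow>
      addrow_mat n s k l * addrow_mat n t l m =
      addrow_mat n (s * t) k m * (addrow_mat n t l m * addrow_mat n s k l)"
    and transvection_commute: "\<lbrakk>k < n; l < n; k' < n; l' < n; k \<noteq> l; k' \<noteq> l'; l \<noteq> k'; k \<noteq> l'\<rbrakk> \<Longrightarrow>
      addrow_mat n s k l * addrow_mat n t k' l' = addrow_mat n t k' l' * addrow_mat n s k l"
    and transvection_zero: "addrow_mat n (0 :: int) k l = 1\<^sub>m n"
proof -
  have c: "addrow_mat n x k l * addrow_mat n y i j \<in> carrier_mat n n" for x y :: int and k l i j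
    by (intro mult_carrier_mat[where n = n]) simp_all
  note idx = transvection_mult_index[where n = n] transvection_mult_index[OF c]
  show "k < n \<Longrightarrow> l < n \<Longrightarrow> k \<noteq> l \<Longrightarrow>
      addrow_mat n s k l * addrow_mat n t k l = addrow_mat n (s + t) k l"
    by (rule eq_matI) (auto simp: idx simp del: index_mult_mat(1))
  show "\<lbrakk>k < n; l < n; m < n; k \<noteq> l; l \<noteq> m; k \<noteq> m\<rbrakk> \<Longrightarrow>
      addrow_mat n s k l * addrow_mat n t l m =
      addrow_mat n (s * t) k m * (addrow_mat n t l m * addrow_mat n s k l)"
    by (rule eq_matI) (auto simp: idx simp del: index_mult_mat(1))
  show "\<lbrakk>k < n; l < n; k' < n; l' < n; k \<noteq> l; k' \<noteq> l'; l \<noteq> k'; k \<noteq> l'\<rbrakk> \<Longrightarrow>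
      addrow_mat n s k l * addrow_mat n t k' l' = addrow_mat n t k' l' * addrow_mat n s k l"
    by (rule eq_matI) (auto simp: idx simp del: index_mult_mat(1))
  show "addrow_mat n (0 :: int) k l = 1\<^sub>m n"
    by (rule eq_matI) auto
qed

text \<open>A type with exactly four elements, because the Steinberg relations are required for all indices of the index type.\<close>

datatype coord = C0 | C1 | C2 | C3

primrec pos :: "coord \<Rightarrow> nat" where
  "pos C0 = 0" | "pos C1 = 1" | "pos C2 = 2" | "pos C3 = 3"

lemma pos_less: "pos i < 4" by (cases i) auto

lemma pos_eq_iff: "pos i = pos j \<longleftrightarrow> i = j" by (cases i; cases j) auto

lemma UNIV_coord: "UNIV = {C0, C1, C2, C3}"
proof -
  have "i \<in> {C0, C1, C2, C3}" for i by (cases i) auto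
  then show ?thesis by blast
qed

lemma third_coord: "\<exists>k. k \<noteq> i \<and> k \<noteq> (j :: coord)"
  by (cases i; cases j) (auto intro: exI[of _ C0] exI[of _ C1] exI[of _ C2])

definition elementary :: "coord \<Rightarrow> coord \<Rightarrow> int \<Rightarrow> int mat" where
  "elementary i j t = addrow_mat 4 t (pos i) (pos j)"

lemma elementary_carrier: "i \<noteq> j \<Longrightarrow> elementary i j t \<in> carrier (SL 4)"
  by (simp add: SL_def elementary_def det_addrow_mat pos_eq_iff)

lemma elementary_add: "i \<noteq> j \<Longrightarrow> elementary i j s * elementary i j t = elementary i j (s + t)"
  and elementary_chain: "\<lbrakk>i \<noteq> j; j \<noteq> k; i \<noteq> k\<rbrakk> \<Longrightarrow>
    elementary i j s * elementary j k t = elementary i k (s * t) * (elementary j k t * elementary i j s)"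
  and elementary_commute: "\<lbrakk>i \<noteq> j; k \<noteq> l; j \<noteq> k; i \<noteq> l\<rbrakk> \<Longrightarrow>
    elementary i j s * elementary k l t = elementary k l t * elementary i j s"
  and elementary_zero: "elementary i j 0 = 1\<^sub>m 4"
  by (simp_all add: elementary_def transvection_zero transvection_add transvection_chain
      transvection_commute pos_less pos_eq_iff)

lemma rep_facts:
  assumes "unitary_rep (SL 4) n \<rho>"
  shows "A \<in> carrier (SL 4) \<Longrightarrow> \<rho> A \<in> carrier (unitary_group n)"
    and "A \<in> carrier (SL 4) \<Longrightarrow> B \<in> carrier (SL 4) \<Longrightarrow> \<rho> (A * B) = \<rho> A * \<rho> B"
    and "\<rho> (1\<^sub>m 4) = 1\<^sub>m n"
    and "A \<in> carrier (SL 4) \<Longrightarrow> \<rho> A \<in> carrier_mat n n"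
proof -
  have h: "\<rho> \<in> hom (SL 4) (unitary_group n)" using assms by (simp add: unitary_rep_def)
  interpret group_hom "SL 4" "unitary_group n" \<rho>
    by (simp add: group_hom_def group_hom_axioms_def group_SL group_unitary_group h)
  show 1: "A \<in> carrier (SL 4) \<Longrightarrow> \<rho> A \<in> carrier (unitary_group n)" for A by simp
  show "A \<in> carrier (SL 4) \<Longrightarrow> B \<in> carrier (SL 4) \<Longrightarrow> \<rho> (A * B) = \<rho> A * \<rho> B"
    using hom_mult[of A B] by (simp add: SL_def unitary_group_def)
  show "\<rho> (1\<^sub>m 4) = 1\<^sub>m n" using hom_one by (simp add: SL_def unitary_group_def)
  show "A \<in> carrier (SL 4) \<Longrightarrow> \<rho> A \<in> carrier_mat n n"
    using 1 by (simp add: unitary_group_def)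
qed

lemma SL_mult_closed: "A \<in> carrier (SL n) \<Longrightarrow> B \<in> carrier (SL n) \<Longrightarrow> A * B \<in> carrier (SL n)"
  using group.is_monoid[OF group_SL[of n]] monoid.m_closed[of "SL n" A B] by (simp add: SL_def)

text \<open>Every elementary matrix is a central commutator in a Heisenberg group, through a third coordinate.\<close>

lemma elementary_common_order:
  assumes \<rho>: "unitary_rep (SL 4) n \<rho>"
  obtains N :: nat where "N > 0" "\<And>i j. i \<noteq> j \<Longrightarrow> \<rho> (elementary i j (int N)) = 1\<^sub>m n"
proof -
  note \<rho>f = rep_facts[OF \<rho>]
  have "\<exists>m>0. i \<noteq> j \<longrightarrow> \<rho> (elementary i j (int m)) = 1\<^sub>m n" for i j
  proof (cases "i = j")
    case False
    obtain k where k: "k \<noteq> i" "k \<noteq> j" using third_coord by blast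
    have e: "elementary i k s \<in> carrier (SL 4)" "elementary k j s \<in> carrier (SL 4)" "elementary i j s \<in> carrier (SL 4)" for s
      using False k elementary_carrier by metis+
    obtain m where "m > 0" "\<rho> (elementary i j (int m)) = 1\<^sub>m n"
    proof (rule heisenberg_center_finite_order[where f = "\<lambda>s. \<rho> (elementary i k (int s))"
          and g = "\<lambda>s. \<rho> (elementary k j (int s))" and h = "\<lambda>s. \<rho> (elementary i j (int s))" and n = n])
      show "\<rho> (elementary i k (int s)) * \<rho> (elementary k j (int t)) =
          \<rho> (elementary i j (int (s * t))) * (\<rho> (elementary k j (int t)) * \<rho> (elementary i k (int s)))" for s t
        using elementary_chain[of i k j "int s" "int t"] k False
        by (simp add: \<rho>f(2)[OF e(1) e(2), symmetric] \<rho>f(2)[OF e(2) e(1), symmetric]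
            \<rho>f(2)[OF e(3) SL_mult_closed[OF e(2) e(1)], symmetric])
    qed (use e \<rho>f(1,3) k False in \<open>auto simp: elementary_zero elementary_add \<rho>f(2)[symmetric]\<close>)
    then show ?thesis by blast
  qed (auto intro: exI[of _ 1])
  then obtain m where m: "\<And>i j. m i j > 0" "\<And>i j. i \<noteq> j \<Longrightarrow> \<rho> (elementary i j (int (m i j))) = 1\<^sub>m n"
    by metis
  define N where "N = (\<Prod>i\<in>UNIV. \<Prod>j\<in>UNIV. m i j)"
  have fin: "finite (UNIV :: coord set)" unfolding UNIV_coord by simp
  have "\<rho> (elementary i j (int N)) = 1\<^sub>m n" if ij: "i \<noteq> j" for i j
  proof -
    have *: "\<rho> (elementary i j (int (m i j * k))) = 1\<^sub>m n" for k
    proof (induction k)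
      case (Suc k)
      have "elementary i j (int (m i j * Suc k)) = elementary i j (int (m i j)) * elementary i j (int (m i j * k))"
        using ij by (simp add: elementary_add algebra_simps)
      then show ?case using Suc m(2)[OF ij] \<rho>f(2)[OF elementary_carrier[OF ij] elementary_carrier[OF ij]] by simp
    qed (use \<rho>f(3) in \<open>simp add: elementary_zero\<close>)
    have "m i j dvd (\<Prod>j\<in>UNIV. m i j)" using fin by (intro dvd_prodI) auto
    also have "\<dots> dvd N" unfolding N_def using fin by (intro dvd_prodI) auto
    finally show ?thesis using * by (metis dvdE)
  qed
  moreover have "N > 0" using m(1) by (simp add: N_def prod_pos)
  ultimately show ?thesis using that by blast
qed

definition mat_action :: "nat \<Rightarrow> complex mat \<Rightarrow> (nat \<Rightarrow> complex) \<Rightarrow> nat \<Rightarrow> complex" where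
  "mat_action n A f i = (if i < n then (\<Sum>j<n. A $$ (i, j) * f j) else 0)"

text \<open>The vectors of length \<open>n\<close>, as functions that vanish from \<open>n\<close> on. Unlike vectors of a fixed dimension,
these are a subspace of a type that is an additive group.\<close>

definition supported :: "nat \<Rightarrow> (nat \<Rightarrow> complex) set" where
  "supported n = {f. \<forall>i\<ge>n. f i = 0}"

lemma mat_action_supported: "mat_action n A f \<in> supported n"
  by (simp add: mat_action_def supported_def)

lemma mat_action_mult:
  assumes "A \<in> carrier_mat n n" "B \<in> carrier_mat n n"
  shows "mat_action n (A * B) f = mat_action n A (mat_action n B f)"
proof
  fix i
  show "mat_action n (A * B) f i = mat_action n A (mat_action n B f) i"
  proof (cases "i < n")
    case True
    have "mat_action n (A * B) f i = (\<Sum>j<n. \<Sum>k<n. A $$ (i, k) * B $$ (k, j) * f j)"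
      using True assms by (simp add: mat_action_def scalar_prod_def atLeast0LessThan sum_distrib_right)
    also have "\<dots> = (\<Sum>k<n. \<Sum>j<n. A $$ (i, k) * B $$ (k, j) * f j)" by (rule sum.swap)
    also have "\<dots> = mat_action n A (mat_action n B f) i"
      using True by (simp add: mat_action_def sum_distrib_left mult.assoc)
    finally show ?thesis .
  qed (simp add: mat_action_def)
qed

lemma mat_action_one: "f \<in> supported n \<Longrightarrow> mat_action n (1\<^sub>m n) f = f"
  by (auto simp: mat_action_def supported_def fun_eq_iff if_distrib if_distribR sum.delta cong: if_cong)

definition fun_scale :: "complex \<Rightarrow> (nat \<Rightarrow> complex) \<Rightarrow> nat \<Rightarrow> complex" where
  "fun_scale r f = (\<lambda>i. r * f i)"

lemma complex_vector_space_fun_scale: "complex_vector_space fun_scale"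
  by unfold_locales (auto simp: fun_scale_def fun_eq_iff algebra_simps)

lemma elementary_fixed_vector:
  assumes \<rho>: "unitary_rep (SL 4) n \<rho>" and "n > 0"
  obtains v where "v \<in> supported n" "v \<noteq> 0"
    "\<And>t. mat_action n (\<rho> (elementary C0 C1 t)) v = v" "\<And>t. mat_action n (\<rho> (elementary C1 C0 (8 * t))) v = v"
proof -
  note \<rho>f = rep_facts[OF \<rho>]
  obtain N where N: "N > 0" "\<And>i j. i \<noteq> j \<Longrightarrow> \<rho> (elementary i j (int N)) = 1\<^sub>m n"
    by (rule elementary_common_order[OF \<rho>]) blast
  let ?S = "supported n"
  define X where "X i j t f = (if f \<in> ?S then mat_action n (\<rho> (elementary i j t)) f else f)" for i j t f
  have X_S: "X i j t f \<in> ?S \<longleftrightarrow> f \<in> ?S" for i j t f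
    by (simp add: X_def mat_action_supported)
  have X_X: "X i j s (X k l t f) = (if f \<in> ?S then mat_action n (\<rho> (elementary i j s * elementary k l t)) f else f)"
    if "i \<noteq> j" "k \<noteq> l" for i j k l s t f
    using that \<rho>f(2,4) elementary_carrier
    by (simp add: X_def mat_action_supported mat_action_mult)
  interpret complex_vector_space fun_scale by (rule complex_vector_space_fun_scale)
  have subspace: "subspace ?S"
    by (rule subspaceI) (auto simp: supported_def fun_scale_def)
  have rep: "steinberg_rep X (int N) C0 C1 C2 fun_scale C3 ?S"
  proof unfold_locales
    show "X i j 0 x = x" for i j x
      using \<rho>f(3) by (simp add: X_def elementary_zero mat_action_one)
    show "X i j s (X i j t x) = X i j (s + t) x" if "i \<noteq> j" for i j s t x
      unfolding X_X[OF that that] elementary_add[OF that] by (simp add: X_def)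
    show "X i j s (X k l t x) = X k l t (X i j s x)"
      if "i \<noteq> j" "k \<noteq> l" "j \<noteq> k" "i \<noteq> l" for i j k l s t x
      unfolding X_X[OF that(1,2)] X_X[OF that(2,1)] elementary_commute[OF that] ..
    show "X i j s (X j k t x) = X i k (s * t) (X j k t (X i j s x))"
      if ijk: "i \<noteq> j" "j \<noteq> k" "i \<noteq> k" for i j k s t x
    proof -
      have c: "elementary j k t * elementary i j s \<in> carrier (SL 4)"
        using ijk by (intro SL_mult_closed elementary_carrier)
      show ?thesis
        unfolding X_X[OF ijk(1,2)] X_X[OF ijk(2,1)] elementary_chain[OF ijk]
          \<rho>f(2)[OF elementary_carrier[OF ijk(3)] c]
        using mat_action_mult[OF \<rho>f(4)[OF elementary_carrier[OF ijk(3)]] \<rho>f(4)[OF c]]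
        by (simp add: X_def mat_action_supported)
    qed
    show "X i j (int N) x = x" if "i \<noteq> j" for i j x
      using N(2)[OF that] by (simp add: X_def mat_action_one)
    show "linear_map_on ?S (X i j t)" for i j t
      using subspace_add[OF subspace] subspace_scale[OF subspace]
      by (auto simp: linear_map_on_def X_def mat_action_supported)
        (auto simp: mat_action_def fun_scale_def fun_eq_iff algebra_simps sum.distrib sum_distrib_left)
  qed (use N(1) subspace in auto)
  have "(\<lambda>i. if i = 0 then 1 else 0) \<in> ?S" using assms(2) by (simp add: supported_def)
  moreover have "(\<lambda>i. if i = 0 then 1 else 0 :: complex) \<noteq> (0 :: nat \<Rightarrow> complex)"
  proof
    assume "(\<lambda>i. if i = 0 then 1 else 0 :: complex) = (0 :: nat \<Rightarrow> complex)"
    from fun_cong[OF this, of 0] show False by simp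
  qed
  ultimately have "\<exists>v\<in>?S. v \<noteq> 0 \<and> (\<forall>t. X C0 C1 t v = v) \<and> (\<forall>t. X C1 C0 (8 * t) v = v)"
    using fixed_vector[OF rep] by simp
  then obtain v where "v \<in> ?S" "v \<noteq> 0" "\<forall>t. X C0 C1 t v = v" "\<forall>t. X C1 C0 (8 * t) v = v"
    by blast
  then show ?thesis using that by (simp add: X_def)
qed

text \<open>Conjugates of \<open>x_10(8)\<close> by powers of \<open>x_01(2)\<close>. On the projective line, with the coordinate \<open>z\<close> given by
first over second entry, \<open>x_10(8)\<close> maps the complement of \<open>\<bar>z\<bar> < 1\<close> into this interval. So
\<open>hyperbolic m\<close> does the same for the interval \<open>\<bar>z - 2 m\<bar> < 1\<close>, and these intervals are disjoint.\<close>

definition hyperbolic :: "nat \<Rightarrow> int mat" where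
  "hyperbolic m = elementary C0 C1 (2 * int m) * (elementary C1 C0 8 * elementary C0 C1 (- (2 * int m)))"

lemma hyperbolic_carrier: "hyperbolic m \<in> carrier (SL 4)"
  unfolding hyperbolic_def by (intro SL_mult_closed elementary_carrier) auto

lemma hyperbolic_mult_index:
  assumes A: "A \<in> carrier_mat 4 4" and j: "j < 4"
  shows "(hyperbolic m * A) $$ (0, j) = (A $$ (0, j) - 2 * int m * A $$ (1, j)) +
      2 * int m * (hyperbolic m * A) $$ (1, j)"
    and "(hyperbolic m * A) $$ (1, j) = A $$ (1, j) + 8 * (A $$ (0, j) - 2 * int m * A $$ (1, j))"
proof -
  let ?x = "elementary C0 C1 (- (2 * int m))" and ?y = "elementary C1 C0 8" and ?z = "elementary C0 C1 (2 * int m)"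
  have c: "elementary i j t \<in> carrier_mat 4 4" for i j t by (simp add: elementary_def)
  have xA: "?x * A \<in> carrier_mat 4 4" by (rule mult_carrier_mat[OF c A])
  then have yxA: "?y * (?x * A) \<in> carrier_mat 4 4" by (rule mult_carrier_mat[OF c])
  have h: "hyperbolic m * A = ?z * (?y * (?x * A))"
    unfolding hyperbolic_def assoc_mult_mat[OF c mult_carrier_mat[OF c c] A] assoc_mult_mat[OF c c A] ..
  have "(?x * A) $$ (0, j) = A $$ (0, j) - 2 * int m * A $$ (1, j)" "(?x * A) $$ (1, j) = A $$ (1, j)"
    unfolding elementary_def using A j by (simp_all add: transvection_mult_index del: index_mult_mat(1))
  moreover have "(?y * (?x * A)) $$ (0, j) = (?x * A) $$ (0, j)"
    "(?y * (?x * A)) $$ (1, j) = 8 * (?x * A) $$ (0, j) + (?x * A) $$ (1, j)"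
    unfolding elementary_def[of C1 C0] using xA j by (simp_all add: transvection_mult_index del: index_mult_mat(1))
  moreover have "(?z * (?y * (?x * A))) $$ (0, j) = 2 * int m * (?y * (?x * A)) $$ (1, j) + (?y * (?x * A)) $$ (0, j)"
    "(?z * (?y * (?x * A))) $$ (1, j) = (?y * (?x * A)) $$ (1, j)"
    unfolding elementary_def[of C0 C1 "2 * int m"] using yxA j
    by (simp_all add: transvection_mult_index del: index_mult_mat(1))
  ultimately show "(hyperbolic m * A) $$ (0, j) = (A $$ (0, j) - 2 * int m * A $$ (1, j)) +
      2 * int m * (hyperbolic m * A) $$ (1, j)"
    "(hyperbolic m * A) $$ (1, j) = A $$ (1, j) + 8 * (A $$ (0, j) - 2 * int m * A $$ (1, j))"
    unfolding h by simp_all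
qed

lemma inj_hyperbolic: "inj hyperbolic"
proof (rule injI)
  have *: "hyperbolic m $$ (0, 0) = 1 + 16 * int m" for m
  proof -
    have "hyperbolic m \<in> carrier_mat 4 4" using hyperbolic_carrier[of m] by (simp add: SL_def)
    then have eq: "hyperbolic m * 1\<^sub>m 4 = hyperbolic m" by (rule right_mult_one_mat)
    have idx: "hyperbolic m $$ (0, 0) = 1 + 2 * int m * hyperbolic m $$ (1, 0)" "hyperbolic m $$ (1, 0) = 8"
      using hyperbolic_mult_index[OF one_carrier_mat, of 0 m] unfolding eq by simp_all
    show ?thesis using idx(1) unfolding idx(2) by simp
  qed
  fix m k assume "hyperbolic m = hyperbolic k"
  then have "1 + 16 * int m = 1 + 16 * int k" unfolding *[symmetric] by (rule arg_cong)
  then show "m = k" by simp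
qed

text \<open>The first column whose upper two entries do not both vanish. Matrices that act on the first
two coordinates from the left do not change it, so it turns the action on the group into
the action on nonzero vectors of length two.\<close>

definition lead_col :: "int mat \<Rightarrow> nat" where
  "lead_col A = (LEAST j. A $$ (0, j) \<noteq> 0 \<or> A $$ (1, j) \<noteq> 0)"

definition sector :: "nat \<Rightarrow> int mat set" where
  "sector m = {A. \<bar>A $$ (0, lead_col A) - 2 * int m * A $$ (1, lead_col A)\<bar> < \<bar>A $$ (1, lead_col A)\<bar>}"

lemma lead_col:
  assumes "A \<in> carrier (SL 4)"
  shows "lead_col A < 4" "A $$ (0, lead_col A) \<noteq> 0 \<or> A $$ (1, lead_col A) \<noteq> 0"
proof -
  have A: "A \<in> carrier_mat 4 4" "det A = 1" using assms by (auto simp: SL_def)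
  note adj = adj_mat[OF A(1)]
  have "\<exists>j<4. A $$ (0, j) \<noteq> 0"
  proof (rule ccontr)
    assume "\<not> ?thesis"
    then have "(A * adj_mat A) $$ (0, 0) = 0"
      using A(1) adj(1) by (simp add: scalar_prod_def)
    moreover have "(A * adj_mat A) $$ (0, 0) = 1" using adj(2) A(2) by simp
    ultimately show False by simp
  qed
  then obtain j where j: "j < 4" "A $$ (0, j) \<noteq> 0 \<or> A $$ (1, j) \<noteq> 0" by blast
  show "A $$ (0, lead_col A) \<noteq> 0 \<or> A $$ (1, lead_col A) \<noteq> 0"
    unfolding lead_col_def by (rule LeastI) (rule j(2))
  have "lead_col A \<le> j" unfolding lead_col_def by (rule Least_le) (rule j(2))
  then show "lead_col A < 4" using j(1) by simp
qed

lemma lead_col_hyperbolic: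
  assumes "A \<in> carrier (SL 4)"
  shows "lead_col (hyperbolic m * A) = lead_col A"
proof -
  have A: "A \<in> carrier_mat 4 4" using assms by (auto simp: SL_def)
  have gA: "hyperbolic m * A \<in> carrier (SL 4)" by (intro SL_mult_closed hyperbolic_carrier assms)
  have iff: "(hyperbolic m * A) $$ (0, j) = 0 \<and> (hyperbolic m * A) $$ (1, j) = 0 \<longleftrightarrow>
      A $$ (0, j) = 0 \<and> A $$ (1, j) = 0" if "j < 4" for j
    using hyperbolic_mult_index[OF A that, of m] by auto
  show ?thesis
  proof (rule antisym)
    show "lead_col (hyperbolic m * A) \<le> lead_col A"
      unfolding lead_col_def[of "hyperbolic m * A"]
      by (rule Least_le) (use iff[OF lead_col(1)[OF assms]] lead_col(2)[OF assms] in blast)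
    show "lead_col A \<le> lead_col (hyperbolic m * A)"
      unfolding lead_col_def[of A]
      by (rule Least_le) (use iff[OF lead_col(1)[OF gA]] lead_col(2)[OF gA] in blast)
  qed
qed

lemma hyperbolic_ping_pong:
  assumes "A \<in> carrier (SL 4)" "A \<notin> sector m"
  shows "hyperbolic m * A \<in> sector m"
proof -
  have A: "A \<in> carrier_mat 4 4" using assms by (auto simp: SL_def)
  let ?j = "lead_col A"
  have "A $$ (0, ?j) - 2 * int m * A $$ (1, ?j) \<noteq> 0"
    using assms(2) lead_col(2)[OF assms(1)] by (auto simp: sector_def)
  then show ?thesis
    using assms(2) hyperbolic_mult_index[OF A lead_col(1)[OF assms(1)], of m]
    unfolding sector_def by (simp add: lead_col_hyperbolic[OF assms(1)])
qed

lemma sectors_disjoint: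
  assumes "m \<noteq> k"
  shows "sector m \<inter> sector k = {}"
proof -
  have False if "\<bar>x - 2 * int m * y\<bar> < \<bar>y\<bar>" "\<bar>x - 2 * int k * y\<bar> < \<bar>y\<bar>" for x y :: int
  proof -
    have "\<bar>2 * (int m - int k) * y\<bar> < 2 * \<bar>y\<bar>" using that by (simp add: algebra_simps)
    moreover have "2 * \<bar>y\<bar> \<le> \<bar>2 * (int m - int k) * y\<bar>"
      using assms unfolding abs_mult by (intro mult_right_mono) auto
    ultimately show False by simp
  qed
  then show ?thesis unfolding sector_def by blast
qed

lemma hyperbolic_sum_regular_norm:
  "operator_norm (ell2 (SL 4)) (ell2_norm (SL 4))
     (left_regular_extend (SL 4) (\<lambda>g. if g \<in> hyperbolic ` {..<5} then 1 else 0)) \<le> 2 * sqrt 5"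
proof -
  let ?A = "\<lambda>g. sector (inv_into UNIV hyperbolic g)"
  have A: "?A (hyperbolic m) = sector m" for m using inj_hyperbolic by simp
  have "operator_norm (ell2 (SL 4)) (ell2_norm (SL 4))
     (left_regular_extend (SL 4) (\<lambda>g. if g \<in> hyperbolic ` {..<5} then 1 else 0))
     \<le> 2 * sqrt (real (card (hyperbolic ` {..<5})))"
  proof (rule ping_pong_operator_norm[where A = ?A, OF group_SL])
    show "hyperbolic ` {..<5} \<subseteq> carrier (SL 4)" using hyperbolic_carrier by blast
    show "?A g \<inter> ?A h = {}" if "g \<in> hyperbolic ` {..<5}" "h \<in> hyperbolic ` {..<5}" "g \<noteq> h" for g h
    proof -
      from that obtain m k where "g = hyperbolic m" "h = hyperbolic k" "m \<noteq> k" by blast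
      then show ?thesis using A sectors_disjoint[of m k] by simp
    qed
    show "g \<otimes>\<^bsub>SL 4\<^esub> x \<in> ?A g" if "g \<in> hyperbolic ` {..<5}" "x \<in> carrier (SL 4)" "x \<notin> ?A g" for g x
      using that A hyperbolic_ping_pong[of x] by (auto simp: SL_def)
  qed simp
  moreover have "card (hyperbolic ` {..<5}) = 5"
    using inj_hyperbolic by (simp add: card_image inj_on_subset)
  ultimately show ?thesis by simp
qed

text \<open>\<open>v\<close> is an eigenvector of the sum with eigenvalue \<open>card T\<close>.\<close>

lemma operator_norm_ge_card:
  assumes "finite T" "\<And>g. g \<in> T \<Longrightarrow> \<rho> g \<in> carrier_mat n n"
    and v: "v \<in> supported n" "v \<noteq> 0" and fixed: "\<And>g. g \<in> T \<Longrightarrow> mat_action n (\<rho> g) v = v"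
  shows "real (card T) \<le> mat_operator_norm n (rep_extend n \<rho> (\<lambda>g. if g \<in> T then 1 else 0))"
proof -
  let ?A = "rep_extend n \<rho> (\<lambda>g. if g \<in> T then 1 else 0)"
  have T: "{g. (if g \<in> T then 1 else 0 :: complex) \<noteq> 0} = T" by auto
  have Ac: "?A \<in> carrier_mat n n" by (simp add: rep_extend_def)
  define r where "r = sqrt (\<Sum>i<n. (cmod (v i))\<^sup>2)"
  obtain i where "v i \<noteq> 0" using v(2) by (auto simp: fun_eq_iff)
  moreover from this have "i < n" using v(1) by (metis (mono_tags, lifting) mem_Collect_eq not_le supported_def)
  ultimately have "(\<Sum>i<n. (cmod (v i))\<^sup>2) > 0"
    by (intro sum_pos2[of _ i]) auto
  then have r: "r > 0" "r\<^sup>2 = (\<Sum>i<n. (cmod (v i))\<^sup>2)" by (simp_all add: r_def)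
  define w where "w = Matrix.vec n (\<lambda>i. v i / of_real r)"
  have Aw: "(?A *\<^sub>v w) $ i = of_nat (card T) * (v i / of_real r)" if i: "i < n" for i
  proof -
    have "(?A *\<^sub>v w) $ i = (\<Sum>j<n. (\<Sum>g\<in>T. \<rho> g $$ (i, j)) * (v j / of_real r))"
      using i by (simp add: rep_extend_def w_def scalar_prod_def atLeast0LessThan T)
    also have "\<dots> = (\<Sum>g\<in>T. (\<Sum>j<n. \<rho> g $$ (i, j) * v j) / of_real r)"
      by (simp add: sum_distrib_right sum_divide_distrib) (rule sum.swap)
    also have "\<dots> = (\<Sum>g\<in>T. v i / of_real r)"
    proof (intro sum.cong refl)
      fix g assume "g \<in> T"
      from fun_cong[OF fixed[OF this], of i] show "(\<Sum>j<n. \<rho> g $$ (i, j) * v j) / of_real r = v i / of_real r"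
        using i by (simp add: mat_action_def)
    qed
    finally show ?thesis by simp
  qed
  have w_norm: "(\<Sum>i<n. (cmod (v i / of_real r))\<^sup>2) = 1"
    using r(1) by (simp add: norm_divide power_divide r(2)[symmetric] flip: sum_divide_distrib)
  have "vec_norm2 w = 1" using w_norm by (simp add: vec_norm2_def w_def)
  moreover have "vec_norm2 (?A *\<^sub>v w) = real (card T)"
  proof -
    have "vec_norm2 (?A *\<^sub>v w) = sqrt (\<Sum>i<n. (cmod (of_nat (card T) * (v i / of_real r)))\<^sup>2)"
      using Ac Aw by (simp add: vec_norm2_def)
    also have "\<dots> = sqrt ((real (card T))\<^sup>2 * (\<Sum>i<n. (cmod (v i / of_real r))\<^sup>2))"
    proof -
      have "(cmod (of_nat (card T) * z))\<^sup>2 = (real (card T))\<^sup>2 * (cmod z)\<^sup>2" for z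
        by (simp add: norm_mult power_mult_distrib)
      then show ?thesis by (simp only: sum_distrib_left)
    qed
    finally show ?thesis unfolding w_norm by simp
  qed
  moreover have "w \<in> carrier_vec n" by (simp add: w_def)
  ultimately show ?thesis
    unfolding mat_operator_norm_def operator_norm_def
    using cSUP_upper[OF _ bdd_above_mat[OF Ac], of w] by simp
qed

lemma operator_norm_dim_zero: "mat_operator_norm 0 A = 0" if "A \<in> carrier_mat 0 0"
proof -
  have "Matrix.vec 0 (\<lambda>_. 0) \<in> {v \<in> carrier_vec 0. vec_norm2 v \<le> 1}"
    by (simp add: vec_norm2_def)
  then have "{v \<in> carrier_vec 0. vec_norm2 v \<le> 1} \<noteq> {}" by blast
  moreover have "vec_norm2 (A *\<^sub>v v) = 0" for v using that by (simp add: vec_norm2_def)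
  ultimately show ?thesis by (simp add: mat_operator_norm_def operator_norm_def)
qed

theorem corollary1p3:
  shows "\<not> purely_matricial_field (SL 4)"
proof
  assume "purely_matricial_field (SL 4)"
  then obtain d :: "nat \<Rightarrow> nat" and \<rho> where rep: "\<And>i. unitary_rep (SL 4) (d i) (\<rho> i)"
    and conv: "strongly_converges_to_regular (SL 4) d \<rho>"
    unfolding purely_matricial_field_def by blast
  let ?ind = "\<lambda>T g. if g \<in> T then 1 else 0 :: complex"
  let ?N = "\<lambda>T i. mat_operator_norm (d i) (rep_extend (d i) (\<rho> i) (?ind T))"
  let ?L = "\<lambda>T. operator_norm (ell2 (SL 4)) (ell2_norm (SL 4)) (left_regular_extend (SL 4) (?ind T))"
  have lim: "?N T \<longlonglongrightarrow> ?L T" if "finite T" "T \<subseteq> carrier (SL 4)" for T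
    using conv that unfolding strongly_converges_to_regular_def group_algebra_def by simp
  let ?one = "{\<one>\<^bsub>SL 4\<^esub>}" and ?T = "hyperbolic ` {..<5}"
  have one: "?one \<subseteq> carrier (SL 4)" by (simp add: SL_def)
  have T: "?T \<subseteq> carrier (SL 4)" using hyperbolic_carrier by blast
  have "0 < ?L ?one" using operator_norm_identity[OF group_SL[of 4]] by simp
  then have ev1: "\<forall>\<^sub>F i in sequentially. 0 < ?N ?one i"
    using order_tendstoD(1)[OF lim[OF _ one]] by simp
  have "sqrt 5 < sqrt ((5 / 2)\<^sup>2)" unfolding real_sqrt_less_iff by (simp add: power2_eq_square)
  then have "?L ?T < 5" using hyperbolic_sum_regular_norm by simp
  then have ev2: "\<forall>\<^sub>F i in sequentially. ?N ?T i < 5"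
    using order_tendstoD(2)[OF lim[OF _ T]] by simp
  obtain i where i: "0 < ?N ?one i" "?N ?T i < 5"
    using eventually_happens'[OF sequentially_bot eventually_conj[OF ev1 ev2]] by blast
  \<comment> \<open>Dimension zero is excluded by the identity, whose norm in the regular representation is not zero.\<close>
  have "d i > 0"
  proof (rule ccontr)
    assume "\<not> d i > 0"
    then show False using i(1) operator_norm_dim_zero by (simp add: rep_extend_def)
  qed
  obtain v where v: "v \<in> supported (d i)" "v \<noteq> 0"
    "\<And>t. mat_action (d i) (\<rho> i (elementary C0 C1 t)) v = v" "\<And>t. mat_action (d i) (\<rho> i (elementary C1 C0 (8 * t))) v = v"
    by (rule elementary_fixed_vector[OF rep \<open>d i > 0\<close>]) blast
  note \<rho>f = rep_facts[OF rep[of i]]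
  have "mat_action (d i) (\<rho> i (hyperbolic m)) v = v" for m
  proof -
    have e: "elementary C0 C1 t \<in> carrier (SL 4)" "elementary C1 C0 t \<in> carrier (SL 4)" for t
      by (intro elementary_carrier; simp)+
    have comp: "mat_action (d i) (\<rho> i (A * B)) f = mat_action (d i) (\<rho> i A) (mat_action (d i) (\<rho> i B) f)"
      if "A \<in> carrier (SL 4)" "B \<in> carrier (SL 4)" for A B f
      unfolding \<rho>f(2)[OF that] by (rule mat_action_mult[OF \<rho>f(4)[OF that(1)] \<rho>f(4)[OF that(2)]])
    show ?thesis
      unfolding hyperbolic_def comp[OF e(1) SL_mult_closed[OF e(2,1)]] comp[OF e(2,1)]
      using v(3) v(4)[of 1] by simp
  qed
  then have "real (card ?T) \<le> ?N ?T i"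
    using hyperbolic_carrier \<rho>f(4) v(1,2) by (intro operator_norm_ge_card[where v = v]) auto
  moreover have "card ?T = 5"
    using inj_hyperbolic by (simp add: card_image inj_on_subset)
  ultimately show False using i(2) by simp
qed

end
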